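(* Let $\mathbf{B}$ be a real separable Banach space. (i) If $\mathbf{B}$ is both of cotype $2$ and of type $2$, then for every $\mathbf{B}$-valued random variable $X$ the following three conditions are equivalent: $X \in \mathrm{CLT}$; $X \in \mathrm{CLTSS}$; $\mathbb{E}X = 0$ and $\mathbb{E}\|X\|^{2} < \infty$. (ii) If $\mathbf{B}$ is of cotype $2$ but not of type $2$, then for every $\mathbf{B}$-valued random variable $X$, $$X \in \mathrm{CLT} \iff X \in \mathrm{CLTSS}, \qquad\text{and}\qquad X \in \mathrm{CLTSS} \implies \big(\mathbb{E}X = 0 \text{ and } \mathbb{E}\|X\|^{2} < \infty\big),$$ while the converse of the last implication fails: there exists a $\mathbf{B}$-valued random variable $X$ with $\mathbb{E}X = 0$ and $\mathbb{E}\|X\|^{2} < \infty$ such that $X \notin \mathrm{CLTSS}$ (equivalently, $X \notin \mathrm{CLT}$).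
   Context: $(\mathbf{B},\|\cdot\|)$ is a real separable Banach space with its Borel $\sigma$-algebra. A $\mathbf{B}$-valued random variable is a measurable map from a probability space $(\Omega,\mathcal{F},\mathbb{P})$ into $\mathbf{B}$; the probability space is complete and assumed rich enough to carry all random variables considered. Given a $\mathbf{B}$-valued random variable $X$, let $X_1, X_2, \dots$ be i.i.d. copies of $X$ and $S_n = \sum_{i=1}^n X_i$. $\mathbb{N}$ is the set of positive integers; a subsequence $\{m_n; n\in\mathbb{N}\}$ of $\mathbb{N}$ is a strictly increasing sequence of positive integers. $X \in \mathrm{CLT}$ means: $(S_n/\sqrt{n})_{n \in \mathbb{N}}$ converges weakly (in distribution, to some $\mathbf{B}$-valued random variable). $X \in \mathrm{CLTSS}$ means: there exists a subsequence $\{m_n; n \in \mathbb{N}\}$ of $\mathbb{N}$ such that $(S_{m_n}/\sqrt{m_n})_{n \in \mathbb{N}}$ converges weakly (to some $\mathbf{B}$-valued random variable). Let $(\varepsilon_i)$ be i.i.d. Rademacher signs ($\mathbb{P}(\varepsilon_i=\pm1)=1/2$). $\mathbf{B}$ is of type $2$ if there is a constant $C<\infty$ such that $\mathbb{E}\big\|\sum_{i=1}^k \varepsilon_i x_i\big\|^2 \le C\sum_{i=1}^k \|x_i\|^2$ for all $k$ and all $x_1,\dots,x_k\in\mathbf{B}$; $\mathbf{B}$ is of cotype $2$ if there is a constant $C<\infty$ such that $\sum_{i=1}^k \|x_i\|^2 \le C\,\mathbb{E}\big\|\sum_{i=1}^k \varepsilon_i x_i\big\|^2$ for all $k$ and all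 $x_1,\dots,x_k\in\mathbf{B}$. *)

theory Defs
  imports "HOL-Probability.Probability"
begin

text \<open>
  Throughout, separable Banach spaces are rendered by the sort
  \<open>{banach, second_countable_topology}\<close>: a metric space is separable iff it is second countable.
\<close>

text \<open>
  \<open>rademacher k\<close> is the joint law of \<open>k\<close> independent fair signs, indexed by \<open>i < k\<close>
  (the default value \<open>0\<close> outside this range is never used).
\<close>

definition rademacher :: "nat \<Rightarrow> (nat \<Rightarrow> real) pmf" where
  "rademacher k = Pi_pmf {..<k} 0 (\<lambda>_. pmf_of_set {-1, 1})"

definition rademacher_moment :: "nat \<Rightarrow> (nat \<Rightarrow> 'b::real_normed_vector) \<Rightarrow> real" where
  "rademacher_moment k x =
     measure_pmf.expectation (rademacher k) (\<lambda>\<epsilon>. (norm (\<Sum>i<k. \<epsilon> i *\<^sub>R x i))\<^sup>2)"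

definition type2 :: "'b::real_normed_vector itself \<Rightarrow> bool" where
  "type2 _ \<longleftrightarrow>
     (\<exists>C::real. \<forall>k. \<forall>x::nat \<Rightarrow> 'b. rademacher_moment k x \<le> C * (\<Sum>i<k. (norm (x i))\<^sup>2))"

definition cotype2 :: "'b::real_normed_vector itself \<Rightarrow> bool" where
  "cotype2 _ \<longleftrightarrow>
     (\<exists>C::real. \<forall>k. \<forall>x::nat \<Rightarrow> 'b. (\<Sum>i<k. (norm (x i))\<^sup>2) \<le> C * rademacher_moment k x)"

text \<open>
  The library's \<open>weak_conv_m\<close> is stated through distribution functions and covers only
  measures on the real line.
\<close>

definition weakly_converges :: "(nat \<Rightarrow> 'b::topological_space measure) \<Rightarrow> 'b measure \<Rightarrow> bool" where
  "weakly_converges \<mu> \<nu> \<longleftrightarrow>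
     (\<forall>f::'b \<Rightarrow> real. continuous_on UNIV f \<longrightarrow> bounded (range f) \<longrightarrow>
        (\<lambda>n. \<integral>x. f x \<partial>\<mu> n) \<longlonglongrightarrow> (\<integral>x. f x \<partial>\<nu>))"

text \<open>
  The limiting random variable is represented by its law \<open>\<nu>\<close>; any Borel probability measure is
  the law of a random variable, namely of the identity.
\<close>

definition converges_in_distribution ::
  "'c measure \<Rightarrow> (nat \<Rightarrow> 'c \<Rightarrow> 'b::topological_space) \<Rightarrow> bool" where
  "converges_in_distribution N Z \<longleftrightarrow>
     (\<exists>\<nu>. prob_space \<nu> \<and> sets \<nu> = sets borel \<and>
        weakly_converges (\<lambda>n. distr N borel (Z n)) \<nu>)"

definition iid_copies ::
  "'a measure \<Rightarrow> ('a \<Rightarrow> 'b::topological_space) \<Rightarrow> 'c measure \<Rightarrow> (nat \<Rightarrow> 'c \<Rightarrow> 'b) \<Rightarrow> bool" where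
  "iid_copies M X N Y \<longleftrightarrow>
     prob_space N \<and> prob_space.indep_vars N (\<lambda>_. borel) Y UNIV \<and>
     (\<forall>i. distr N borel (Y i) = distr M borel X)"

text \<open>
  The canonical i.i.d. copies of \<open>X\<close> are the coordinates on the infinite power of the law of \<open>X\<close>.
\<close>

definition iid_space :: "'a measure \<Rightarrow> ('a \<Rightarrow> 'b::topological_space) \<Rightarrow> (nat \<Rightarrow> 'b) measure" where
  "iid_space M X = (\<Pi>\<^sub>M i\<in>UNIV. distr M borel X)"

definition normalized_sum :: "(nat \<Rightarrow> 'c \<Rightarrow> 'b::real_normed_vector) \<Rightarrow> nat \<Rightarrow> 'c \<Rightarrow> 'b" where
  "normalized_sum Y n \<omega> = (1 / sqrt (real n)) *\<^sub>R (\<Sum>i<n. Y i \<omega>)"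

definition CLT :: "'a measure \<Rightarrow> ('a \<Rightarrow> 'b::{banach,second_countable_topology}) \<Rightarrow> bool" where
  "CLT M X \<longleftrightarrow>
     converges_in_distribution (iid_space M X) (\<lambda>n. normalized_sum (\<lambda>i \<omega>. \<omega> i) n)"

definition CLTSS :: "'a measure \<Rightarrow> ('a \<Rightarrow> 'b::{banach,second_countable_topology}) \<Rightarrow> bool" where
  "CLTSS M X \<longleftrightarrow>
     (\<exists>m::nat \<Rightarrow> nat. strict_mono m \<and> (\<forall>n. 0 < m n) \<and>
        converges_in_distribution (iid_space M X) (\<lambda>n. normalized_sum (\<lambda>i \<omega>. \<omega> i) (m n)))"

text \<open>
  The coordinates are indeed i.i.d. copies of \<open>X\<close>, and both notions can be tested on any other
  sequence of i.i.d. copies, on any probability space.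
\<close>

lemma iid_copies_coordinates:
  fixes X :: "'a \<Rightarrow> 'b::topological_space"
  assumes "prob_space M" and X: "X \<in> borel_measurable M"
  shows "iid_copies M X (iid_space M X) (\<lambda>i \<omega>. \<omega> i)"
proof -
  define D where "D = distr M borel X"
  have D: "prob_space D" unfolding D_def using assms by (intro prob_space.prob_space_distr)
  have sD[measurable_cong, simp]: "sets D = sets borel" by (simp add: D_def)
  interpret P: prob_space "\<Pi>\<^sub>M i\<in>(UNIV::nat set). D"
    using D by (intro prob_space_PiM)
  have comp: "distr (\<Pi>\<^sub>M i\<in>(UNIV::nat set). D) borel (\<lambda>\<omega>. \<omega> i) = D" for i
  proof -
    have "distr (\<Pi>\<^sub>M i\<in>(UNIV::nat set). D) borel (\<lambda>\<omega>. \<omega> i) =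
          distr (\<Pi>\<^sub>M i\<in>(UNIV::nat set). D) D (\<lambda>\<omega>. \<omega> i)"
      by (intro distr_cong) auto
    also have "\<dots> = D" using D by (intro distr_PiM_component) auto
    finally show ?thesis .
  qed
  have "P.indep_vars (\<lambda>_. borel) (\<lambda>i \<omega>. \<omega> i) UNIV"
  proof (subst P.indep_vars_iff_distr_eq_PiM)
    show "(\<lambda>\<omega>. \<omega> i) \<in> borel_measurable (\<Pi>\<^sub>M i\<in>(UNIV::nat set). D)" for i
      by measurable
    have "distr (\<Pi>\<^sub>M i\<in>(UNIV::nat set). D) (\<Pi>\<^sub>M i\<in>UNIV. borel) (\<lambda>\<omega>. \<lambda>i\<in>UNIV. \<omega> i) =
          distr (\<Pi>\<^sub>M i\<in>(UNIV::nat set). D) (\<Pi>\<^sub>M i\<in>UNIV. D) (\<lambda>\<omega>. \<omega>)"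
      by (intro distr_cong sets_PiM_cong) auto
    then show "distr (\<Pi>\<^sub>M i\<in>(UNIV::nat set). D) (\<Pi>\<^sub>M i\<in>UNIV. borel) (\<lambda>\<omega>. \<lambda>i\<in>UNIV. \<omega> i) =
      (\<Pi>\<^sub>M i\<in>UNIV. distr (\<Pi>\<^sub>M i\<in>(UNIV::nat set). D) borel (\<lambda>\<omega>. \<omega> i))"
      by (simp add: comp distr_id)
  qed simp
  with comp show ?thesis
    unfolding iid_copies_def iid_space_def D_def[symmetric] using P.prob_space_axioms by auto
qed

lemma distr_normalized_sum_iid:
  fixes X :: "'a \<Rightarrow> 'b::{banach,second_countable_topology}"
  assumes "iid_copies M X N Y"
  shows "distr N borel (normalized_sum Y n) =
         distr (iid_space M X) borel (normalized_sum (\<lambda>i \<omega>. \<omega> i) n)"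
proof -
  interpret N: prob_space N using assms by (simp add: iid_copies_def)
  have ind: "N.indep_vars (\<lambda>_. borel) Y UNIV" and
    law: "\<And>i. distr N borel (Y i) = distr M borel X"
    using assms by (auto simp: iid_copies_def)
  have Y[measurable]: "Y i \<in> borel_measurable N" for i
    using ind by (auto simp: N.indep_vars_def)
  have joint: "distr N (\<Pi>\<^sub>M i\<in>UNIV. borel) (\<lambda>x. \<lambda>i\<in>UNIV. Y i x) = iid_space M X"
    using N.indep_vars_iff_distr_eq_PiM[of UNIV Y "\<lambda>_. borel"] ind law
    by (simp add: iid_space_def)
  have "distr (iid_space M X) borel (normalized_sum (\<lambda>i \<omega>. \<omega> i) n) =
        distr N borel (normalized_sum (\<lambda>i \<omega>. \<omega> i) n \<circ> (\<lambda>x. \<lambda>i\<in>UNIV. Y i x))"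
    unfolding joint[symmetric]
    by (intro distr_distr) (unfold normalized_sum_def, measurable)
  also have "normalized_sum (\<lambda>i \<omega>. \<omega> i) n \<circ> (\<lambda>x. \<lambda>i\<in>UNIV. Y i x) = normalized_sum Y n"
    by (auto simp: normalized_sum_def)
  finally show ?thesis by simp
qed

lemma CLT_iff_iid_copies:
  assumes "iid_copies M X N Y"
  shows "CLT M X \<longleftrightarrow> converges_in_distribution N (\<lambda>n. normalized_sum Y n)"
  by (simp add: CLT_def converges_in_distribution_def distr_normalized_sum_iid[OF assms])

lemma CLTSS_iff_iid_copies:
  assumes "iid_copies M X N Y"
  shows "CLTSS M X \<longleftrightarrow>
     (\<exists>m::nat \<Rightarrow> nat. strict_mono m \<and> (\<forall>n. 0 < m n) \<and>
        converges_in_distribution N (\<lambda>n. normalized_sum Y (m n)))"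
  by (simp add: CLTSS_def converges_in_distribution_def distr_normalized_sum_iid[OF assms])

end

(*
If X satisfies the CLT along a subsequence, then the sums S_m are stochastically bounded at scale
sqrt m along that subsequence.  Cut S_m into k independent symmetrized blocks Y_i of length n.
Hypercontractivity of Rademacher averages turns boundedness in probability into a second moment
bound, cotype 2 bounds the sum of the |Y_i|^2 by a multiple of m, and the law of large numbers for
the truncated |Y_i|^2 then gives E |S_n|^2 <= K n for every n.  With n = 1 this is E |X|^2 < infinity,
and the bound E |S_n - n E X|^2 <= K n forces E X = 0.

For the full CLT, expand X in an orthonormal system e_k of L^2 obtained by Gram-Schmidt from
indicators of cylinder sets, with coefficients x_k = E (e_k X).  The partial sums A_l of length 2^l
are conditional expectations, and by the multivariate CLT the normalized sums of A_l' - A_l converge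
to the sum of g_k x_k over the block, with independent standard normal g_k.  It suffices that
E |S_n (X - A_l)|^2 / n is small uniformly in n for large l.  In type 2 this is immediate
from A_l -> X in L^2.  In cotype 2 the Gaussian blocks have second moments of bounded sum, hence the
Gaussian series is Cauchy, and the first step applied to A_l' - A_l carries this over to the sums.

If the space is not of type 2, mix countably many blocks of vectors y_i with small sum of |y_i|^2 and
large Rademacher average: a CLT along a subsequence would bound E |sum of g_i y_i|^2 uniformly over
the blocks.
*)

theory Submission
  imports Defs "HOL-Real_Asymp.Real_Asymp" "HOL-Library.Nat_Bijection"
begin

section \<open>Partial sums of independent variables\<close>

text \<open>No moment of X is known at the outset. Truncating |Y_i|^2 and choosing a single
  favourable outcome gives a bound that survives the removal of the truncation. Infinitely many m
  suffice because, for fixed n, a large m contains k blocks of length n with m \<le> 2 k n; this is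
  how a subsequence controls all n.

  The limit law is constructed, not extracted by compactness: along a subsequence the Gaussian
  partial sums converge almost surely, and Lipschitz test functions identify the law of their limit
  as that of the normalized sums. Length 2^l matters because the conditional Jensen inequality then
  moves second moment bounds from X - A_l to A_l' - A_l in every Banach space. In cotype 2 the
  estimate goes round deliberately: sums of X bound the Gaussian blocks, cotype 2 makes late blocks
  small, and small blocks bound the sums of A_l' - A_l.

  Comparisons of sums of independent variables reduce to one summand under an arbitrary shift s,
  which is why s occurs in so many statements.\<close>

abbreviation iid_seq :: "'a measure \<Rightarrow> (nat \<Rightarrow> 'a) measure" where
  "iid_seq M \<equiv> PiM UNIV (\<lambda>_::nat. M)"

abbreviation second_moment :: "'a measure \<Rightarrow> ('a \<Rightarrow> 'b::real_normed_vector) \<Rightarrow> ennreal" where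
  "second_moment M u \<equiv> \<integral>\<^sup>+x. ennreal ((norm (u x))\<^sup>2) \<partial>M"

text \<open>The summand may depend on its index: Gaussian and Rademacher series have varying
  coefficients, and inductions that split off the first variable pass from \<open>h\<close> to
  \<open>\<lambda>i. h (Suc i)\<close>.\<close>

definition psum :: "(nat \<Rightarrow> 'a \<Rightarrow> 'b::real_normed_vector) \<Rightarrow> nat \<Rightarrow> (nat \<Rightarrow> 'a) \<Rightarrow> 'b" where
  "psum h n \<omega> = (\<Sum>i<n. h i (\<omega> i))"

lemma prob_space_iid_seq: "prob_space M \<Longrightarrow> prob_space (iid_seq M)"
  by (intro prob_space_PiM)

lemma iid_seq_component:
  "prob_space M \<Longrightarrow> distr (iid_seq M) M (\<lambda>\<omega>. \<omega> i) = M"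
  by (intro distr_PiM_component) auto

lemma nn_integral_iid_seq_component:
  assumes "prob_space M" and [measurable]: "f \<in> borel_measurable M"
  shows "(\<integral>\<^sup>+\<omega>. f (\<omega> i) \<partial>iid_seq M) = (\<integral>\<^sup>+x. f x \<partial>M)"
  by (subst iid_seq_component[OF assms(1), of i, symmetric], subst nn_integral_distr) auto

lemma nn_integral_iid_seq_Suc:
  assumes "prob_space M" and [measurable]: "F \<in> borel_measurable (iid_seq M)"
  shows "(\<integral>\<^sup>+\<omega>. F \<omega> \<partial>iid_seq M) = (\<integral>\<^sup>+x. \<integral>\<^sup>+\<omega>. F (case_nat x \<omega>) \<partial>iid_seq M \<partial>M)"
proof -
  interpret M: prob_space M by fact
  interpret sequence_space M ..
  have "(\<integral>\<^sup>+\<omega>. F \<omega> \<partial>S) = (\<integral>\<^sup>+\<omega>. F \<omega> \<partial>distr (M \<Otimes>\<^sub>M S) S (\<lambda>(s, \<omega>). case_nat s \<omega>))"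
    by (simp add: PiM_iter)
  also have "\<dots> = (\<integral>\<^sup>+p. F (case p of (s, \<omega>) \<Rightarrow> case_nat s \<omega>) \<partial>(M \<Otimes>\<^sub>M S))"
    by (subst nn_integral_distr) auto
  also have "\<dots> = (\<integral>\<^sup>+x. \<integral>\<^sup>+\<omega>. F (case_nat x \<omega>) \<partial>S \<partial>M)"
    by (subst P.nn_integral_fst[symmetric]) auto
  finally show ?thesis .
qed

lemma psum_case_nat: "psum h (Suc n) (case_nat x \<omega>) = h 0 x + psum (\<lambda>i. h (Suc i)) n \<omega>"
  unfolding psum_def by (subst sum.lessThan_Suc_shift) simp

lemma measurable_psum[measurable]:
  fixes h :: "nat \<Rightarrow> 'a \<Rightarrow> 'b::{real_normed_vector,second_countable_topology}"
  assumes [measurable]: "\<And>i. h i \<in> borel_measurable M"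
  shows "psum h n \<in> borel_measurable (iid_seq M)"
  unfolding psum_def by measurable

context
  fixes M :: "'a measure" and h :: "nat \<Rightarrow> 'a \<Rightarrow> 'b::{real_normed_vector,second_countable_topology}"
    and F :: "'b \<Rightarrow> ennreal"
  assumes M: "prob_space M" and h[measurable]: "\<And>i. h i \<in> borel_measurable M"
    and F[measurable]: "F \<in> borel_measurable borel"
begin

lemma nn_integral_psum_0: "(\<integral>\<^sup>+\<omega>. F (s + psum h 0 \<omega>) \<partial>iid_seq M) = F s"
proof -
  interpret S: prob_space "iid_seq M" using M by (rule prob_space_iid_seq)
  show ?thesis by (simp add: psum_def S.emeasure_space_1)
qed

lemma nn_integral_psum_Suc:
  "(\<integral>\<^sup>+\<omega>. F (s + psum h (Suc n) \<omega>) \<partial>iid_seq M) =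
   (\<integral>\<^sup>+x. \<integral>\<^sup>+\<omega>. F (s + h 0 x + psum (\<lambda>i. h (Suc i)) n \<omega>) \<partial>iid_seq M \<partial>M)"
  by (subst nn_integral_iid_seq_Suc[OF M]) (auto simp: psum_case_nat add.assoc)

end

text \<open>
  The summands are exchanged one at a time; \<open>s\<close> collects those already treated.
\<close>

lemma nn_integral_psum_mono:
  fixes h :: "nat \<Rightarrow> 'a \<Rightarrow> 'b::{real_normed_vector,second_countable_topology}"
    and h' :: "nat \<Rightarrow> 'c \<Rightarrow> 'b"
  assumes M: "prob_space M" "prob_space M'"
    and F[measurable]: "F \<in> borel_measurable borel"
  shows "\<lbrakk>\<And>i. h i \<in> borel_measurable M; \<And>i. h' i \<in> borel_measurable M';
    \<And>i s. i < n \<Longrightarrow> (\<integral>\<^sup>+x. F (s + h i x) \<partial>M) \<le> (\<integral>\<^sup>+x. F (s + h' i x) \<partial>M')\<rbrakk> \<Longrightarrow>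
    (\<integral>\<^sup>+\<omega>. F (s + psum h n \<omega>) \<partial>iid_seq M) \<le> (\<integral>\<^sup>+\<omega>. F (s + psum h' n \<omega>) \<partial>iid_seq M')"
proof (induction n arbitrary: h h' s)
  case 0
  then show ?case using M by (simp add: nn_integral_psum_0)
next
  case (Suc n)
  note [measurable] = Suc.prems(1,2)
  interpret M: prob_space M by fact
  interpret M': prob_space M' by fact
  interpret S': prob_space "iid_seq M'" using M by (intro prob_space_iid_seq)
  interpret PM: pair_sigma_finite M "iid_seq M'" ..
  interpret PM': pair_sigma_finite M' "iid_seq M'" ..
  have "(\<integral>\<^sup>+\<omega>. F (s + psum h (Suc n) \<omega>) \<partial>iid_seq M) =
     (\<integral>\<^sup>+x. \<integral>\<^sup>+\<omega>. F (s + h 0 x + psum (\<lambda>i. h (Suc i)) n \<omega>) \<partial>iid_seq M \<partial>M)"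
    by (intro nn_integral_psum_Suc M) auto
  \<comment> \<open>The tail is exchanged while \<open>h 0 x\<close> sits in the shift. After Fubini
    the new tail sits in the shift, and the first summand is exchanged.\<close>
  also have "\<dots> \<le> (\<integral>\<^sup>+x. \<integral>\<^sup>+\<omega>. F (s + h 0 x + psum (\<lambda>i. h' (Suc i)) n \<omega>) \<partial>iid_seq M' \<partial>M)"
    by (intro nn_integral_mono Suc.IH) (auto intro: Suc.prems)
  also have "\<dots> = (\<integral>\<^sup>+\<omega>. \<integral>\<^sup>+x. F ((s + psum (\<lambda>i. h' (Suc i)) n \<omega>) + h 0 x) \<partial>M \<partial>iid_seq M')"
    by (subst PM.Fubini') (auto simp: ac_simps)
  also have "\<dots> \<le> (\<integral>\<^sup>+\<omega>. \<integral>\<^sup>+x. F ((s + psum (\<lambda>i. h' (Suc i)) n \<omega>) + h' 0 x) \<partial>M' \<partial>iid_seq M')"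
    by (intro nn_integral_mono Suc.prems) auto
  also have "\<dots> = (\<integral>\<^sup>+x. \<integral>\<^sup>+\<omega>. F (s + h' 0 x + psum (\<lambda>i. h' (Suc i)) n \<omega>) \<partial>iid_seq M' \<partial>M')"
    by (subst PM'.Fubini') (auto simp: ac_simps)
  also have "\<dots> = (\<integral>\<^sup>+\<omega>. F (s + psum h' (Suc n) \<omega>) \<partial>iid_seq M')"
    by (intro nn_integral_psum_Suc[symmetric] M) auto
  finally show ?case .
qed

lemma nn_integral_psum_cong:
  fixes h :: "nat \<Rightarrow> 'a \<Rightarrow> 'b::{real_normed_vector,second_countable_topology}"
    and h' :: "nat \<Rightarrow> 'c \<Rightarrow> 'b"
  assumes "prob_space M" "prob_space M'" "F \<in> borel_measurable borel"
    "\<And>i. h i \<in> borel_measurable M" "\<And>i. h' i \<in> borel_measurable M'"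
    "\<And>i s. i < n \<Longrightarrow> (\<integral>\<^sup>+x. F (s + h i x) \<partial>M) = (\<integral>\<^sup>+x. F (s + h' i x) \<partial>M')"
  shows "(\<integral>\<^sup>+\<omega>. F (s + psum h n \<omega>) \<partial>iid_seq M) = (\<integral>\<^sup>+\<omega>. F (s + psum h' n \<omega>) \<partial>iid_seq M')"
  by (intro antisym nn_integral_psum_mono) (use assms in auto)

text \<open>Symmetrizing every summand amounts to subtracting an independent copy of the whole sum.
  Tail bounds for sums of \<open>h\<close> thus pass to the symmetrized sums.\<close>

lemma nn_integral_psum_diff:
  fixes h :: "nat \<Rightarrow> 'a \<Rightarrow> 'b::{real_normed_vector,second_countable_topology}"
  assumes M: "prob_space M" and F[measurable]: "F \<in> borel_measurable borel"
  shows "(\<And>i. h i \<in> borel_measurable M) \<Longrightarrow>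
    (\<integral>\<^sup>+\<omega>. F (s + psum (\<lambda>i (x, y). h i x - h i y) n \<omega>) \<partial>iid_seq (M \<Otimes>\<^sub>M M)) =
    (\<integral>\<^sup>+\<omega>. \<integral>\<^sup>+\<omega>'. F (s + psum h n \<omega> - psum h n \<omega>') \<partial>iid_seq M \<partial>iid_seq M)"
proof (induction n arbitrary: h s)
  case 0
  interpret M: prob_space M by fact
  interpret S: prob_space "iid_seq M" using M by (rule prob_space_iid_seq)
  interpret pair_prob_space M M ..
  interpret S2: prob_space "iid_seq (M \<Otimes>\<^sub>M M)" by (intro prob_space_iid_seq) unfold_locales
  from 0 show ?case
    by (simp add: psum_def S.emeasure_space_1 S2.emeasure_space_1)
next
  case (Suc n)
  note [measurable] = Suc.prems
  interpret M: prob_space M by fact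
  interpret S: prob_space "iid_seq M" using M by (rule prob_space_iid_seq)
  interpret MM: pair_prob_space M M ..
  interpret MS: pair_sigma_finite M "iid_seq M" ..
  let ?h = "\<lambda>i. h (Suc i)"
  have "(\<integral>\<^sup>+\<omega>. F (s + psum (\<lambda>i (x, y). h i x - h i y) (Suc n) \<omega>) \<partial>iid_seq (M \<Otimes>\<^sub>M M)) =
     (\<integral>\<^sup>+p. \<integral>\<^sup>+\<omega>. F (s + (case p of (x, y) \<Rightarrow> h 0 x - h 0 y) + psum (\<lambda>i (x, y). ?h i x - ?h i y) n \<omega>) \<partial>iid_seq (M \<Otimes>\<^sub>M M) \<partial>(M \<Otimes>\<^sub>M M))"
    by (subst nn_integral_psum_Suc) (auto intro: MM.prob_space_axioms)
  also have "\<dots> = (\<integral>\<^sup>+p. \<integral>\<^sup>+\<omega>. \<integral>\<^sup>+\<omega>'. F (s + (case p of (x, y) \<Rightarrow> h 0 x - h 0 y) + psum ?h n \<omega> - psum ?h n \<omega>') \<partial>iid_seq M \<partial>iid_seq M \<partial>(M \<Otimes>\<^sub>M M))"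
    by (subst Suc.IH) auto
  also have "\<dots> = (\<integral>\<^sup>+x. \<integral>\<^sup>+y. \<integral>\<^sup>+\<omega>. \<integral>\<^sup>+\<omega>'. F (s + (h 0 x - h 0 y) + psum ?h n \<omega> - psum ?h n \<omega>') \<partial>iid_seq M \<partial>iid_seq M \<partial>M \<partial>M)"
    by (subst M.nn_integral_fst[symmetric]) auto
  also have "\<dots> = (\<integral>\<^sup>+x. \<integral>\<^sup>+\<omega>. \<integral>\<^sup>+y. \<integral>\<^sup>+\<omega>'. F ((s + h 0 x + psum ?h n \<omega>) - (h 0 y + psum ?h n \<omega>')) \<partial>iid_seq M \<partial>M \<partial>iid_seq M \<partial>M)"
    by (subst MS.Fubini') (auto simp: algebra_simps)
  also have "\<dots> = (\<integral>\<^sup>+x. \<integral>\<^sup>+\<omega>. \<integral>\<^sup>+\<omega>'. F ((s + h 0 x + psum ?h n \<omega>) - psum h (Suc n) \<omega>') \<partial>iid_seq M \<partial>iid_seq M \<partial>M)"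
    by (subst (2) nn_integral_iid_seq_Suc[OF M]) (auto simp: psum_case_nat)
  also have "\<dots> = (\<integral>\<^sup>+\<omega>. \<integral>\<^sup>+\<omega>'. F (s + psum h (Suc n) \<omega> - psum h (Suc n) \<omega>') \<partial>iid_seq M \<partial>iid_seq M)"
    by (subst (2) nn_integral_iid_seq_Suc[OF M]) (auto simp: psum_case_nat add.assoc)
  finally show ?case .
qed

lemma nn_integral_psum_add:
  fixes h :: "nat \<Rightarrow> 'a \<Rightarrow> 'b::{real_normed_vector,second_countable_topology}"
  assumes M: "prob_space M" and F[measurable]: "F \<in> borel_measurable borel"
  shows "(\<And>i. h i \<in> borel_measurable M) \<Longrightarrow>
    (\<integral>\<^sup>+\<omega>. F (s + psum h (n + m) \<omega>) \<partial>iid_seq M) =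
    (\<integral>\<^sup>+\<omega>. \<integral>\<^sup>+\<omega>'. F (s + psum h n \<omega> + psum (\<lambda>i. h (n + i)) m \<omega>') \<partial>iid_seq M \<partial>iid_seq M)"
proof (induction n arbitrary: h s)
  case 0
  interpret S: prob_space "iid_seq M" using M by (rule prob_space_iid_seq)
  from 0 show ?case
    by (simp add: psum_def S.emeasure_space_1)
next
  case (Suc n)
  note [measurable] = Suc.prems
  interpret M: prob_space M by fact
  interpret S: prob_space "iid_seq M" using M by (rule prob_space_iid_seq)
  let ?h = "\<lambda>i. h (Suc i)"
  have "(\<integral>\<^sup>+\<omega>. F (s + psum h (Suc n + m) \<omega>) \<partial>iid_seq M) =
     (\<integral>\<^sup>+x. \<integral>\<^sup>+\<omega>. F (s + h 0 x + psum ?h (n + m) \<omega>) \<partial>iid_seq M \<partial>M)"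
    by (simp, subst nn_integral_psum_Suc) (auto intro: M)
  also have "\<dots> = (\<integral>\<^sup>+x. \<integral>\<^sup>+\<omega>. \<integral>\<^sup>+\<omega>'. F (s + (h 0 x + psum ?h n \<omega>) + psum (\<lambda>i. h (Suc n + i)) m \<omega>') \<partial>iid_seq M \<partial>iid_seq M \<partial>M)"
    by (subst Suc.IH) (auto simp: add.assoc)
  also have "\<dots> = (\<integral>\<^sup>+\<omega>. \<integral>\<^sup>+\<omega>'. F (s + psum h (Suc n) \<omega> + psum (\<lambda>i. h (Suc n + i)) m \<omega>') \<partial>iid_seq M \<partial>iid_seq M)"
    by (subst (2) nn_integral_iid_seq_Suc[OF M]) (auto simp: psum_case_nat)
  finally show ?case .
qed

text \<open>On sequences of sequences the block sums become functions of separate coordinates, so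
  that independence of blocks is independence of coordinates.\<close>

lemma nn_integral_psum_blocks:
  fixes h :: "'a \<Rightarrow> 'b::{real_normed_vector,second_countable_topology}"
  assumes M: "prob_space M" and F[measurable]: "F \<in> borel_measurable borel"
    and [measurable]: "h \<in> borel_measurable M"
  shows "(\<integral>\<^sup>+\<omega>. F (s + psum (\<lambda>_. psum (\<lambda>_. h) n) k \<omega>) \<partial>iid_seq (iid_seq M)) =
    (\<integral>\<^sup>+\<omega>. F (s + psum (\<lambda>_. h) (k * n) \<omega>) \<partial>iid_seq M)"
proof (induction k arbitrary: s)
  case 0
  interpret S: prob_space "iid_seq M" using M by (rule prob_space_iid_seq)
  interpret S2: prob_space "iid_seq (iid_seq M)" by (intro prob_space_iid_seq S.prob_space_axioms)
  from 0 show ?case by (simp add: psum_def S.emeasure_space_1 S2.emeasure_space_1)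
next
  case (Suc k)
  interpret S: prob_space "iid_seq M" using M by (rule prob_space_iid_seq)
  have "(\<integral>\<^sup>+\<omega>. F (s + psum (\<lambda>_. psum (\<lambda>_. h) n) (Suc k) \<omega>) \<partial>iid_seq (iid_seq M)) =
    (\<integral>\<^sup>+\<omega>. \<integral>\<^sup>+\<omega>'. F (s + psum (\<lambda>_. h) n \<omega> + psum (\<lambda>_. h) (k * n) \<omega>') \<partial>iid_seq M \<partial>iid_seq M)"
    by (subst nn_integral_psum_Suc) (auto intro: S.prob_space_axioms simp: Suc.IH)
  also have "\<dots> = (\<integral>\<^sup>+\<omega>. F (s + psum (\<lambda>_. h) (n + k * n) \<omega>) \<partial>iid_seq M)"
    by (subst nn_integral_psum_add) (auto intro: M)
  finally show ?case by simp
qed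

text \<open>Monotone convergence. It yields a moment bound from bounds uniform in the truncation
  level, before any integrability is known; \<open>Suc i\<close> keeps the levels positive.\<close>

lemma nn_integral_le_of_truncations:
  assumes [measurable]: "u \<in> borel_measurable M"
    and le: "\<And>R::real. R > 0 \<Longrightarrow> (\<integral>\<^sup>+x. ennreal (min (u x) R) \<partial>M) \<le> c"
  shows "(\<integral>\<^sup>+x. ennreal (u x) \<partial>M) \<le> c"
proof -
  have mono: "incseq (\<lambda>i x. ennreal (min (u x) (real (Suc i))))"
    by (auto simp: incseq_def le_fun_def intro!: ennreal_leI)
  have sup: "(SUP i. ennreal (min a (real (Suc i)))) = ennreal a" for a
  proof (rule antisym)
    obtain i where "a \<le> real i" using real_arch_simple by blast
    then show "ennreal a \<le> (SUP i. ennreal (min a (real (Suc i))))"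
      by (intro SUP_upper2[of i]) (auto simp: min_def)
  qed (auto intro!: SUP_least ennreal_leI)
  have "(\<integral>\<^sup>+x. ennreal (u x) \<partial>M) = (SUP i. \<integral>\<^sup>+x. ennreal (min (u x) (real (Suc i))) \<partial>M)"
    by (subst nn_integral_monotone_convergence_SUP[symmetric]) (auto simp: sup mono simp del: of_nat_Suc)
  also have "\<dots> \<le> c" by (intro SUP_least le) simp
  finally show ?thesis .
qed

lemma ennreal_add_self_half: "(a + a) / 2 = (a::ennreal)"
  by (subst mult_2_right[symmetric], rule ennreal_mult_divide_eq) auto

text \<open>Jensen's inequality for the squared norm, as \<open>s\<close> is the mean of
  \<open>s + V\<close>: the norm of an integral is at most the integral of the norm, and
  Cauchy-Schwarz against the constant 1 does the rest.\<close>

lemma norm_square_le_nn_integral: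
  fixes V :: "'a \<Rightarrow> 'b::{banach,second_countable_topology}"
  assumes "prob_space M" and V: "integrable M V" "(\<integral>x. V x \<partial>M) = 0"
  shows "ennreal ((norm s)\<^sup>2) \<le> second_moment M (\<lambda>x. s + V x)"
proof -
  interpret prob_space M by fact
  note [measurable] = borel_measurable_integrable[OF V(1)]
  have "norm s = norm (\<integral>x. s + V x \<partial>M)"
    using V by (simp add: prob_space)
  then have "ennreal (norm s) \<le> (\<integral>\<^sup>+x. norm (s + V x) \<partial>M)"
    using V(1) by (simp only:) (intro integral_norm_bound_ennreal, auto)
  then have "(ennreal (norm s))\<^sup>2 \<le> (\<integral>\<^sup>+x. ennreal (norm (s + V x)) * 1 \<partial>M)\<^sup>2"
    by (intro power_mono) auto
  also have "\<dots> \<le> (\<integral>\<^sup>+x. (ennreal (norm (s + V x)))\<^sup>2 \<partial>M) * (\<integral>\<^sup>+x. 1\<^sup>2 \<partial>M)"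
    by (intro Cauchy_Schwarz_nn_integral) auto
  also have "\<dots> = second_moment M (\<lambda>x. s + V x)"
    by (simp add: emeasure_space_1 ennreal_power)
  finally show ?thesis by (simp add: ennreal_power)
qed

section \<open>Rademacher averages\<close>

text \<open>The shift \<open>s\<close> holds the contribution of the signs already drawn. In this
  recursive form an inequality for one sign can be lifted to \<open>k\<close> signs by
  induction.\<close>

primrec rademacher_avg :: "('b::real_normed_vector \<Rightarrow> real) \<Rightarrow> (nat \<Rightarrow> 'b) \<Rightarrow> nat \<Rightarrow> 'b \<Rightarrow> real" where
  "rademacher_avg F y 0 s = F s"
| "rademacher_avg F y (Suc k) s =
     (rademacher_avg F y k (s + y k) + rademacher_avg F y k (s - y k)) / 2"

lemma finite_set_pmf_rademacher: "finite (set_pmf (rademacher k))"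
  by (simp add: rademacher_def set_Pi_pmf finite_PiE_dflt)

lemma expectation_rademacher:
  "measure_pmf.expectation (rademacher k) (\<lambda>\<epsilon>. F (s + (\<Sum>i<k. \<epsilon> i *\<^sub>R y i))) = rademacher_avg F y k s"
proof (induction k arbitrary: s)
  case 0
  then show ?case by (simp add: rademacher_def)
next
  case (Suc k)
  have "rademacher (Suc k) = pmf_of_set {-1, 1} \<bind> (\<lambda>a. map_pmf (\<lambda>f. f(k := a)) (rademacher k))"
    unfolding rademacher_def lessThan_Suc
    by (subst Pi_pmf_insert) (auto simp: pair_pmf_def map_bind_pmf map_pmf_def bind_assoc_pmf bind_return_pmf)
  then have "measure_pmf.expectation (rademacher (Suc k)) (\<lambda>\<epsilon>. F (s + (\<Sum>i<Suc k. \<epsilon> i *\<^sub>R y i))) =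
     (\<Sum>a\<in>{-1,1}. pmf (pmf_of_set {-1, 1}) a *
       measure_pmf.expectation (rademacher k) (\<lambda>\<epsilon>. F ((s + a *\<^sub>R y k) + (\<Sum>i<k. \<epsilon> i *\<^sub>R y i))))"
    by (simp only:, subst pmf_expectation_bind[of "{-1,1::real}"])
       (auto simp: finite_set_pmf_rademacher algebra_simps intro!: sum.cong)
  also have "\<dots> = rademacher_avg F y (Suc k) s"
    by (simp only: Suc.IH) (simp add: field_simps)
  finally show ?case .
qed

lemma rademacher_moment_eq_avg:
  "rademacher_moment k y = rademacher_avg (\<lambda>x. (norm x)\<^sup>2) y k 0"
  unfolding rademacher_moment_def using expectation_rademacher[of k "\<lambda>x. (norm x)\<^sup>2" 0 y] by simp

text \<open>Random sequences are peeled from the front, whereas the defining recursion draws the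
  last sign first; this reconciles the two.\<close>

lemma rademacher_avg_Suc_first:
  "rademacher_avg F y (Suc k) s =
    (rademacher_avg F (\<lambda>i. y (Suc i)) k (s + y 0) + rademacher_avg F (\<lambda>i. y (Suc i)) k (s - y 0)) / 2"
proof (induction k arbitrary: s)
  case (Suc k)
  show ?case
    by (subst rademacher_avg.simps(2), subst (1 2) Suc.IH) (simp add: algebra_simps add_divide_distrib)
qed simp

lemma rademacher_avg_add:
  "rademacher_avg (\<lambda>x. F x + G x) y k s = rademacher_avg F y k s + rademacher_avg G y k s"
  by (induction k arbitrary: s) (auto simp: field_simps)

lemma rademacher_avg_cmult: "rademacher_avg (\<lambda>x. c * F x) y k s = c * rademacher_avg F y k s"
  by (induction k arbitrary: s) (auto simp: field_simps)

lemma rademacher_avg_const: "rademacher_avg (\<lambda>x. c) y k s = c"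
  by (induction k arbitrary: s) auto

lemma rademacher_avg_mono:
  "(\<And>x. F x \<le> G x) \<Longrightarrow> rademacher_avg F y k s \<le> rademacher_avg G y k s"
proof (induction k arbitrary: s)
  case (Suc k)
  show ?case using Suc.IH[OF Suc.prems, of "s + y k"] Suc.IH[OF Suc.prems, of "s - y k"] by simp
qed auto

lemma rademacher_avg_nonneg: "(\<And>x. F x \<ge> 0) \<Longrightarrow> rademacher_avg F y k s \<ge> 0"
  using rademacher_avg_mono[of "\<lambda>_. 0" F] by (simp add: rademacher_avg_const)

lemma rademacher_avg_scale:
  "rademacher_avg F (\<lambda>i. c *\<^sub>R y i) k (c *\<^sub>R s) = rademacher_avg (\<lambda>x. F (c *\<^sub>R x)) y k s"
proof (induction k arbitrary: s)
  case (Suc k)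
  show ?case using Suc.IH[of "s + y k"] Suc.IH[of "s - y k"] by (simp add: algebra_simps)
qed simp

section \<open>Hypercontractivity of random signs\<close>

lemma two_point_real:
  fixes a b :: real
  shows "((a + b / sqrt 3)^4 + (a - b / sqrt 3)^4) / 2 \<le> (a\<^sup>2 + b\<^sup>2)\<^sup>2"
proof -
  define r where "r = 1 / sqrt (3::real)"
  have r: "r\<^sup>2 = 1/3" by (simp add: r_def power_divide)
  have r4: "r^4 = 1/9" using arg_cong[OF r, of power2] by (simp add: power_divide)
  have "((a + b * r)^4 + (a - b * r)^4) / 2 = a^4 + 6 * a\<^sup>2 * b\<^sup>2 * r\<^sup>2 + b^4 * r^4"
    by (simp add: power4_eq_xxxx power2_eq_square algebra_simps)
  also have "\<dots> = a^4 + 2 * a\<^sup>2 * b\<^sup>2 + b^4 / 9" unfolding r r4 by simp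
  also have "\<dots> \<le> a^4 + 2 * a\<^sup>2 * b\<^sup>2 + b^4" by simp
  also have "\<dots> = (a\<^sup>2 + b\<^sup>2)\<^sup>2"
    by (simp add: power4_eq_xxxx power2_eq_square algebra_simps)
  finally show ?thesis by (simp add: r_def)
qed

text \<open>The points at distance \<open>1 / sqrt 3\<close> are convex combinations of
  \<open>s + z\<close> and \<open>s - z\<close>, so their norms are at most \<open>a + b * r\<close>
  and \<open>a - b * r\<close>, where \<open>a\<close> and \<open>b\<close> are half the sum and
  half the difference of the norms at \<open>s + z\<close> and \<open>s - z\<close>. This reduces
  the vector case to real numbers.\<close>

lemma two_point_norm:
  fixes s z :: "'b::real_normed_vector"
  shows "((norm (s + (1 / sqrt 3) *\<^sub>R z))^4 + (norm (s - (1 / sqrt 3) *\<^sub>R z))^4) / 2 \<le>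
    (((norm (s + z))\<^sup>2 + (norm (s - z))\<^sup>2) / 2)\<^sup>2"
proof -
  define r where "r = 1 / sqrt (3::real)"
  define a where "a = (norm (s + z) + norm (s - z)) / 2"
  define b where "b = (norm (s + z) - norm (s - z)) / 2"
  have r: "0 \<le> r" "r \<le> 1" by (auto simp: r_def)
  have conv: "c *\<^sub>R (s + z) + d *\<^sub>R (s - z) = (c + d) *\<^sub>R s + (c - d) *\<^sub>R z" for c d
    by (simp add: algebra_simps)
  have "s + r *\<^sub>R z = ((1 + r)/2) *\<^sub>R (s + z) + ((1 - r)/2) *\<^sub>R (s - z)"
    using conv[of "(1 + r)/2" "(1 - r)/2"] by (simp flip: add_divide_distrib diff_divide_distrib)
  then have "norm (s + r *\<^sub>R z) \<le> \<bar>(1 + r)/2\<bar> * norm (s + z) + \<bar>(1 - r)/2\<bar> * norm (s - z)"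
    by (simp only:) (rule order_trans[OF norm_triangle_ineq], simp only: norm_scaleR order_refl)
  then have 1: "norm (s + r *\<^sub>R z) \<le> a + b * r" using r by (simp add: a_def b_def field_simps)
  have "s - r *\<^sub>R z = ((1 - r)/2) *\<^sub>R (s + z) + ((1 + r)/2) *\<^sub>R (s - z)"
    using conv[of "(1 - r)/2" "(1 + r)/2"] by (simp flip: add_divide_distrib diff_divide_distrib)
  then have "norm (s - r *\<^sub>R z) \<le> \<bar>(1 - r)/2\<bar> * norm (s + z) + \<bar>(1 + r)/2\<bar> * norm (s - z)"
    by (simp only:) (rule order_trans[OF norm_triangle_ineq], simp only: norm_scaleR order_refl)
  then have 2: "norm (s - r *\<^sub>R z) \<le> a - b * r" using r by (simp add: a_def b_def field_simps)
  have "((norm (s + r *\<^sub>R z))^4 + (norm (s - r *\<^sub>R z))^4) / 2 \<le> ((a + b * r)^4 + (a - b * r)^4) / 2"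
    using power_mono[OF 1, of 4] power_mono[OF 2, of 4] by simp
  also have "\<dots> \<le> (a\<^sup>2 + b\<^sup>2)\<^sup>2" using two_point_real[of a b] by (simp add: r_def)
  also have "a\<^sup>2 + b\<^sup>2 = ((norm (s + z))\<^sup>2 + (norm (s - z))\<^sup>2) / 2"
    by (simp add: a_def b_def power2_eq_square field_simps)
  finally show ?thesis by (simp add: r_def)
qed

text \<open>The triangle inequality in the L^2 space of one fair sign, for the functions with values
  (u, v) and (u', v').\<close>

lemma two_point_minkowski:
  fixes u v u' v' P Q :: real
  assumes "(u\<^sup>2 + v\<^sup>2) / 2 \<le> P\<^sup>2" "(u'\<^sup>2 + v'\<^sup>2) / 2 \<le> Q\<^sup>2" "0 \<le> P" "0 \<le> Q"
  shows "(((u + u') / 2)\<^sup>2 + ((v + v') / 2)\<^sup>2) / 2 \<le> ((P + Q) / 2)\<^sup>2"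
proof -
  \<comment> \<open>Lagrange's identity, hence Cauchy-Schwarz.\<close>
  have "(u * u' + v * v')\<^sup>2 + (u * v' - v * u')\<^sup>2 = (u\<^sup>2 + v\<^sup>2) * (u'\<^sup>2 + v'\<^sup>2)"
    by (simp add: power2_eq_square algebra_simps)
  then have "(u * u' + v * v')\<^sup>2 \<le> (u\<^sup>2 + v\<^sup>2) * (u'\<^sup>2 + v'\<^sup>2)"
    using zero_le_power2[of "u * v' - v * u'"] by linarith
  also have "\<dots> \<le> (2 * P\<^sup>2) * (2 * Q\<^sup>2)" using assms by (intro mult_mono) auto
  finally have "(u * u' + v * v')\<^sup>2 \<le> (2 * P * Q)\<^sup>2" by (simp add: power_mult_distrib)
  then have "u * u' + v * v' \<le> 2 * P * Q"
    by (rule power2_le_imp_le) (simp add: assms(3,4))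
  then have "((u\<^sup>2 + v\<^sup>2) / 2 + (u'\<^sup>2 + v'\<^sup>2) / 2 + (u * u' + v * v')) / 4 \<le> (P\<^sup>2 + Q\<^sup>2 + 2 * P * Q) / 4"
    by (intro divide_right_mono add_mono assms(1,2)) simp_all
  then show ?thesis by (simp add: power2_eq_square field_simps)
qed

text \<open>As a function of its shift, the second moment \<open>B k\<close> obeys the same
  two-point inequality as the squared norm. This is the induction step of
  hypercontractivity.\<close>

lemma rademacher_avg_minkowski:
  fixes y :: "nat \<Rightarrow> 'b::real_normed_vector"
  defines "B \<equiv> rademacher_avg (\<lambda>x. (norm x)\<^sup>2) y"
  shows "((B k (s + (1 / sqrt 3) *\<^sub>R z))\<^sup>2 + (B k (s - (1 / sqrt 3) *\<^sub>R z))\<^sup>2) / 2 \<le>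
    ((B k (s + z) + B k (s - z)) / 2)\<^sup>2"
proof (induction k arbitrary: s)
  case 0
  then show ?case using two_point_norm[of s z] by (simp add: B_def flip: power_mult)
next
  case (Suc k)
  have nn: "B k x \<ge> 0" for x unfolding B_def by (intro rademacher_avg_nonneg) auto
  have step: "B (Suc k) (s + a) = (B k ((s + y k) + a) + B k ((s - y k) + a)) / 2"
    "B (Suc k) (s - a) = (B k ((s + y k) - a) + B k ((s - y k) - a)) / 2" for a
    by (simp_all add: B_def algebra_simps)
  have "(B (Suc k) (s + z) + B (Suc k) (s - z)) / 2 =
    ((B k ((s + y k) + z) + B k ((s + y k) - z)) / 2 + (B k ((s - y k) + z) + B k ((s - y k) - z)) / 2) / 2"
    unfolding step by (simp add: add_divide_distrib)
  then show ?case
    using two_point_minkowski[OF Suc.IH[of "s + y k"] Suc.IH[of "s - y k"]] nn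
    by (simp only: step) simp
qed

text \<open>
  The factor \<open>1 / sqrt 3\<close> makes the mixed term of the two-point inequality fit into a square;
  the Minkowski inequality then propagates it from one sign to \<open>k\<close> signs.
\<close>

lemma rademacher_avg_hypercontractive:
  fixes y :: "nat \<Rightarrow> 'b::real_normed_vector"
  shows "rademacher_avg (\<lambda>x. (norm x)^4) (\<lambda>i. (1 / sqrt 3) *\<^sub>R y i) k s \<le>
    (rademacher_avg (\<lambda>x. (norm x)\<^sup>2) y k s)\<^sup>2"
proof (induction k arbitrary: s)
  case (Suc k)
  show ?case unfolding rademacher_avg.simps(2)
    by (rule order_trans[OF divide_right_mono[OF add_mono[OF Suc.IH Suc.IH] zero_le_numeral]
        rademacher_avg_minkowski])
qed (simp flip: power_mult)

text \<open>The Kahane-Khintchine inequality for exponents 4 and 2. Multiplying the vectors by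
  \<open>sqrt 3\<close> removes the contraction; it triples the second moment, whence 9 after
  squaring.\<close>

lemma rademacher_avg_fourth_moment:
  fixes y :: "nat \<Rightarrow> 'b::real_normed_vector"
  shows "rademacher_avg (\<lambda>x. (norm x)^4) y k 0 \<le> 9 * (rademacher_avg (\<lambda>x. (norm x)\<^sup>2) y k 0)\<^sup>2"
proof -
  have "rademacher_avg (\<lambda>x. (norm x)^4) y k 0 \<le> (rademacher_avg (\<lambda>x. (norm x)\<^sup>2) (\<lambda>i. sqrt 3 *\<^sub>R y i) k 0)\<^sup>2"
    using rademacher_avg_hypercontractive[of "\<lambda>i. sqrt 3 *\<^sub>R y i" k 0] by simp
  also have "rademacher_avg (\<lambda>x. (norm x)\<^sup>2) (\<lambda>i. sqrt 3 *\<^sub>R y i) k 0 = 3 * rademacher_avg (\<lambda>x. (norm x)\<^sup>2) y k 0"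
    using rademacher_avg_scale[of "\<lambda>x. (norm x)\<^sup>2" "sqrt 3" y k 0]
    by (simp add: power_mult_distrib rademacher_avg_cmult)
  finally show ?thesis by (simp add: power_mult_distrib)
qed

text \<open>
  Young's inequality with weights chosen so that the fourth moment and the tail each absorb a
  quarter of the second moment.
\<close>

lemma rademacher_avg_second_moment_le:
  fixes y :: "nat \<Rightarrow> 'b::real_normed_vector"
  assumes "rademacher_avg (\<lambda>x. indicator {v. u < norm v} x) y k 0 \<le> 1 / 36" "0 \<le> u"
  shows "rademacher_avg (\<lambda>x. (norm x)\<^sup>2) y k 0 \<le> 2 * u\<^sup>2"
proof -
  define m where "m = rademacher_avg (\<lambda>x. (norm x)\<^sup>2) y k 0"
  have m0: "m \<ge> 0" unfolding m_def by (intro rademacher_avg_nonneg) auto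
  show ?thesis
  proof (cases "m = 0")
    case False
    with m0 have m: "m > 0" by simp
    have "(norm x)\<^sup>2 \<le> u\<^sup>2 + ((1 / (36 * m)) * (norm x)^4 + (9 * m) * indicator {v. u < norm v} x)" for x :: 'b
    proof (cases "u < norm x")
      case True
      have "0 \<le> (1 / (36 * m)) * ((norm x)\<^sup>2 - 18 * m)\<^sup>2" using m by simp
      also have "\<dots> = (1 / (36 * m)) * (norm x)^4 + 9 * m - (norm x)\<^sup>2"
        using m by (simp add: power2_eq_square power4_eq_xxxx field_simps)
      finally show ?thesis using True by (simp add: add_increasing)
    next
      case False
      then have "(norm x)\<^sup>2 \<le> u\<^sup>2" by (intro power_mono) auto
      with False m show ?thesis by (simp add: add_increasing2)
    qed
    from rademacher_avg_mono[OF this, where y = y and k = k and s = 0]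
    have "m \<le> u\<^sup>2 + ((1 / (36 * m)) * rademacher_avg (\<lambda>x. (norm x)^4) y k 0 +
        (9 * m) * rademacher_avg (\<lambda>x. indicator {v. u < norm v} x) y k 0)"
      by (simp only: rademacher_avg_add rademacher_avg_cmult rademacher_avg_const m_def)
    also have "\<dots> \<le> u\<^sup>2 + ((1 / (36 * m)) * (9 * m\<^sup>2) + (9 * m) * (1 / 36))"
      using m rademacher_avg_fourth_moment[of y k, folded m_def] assms
      by (intro add_mono mult_left_mono) auto
    also have "\<dots> = u\<^sup>2 + m / 2" using m by (simp add: power2_eq_square field_simps)
    finally show ?thesis by (simp add: m_def)
  qed (simp add: m_def)
qed

lemma measurable_rademacher_avg[measurable (raw)]:
  fixes y :: "nat \<Rightarrow> 'a \<Rightarrow> 'b::{real_normed_vector,second_countable_topology}"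
  assumes F[measurable]: "F \<in> borel_measurable borel"
    and y[measurable]: "\<And>i. y i \<in> borel_measurable M"
  shows "s \<in> borel_measurable M \<Longrightarrow> (\<lambda>\<omega>. rademacher_avg F (\<lambda>i. y i \<omega>) k (s \<omega>)) \<in> borel_measurable M"
proof (induction k arbitrary: s)
  case (Suc k)
  note [measurable] = Suc
  show ?case by simp
qed simp

section \<open>Symmetric random variables\<close>

definition symmetric_rv :: "'a measure \<Rightarrow> ('a \<Rightarrow> 'b::{real_normed_vector,second_countable_topology}) \<Rightarrow> bool" where
  "symmetric_rv M h \<longleftrightarrow>
     (\<forall>G::'b \<Rightarrow> ennreal. G \<in> borel_measurable borel \<longrightarrow> (\<integral>\<^sup>+x. G (- h x) \<partial>M) = (\<integral>\<^sup>+x. G (h x) \<partial>M))"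

lemma symmetric_rvD:
  "symmetric_rv M h \<Longrightarrow> G \<in> borel_measurable borel \<Longrightarrow> (\<integral>\<^sup>+x. G (- h x) \<partial>M) = (\<integral>\<^sup>+x. G (h x) \<partial>M)"
  by (auto simp: symmetric_rv_def)

text \<open>Exchanging the two coordinates preserves the product measure and changes the sign of the
  difference.\<close>

lemma symmetric_rv_diff:
  assumes M: "prob_space M" and [measurable]: "h \<in> borel_measurable M"
  shows "symmetric_rv (M \<Otimes>\<^sub>M M) (\<lambda>(x, y). h x - h y)"
  unfolding symmetric_rv_def
proof safe
  fix G :: "'b \<Rightarrow> ennreal" assume [measurable]: "G \<in> borel_measurable borel"
  interpret M: prob_space M by fact
  interpret pair_sigma_finite M M ..
  let ?f = "\<lambda>p. G (case p of (x, y) \<Rightarrow> h x - h y)"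
  have "(\<integral>\<^sup>+x. G (- (case x of (x, y) \<Rightarrow> h x - h y)) \<partial>(M \<Otimes>\<^sub>M M)) =
    (\<integral>\<^sup>+y. \<integral>\<^sup>+x. G (- (case (x, y) of (x, y) \<Rightarrow> h x - h y)) \<partial>M \<partial>M)"
    by (rule nn_integral_snd[symmetric]) measurable
  also have "\<dots> = (\<integral>\<^sup>+y. \<integral>\<^sup>+x. ?f (y, x) \<partial>M \<partial>M)" by simp
  also have "\<dots> = (\<integral>\<^sup>+p. ?f p \<partial>(M \<Otimes>\<^sub>M M))"
    by (rule M.nn_integral_fst[where f = ?f]) measurable
  finally show "(\<integral>\<^sup>+x. G (- (case x of (x, y) \<Rightarrow> h x - h y)) \<partial>(M \<Otimes>\<^sub>M M)) = (\<integral>\<^sup>+p. ?f p \<partial>(M \<Otimes>\<^sub>M M))" .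
qed

lemma symmetric_rv_psum:
  assumes M: "prob_space M" and [measurable]: "\<And>i. h i \<in> borel_measurable M"
    and sym: "\<And>i. symmetric_rv M (h i)"
  shows "symmetric_rv (iid_seq M) (psum h n)"
  unfolding symmetric_rv_def
proof safe
  fix G :: "'b \<Rightarrow> ennreal" assume [measurable]: "G \<in> borel_measurable borel"
  have *: "(\<integral>\<^sup>+x. G (s + - h i x) \<partial>M) = (\<integral>\<^sup>+x. G (s + h i x) \<partial>M)" for s i
    by (rule symmetric_rvD[OF sym, of "\<lambda>v. G (s + v)"]) measurable
  have "(\<integral>\<^sup>+\<omega>. G (0 + psum (\<lambda>i x. - h i x) n \<omega>) \<partial>iid_seq M) = (\<integral>\<^sup>+\<omega>. G (0 + psum h n \<omega>) \<partial>iid_seq M)"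
    by (intro nn_integral_psum_cong M) (use * in simp_all)
  then show "(\<integral>\<^sup>+\<omega>. G (- psum h n \<omega>) \<partial>iid_seq M) = (\<integral>\<^sup>+\<omega>. G (psum h n \<omega>) \<partial>iid_seq M)"
    by (simp add: psum_def sum_negf)
qed

text \<open>Independent symmetric variables keep their joint law when multiplied by fixed signs, so
  averaging over all signs as well does not alter the expectation. Inequalities for fixed vectors
  can therefore be applied outcome by outcome.\<close>

lemma nn_integral_rademacher_avg:
  fixes h :: "nat \<Rightarrow> 'a \<Rightarrow> 'b::{real_normed_vector,second_countable_topology}"
  assumes M: "prob_space M" and F[measurable]: "F \<in> borel_measurable borel" and F0: "\<And>x. F x \<ge> 0"
  shows "(\<And>i. h i \<in> borel_measurable M) \<Longrightarrow> (\<And>i. symmetric_rv M (h i)) \<Longrightarrow>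
    (\<integral>\<^sup>+\<omega>. ennreal (rademacher_avg F (\<lambda>i. h i (\<omega> i)) k s) \<partial>iid_seq M) =
    (\<integral>\<^sup>+\<omega>. ennreal (F (s + psum h k \<omega>)) \<partial>iid_seq M)"
proof (induction k arbitrary: h s)
  case 0
  then show ?case by (simp add: psum_def)
next
  case (Suc k)
  note [measurable] = Suc.prems(1)
  interpret S: prob_space "iid_seq M" using M by (rule prob_space_iid_seq)
  let ?h = "\<lambda>i. h (Suc i)"
  let ?G = "\<lambda>v. \<integral>\<^sup>+\<omega>. ennreal (F (s + v + psum ?h k \<omega>)) \<partial>iid_seq M"
  have A: "rademacher_avg F (\<lambda>i. h i (case_nat x \<omega> i)) (Suc k) s =
    (rademacher_avg F (\<lambda>i. ?h i (\<omega> i)) k (s + h 0 x) + rademacher_avg F (\<lambda>i. ?h i (\<omega> i)) k (s - h 0 x)) / 2" for x \<omega>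
    by (subst rademacher_avg_Suc_first) simp
  have B: "ennreal ((a + b) / 2) = (ennreal a + ennreal b) / 2" if "a \<ge> 0" "b \<ge> 0" for a b
    using that by (simp add: divide_ennreal[symmetric] flip: ennreal_plus)
  have "(\<integral>\<^sup>+\<omega>. ennreal (rademacher_avg F (\<lambda>i. h i (\<omega> i)) (Suc k) s) \<partial>iid_seq M) =
     (\<integral>\<^sup>+x. \<integral>\<^sup>+\<omega>. (ennreal (rademacher_avg F (\<lambda>i. ?h i (\<omega> i)) k (s + h 0 x)) +
        ennreal (rademacher_avg F (\<lambda>i. ?h i (\<omega> i)) k (s - h 0 x))) / 2 \<partial>iid_seq M \<partial>M)"
    by (subst nn_integral_iid_seq_Suc[OF M], measurable)
       (simp only: A B[OF rademacher_avg_nonneg[of F, OF F0] rademacher_avg_nonneg[of F, OF F0]])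
  also have "\<dots> = (\<integral>\<^sup>+x. (?G (h 0 x) + ?G (- h 0 x)) / 2 \<partial>M)"
    by (intro nn_integral_cong)
      (simp add: nn_integral_divide nn_integral_add Suc.IH[of ?h, OF Suc.prems(1,2)])
  also have "\<dots> = ((\<integral>\<^sup>+x. ?G (h 0 x) \<partial>M) + (\<integral>\<^sup>+x. ?G (- h 0 x) \<partial>M)) / 2"
    by (simp add: nn_integral_divide nn_integral_add)
  also have "(\<integral>\<^sup>+x. ?G (- h 0 x) \<partial>M) = (\<integral>\<^sup>+x. ?G (h 0 x) \<partial>M)"
    by (rule symmetric_rvD[OF Suc.prems(2)]) measurable
  also have "((\<integral>\<^sup>+x. ?G (h 0 x) \<partial>M) + (\<integral>\<^sup>+x. ?G (h 0 x) \<partial>M)) / 2 = (\<integral>\<^sup>+x. ?G (h 0 x) \<partial>M)"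
    by (rule ennreal_add_self_half)
  also have "\<dots> = (\<integral>\<^sup>+\<omega>. ennreal (F (s + psum h (Suc k) \<omega>)) \<partial>iid_seq M)"
    by (subst nn_integral_psum_Suc[OF M]) auto
  finally show ?case .
qed

section \<open>Type 2 and cotype 2 for sums of independent variables\<close>

lemma indep_vars_iid_seq:
  assumes M: "prob_space M"
  shows "prob_space.indep_vars (iid_seq M) (\<lambda>_. M) (\<lambda>i \<omega>. \<omega> i) UNIV"
proof -
  interpret S: prob_space "iid_seq M" using M by (rule prob_space_iid_seq)
  show ?thesis
  proof (subst S.indep_vars_iff_distr_eq_PiM')
    show "distr (iid_seq M) (iid_seq M) (\<lambda>x. \<lambda>i\<in>UNIV. x i) = (\<Pi>\<^sub>M i\<in>UNIV. distr (iid_seq M) M (\<lambda>\<omega>. \<omega> i))"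
      by (simp add: iid_seq_component[OF M] restrict_def distr_id)
  qed auto
qed

text \<open>The defining inequality is applied to the vectors \<open>h i (\<omega> i)\<close> of
  each outcome and then integrated. The summands need not be identically distributed, as the
  Gaussian blocks are not.\<close>

lemma cotype2_symmetric:
  fixes h :: "nat \<Rightarrow> 'a \<Rightarrow> 'b::{real_normed_vector,second_countable_topology}"
  assumes M: "prob_space M" and [measurable]: "\<And>i. h i \<in> borel_measurable M"
    and sym: "\<And>i. symmetric_rv M (h i)"
    and C: "\<And>k (x::nat \<Rightarrow> 'b). (\<Sum>i<k. (norm (x i))\<^sup>2) \<le> C * rademacher_moment k x" "C \<ge> 0"
  shows "(\<Sum>i<k. \<integral>\<^sup>+x. ennreal ((norm (h i x))\<^sup>2) \<partial>M) \<le>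
    ennreal C * second_moment (iid_seq M) (psum h k)"
proof -
  let ?R = "\<lambda>\<omega>. rademacher_avg (\<lambda>x. (norm x)\<^sup>2) (\<lambda>i. h i (\<omega> i)) k 0"
  have R0: "?R \<omega> \<ge> 0" for \<omega> by (intro rademacher_avg_nonneg) auto
  have "(\<Sum>i<k. \<integral>\<^sup>+x. ennreal ((norm (h i x))\<^sup>2) \<partial>M) = (\<Sum>i<k. \<integral>\<^sup>+\<omega>. ennreal ((norm (h i (\<omega> i)))\<^sup>2) \<partial>iid_seq M)"
    by (intro sum.cong refl, subst nn_integral_iid_seq_component[OF M]) auto
  also have "\<dots> = (\<integral>\<^sup>+\<omega>. ennreal (\<Sum>i<k. (norm (h i (\<omega> i)))\<^sup>2) \<partial>iid_seq M)"
    by (subst nn_integral_sum[symmetric]) (auto intro!: nn_integral_cong)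
  also have "\<dots> \<le> (\<integral>\<^sup>+\<omega>. ennreal (C * ?R \<omega>) \<partial>iid_seq M)"
    using C(1) by (intro nn_integral_mono ennreal_leI) (simp add: rademacher_moment_eq_avg)
  also have "\<dots> = ennreal C * (\<integral>\<^sup>+\<omega>. ennreal (?R \<omega>) \<partial>iid_seq M)"
    using C(2) R0 by (simp add: ennreal_mult nn_integral_cmult)
  also have "(\<integral>\<^sup>+\<omega>. ennreal (?R \<omega>) \<partial>iid_seq M) = second_moment (iid_seq M) (psum h k)"
    by (subst nn_integral_rademacher_avg[OF M]) (auto intro: sym)
  finally show ?thesis .
qed

lemma type2_symmetric:
  fixes h :: "nat \<Rightarrow> 'a \<Rightarrow> 'b::{real_normed_vector,second_countable_topology}"
  assumes M: "prob_space M" and [measurable]: "\<And>i. h i \<in> borel_measurable M"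
    and sym: "\<And>i. symmetric_rv M (h i)"
    and C: "\<And>k (x::nat \<Rightarrow> 'b). rademacher_moment k x \<le> C * (\<Sum>i<k. (norm (x i))\<^sup>2)" "C \<ge> 0"
  shows "second_moment (iid_seq M) (psum h k) \<le>
    ennreal C * (\<Sum>i<k. \<integral>\<^sup>+x. ennreal ((norm (h i x))\<^sup>2) \<partial>M)"
proof -
  let ?R = "\<lambda>\<omega>. rademacher_avg (\<lambda>x. (norm x)\<^sup>2) (\<lambda>i. h i (\<omega> i)) k 0"
  have "second_moment (iid_seq M) (psum h k) = (\<integral>\<^sup>+\<omega>. ennreal (?R \<omega>) \<partial>iid_seq M)"
    by (subst nn_integral_rademacher_avg[OF M]) (auto intro: sym)
  also have "\<dots> \<le> (\<integral>\<^sup>+\<omega>. ennreal (C * (\<Sum>i<k. (norm (h i (\<omega> i)))\<^sup>2)) \<partial>iid_seq M)"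
    using C(1) by (intro nn_integral_mono ennreal_leI) (simp add: rademacher_moment_eq_avg)
  also have "\<dots> = ennreal C * (\<integral>\<^sup>+\<omega>. ennreal (\<Sum>i<k. (norm (h i (\<omega> i)))\<^sup>2) \<partial>iid_seq M)"
    using C(2) by (subst nn_integral_cmult[symmetric]) (auto intro!: nn_integral_cong simp: ennreal_mult sum_nonneg)
  also have "(\<integral>\<^sup>+\<omega>. ennreal (\<Sum>i<k. (norm (h i (\<omega> i)))\<^sup>2) \<partial>iid_seq M) =
      (\<Sum>i<k. \<integral>\<^sup>+\<omega>. ennreal ((norm (h i (\<omega> i)))\<^sup>2) \<partial>iid_seq M)"
    by (subst nn_integral_sum[symmetric]) (auto intro!: nn_integral_cong)
  also have "\<dots> = (\<Sum>i<k. \<integral>\<^sup>+x. ennreal ((norm (h i x))\<^sup>2) \<partial>M)"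
    by (intro sum.cong refl, subst nn_integral_iid_seq_component[OF M]) auto
  finally show ?thesis .
qed

text \<open>Jensen's inequality in the second copy: for fixed \<open>x\<close> the variable
  \<open>?m - h y\<close> has mean 0. The shift makes the result a one-summand comparison for
  \<open>nn_integral_psum_mono\<close>.\<close>

lemma norm_square_symmetrization:
  fixes h :: "'a \<Rightarrow> 'b::{banach,second_countable_topology}"
  assumes M: "prob_space M" and h: "integrable M h"
  shows "second_moment M (\<lambda>x. s + (h x - (\<integral>y. h y \<partial>M))) \<le>
    second_moment (M \<Otimes>\<^sub>M M) (\<lambda>p. s + (case p of (x, y) \<Rightarrow> h x - h y))"
proof -
  interpret prob_space M by fact
  note [measurable] = borel_measurable_integrable[OF h]
  let ?m = "\<integral>y. h y \<partial>M"
  have "second_moment M (\<lambda>x. s + (h x - ?m)) \<le>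
    (\<integral>\<^sup>+x. \<integral>\<^sup>+y. ennreal ((norm ((s + (h x - ?m)) + (?m - h y)))\<^sup>2) \<partial>M \<partial>M)"
    using h by (intro nn_integral_mono norm_square_le_nn_integral M) (auto simp: prob_space)
  also have "\<dots> = (\<integral>\<^sup>+x. \<integral>\<^sup>+y. ennreal ((norm (s + (case (x, y) of (x, y) \<Rightarrow> h x - h y)))\<^sup>2) \<partial>M \<partial>M)"
    by (simp add: algebra_simps)
  also have "\<dots> = second_moment (M \<Otimes>\<^sub>M M) (\<lambda>p. s + (case p of (x, y) \<Rightarrow> h x - h y))"
    by (rule nn_integral_fst) measurable
  finally show ?thesis .
qed

lemma nn_integral_norm_square_diff_le:
  fixes f g :: "'a \<Rightarrow> 'b::{real_normed_vector,second_countable_topology}"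
  assumes [measurable]: "f \<in> borel_measurable M" "g \<in> borel_measurable M"
  shows "second_moment M (\<lambda>x. f x - g x) \<le>
    2 * second_moment M f + 2 * second_moment M g"
proof -
  have "(norm (a - b))\<^sup>2 \<le> 2 * (norm a)\<^sup>2 + 2 * (norm b)\<^sup>2" for a b :: 'b
  proof -
    have "(norm (a - b))\<^sup>2 \<le> (norm a + norm b)\<^sup>2" by (intro power_mono norm_triangle_ineq4) auto
    also have "\<dots> \<le> 2 * (norm a)\<^sup>2 + 2 * (norm b)\<^sup>2"
      using zero_le_power2[of "norm a - norm b"] by (simp add: power2_eq_square algebra_simps)
    finally show ?thesis .
  qed
  then have "second_moment M (\<lambda>x. f x - g x) \<le> (\<integral>\<^sup>+x. 2 * ennreal ((norm (f x))\<^sup>2) + 2 * ennreal ((norm (g x))\<^sup>2) \<partial>M)"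
    by (intro nn_integral_mono) (auto simp: ennreal_mult[symmetric] simp flip: ennreal_numeral ennreal_plus)
  then show ?thesis by (simp add: nn_integral_add nn_integral_cmult)
qed

text \<open>Symmetrization makes \<open>type2_symmetric\<close> applicable. The second moment of a
  difference of two copies is at most 4 times that of \<open>h\<close>, which explains the factor
  4.\<close>

lemma type2_mean_zero:
  fixes h :: "'a \<Rightarrow> 'b::{banach,second_countable_topology}"
  assumes M: "prob_space M" and h: "integrable M h" "(\<integral>x. h x \<partial>M) = 0"
    and C: "\<And>k (x::nat \<Rightarrow> 'b). rademacher_moment k x \<le> C * (\<Sum>i<k. (norm (x i))\<^sup>2)" "C \<ge> 0"
  shows "second_moment (iid_seq M) (psum (\<lambda>_. h) n) \<le>
    ennreal (4 * C * real n) * second_moment M h"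
proof -
  interpret M: prob_space M by fact
  interpret MM: pair_prob_space M M ..
  note [measurable] = borel_measurable_integrable[OF h(1)]
  let ?h = "\<lambda>(x, y). h x - h y" and ?N = "\<integral>\<^sup>+x. ennreal ((norm (h x))\<^sup>2) \<partial>M"
  have "second_moment (iid_seq M) (\<lambda>\<omega>. 0 + psum (\<lambda>_. h) n \<omega>) \<le>
    second_moment (iid_seq (M \<Otimes>\<^sub>M M)) (\<lambda>\<omega>. 0 + psum (\<lambda>_. ?h) n \<omega>)"
    using norm_square_symmetrization[OF M h(1)]
    by (intro nn_integral_psum_mono[where F = "\<lambda>v. ennreal ((norm v)\<^sup>2)"] M MM.prob_space_axioms) (auto simp: h(2))
  also have "\<dots> \<le> ennreal C * (\<Sum>i<n. \<integral>\<^sup>+x. ennreal ((norm (?h x))\<^sup>2) \<partial>(M \<Otimes>\<^sub>M M))"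
    using type2_symmetric[OF MM.prob_space_axioms _ symmetric_rv_diff[OF M] C, of "\<lambda>_. h" n] by simp
  also have "second_moment (M \<Otimes>\<^sub>M M) ?h \<le> 2 * ?N + 2 * ?N"
  proof -
    have "second_moment (M \<Otimes>\<^sub>M M) (\<lambda>p. h (fst p) - h (snd p)) \<le>
      2 * second_moment (M \<Otimes>\<^sub>M M) (\<lambda>p. h (fst p)) + 2 * second_moment (M \<Otimes>\<^sub>M M) (\<lambda>p. h (snd p))"
      by (rule nn_integral_norm_square_diff_le) measurable
    also have "second_moment (M \<Otimes>\<^sub>M M) (\<lambda>p. h (fst p)) = ?N"
      by (subst M.nn_integral_fst[symmetric]) (auto simp: M.emeasure_space_1)
    also have "second_moment (M \<Otimes>\<^sub>M M) (\<lambda>p. h (snd p)) = ?N"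
      by (subst M.nn_integral_fst[symmetric]) (auto simp: M.emeasure_space_1)
    finally show ?thesis by (simp add: case_prod_beta')
  qed
  also have "ennreal C * (\<Sum>i<n. 2 * ?N + 2 * ?N) = ennreal (4 * C * real n) * ?N"
    using C(2) by (simp add: ennreal_mult mult_ac ennreal_of_nat_eq_real_of_nat flip: distrib_right)
  finally show ?thesis using C(2) by (simp add: sum_mono mult_left_mono)
qed

text \<open>
  Removing the last incomplete block costs a factor 2 in probability, so Markov's inequality at the
  threshold \<open>1/36\<close> of \<open>rademacher_avg_second_moment_le\<close> leaves an exceptional set of measure at most
  \<open>36 * 2 / 288 = 1/4\<close>, and Hoeffding's inequality one of measure less than \<open>1/2\<close>.
\<close>

lemma cotype2_block_bound:
  fixes h :: "'a \<Rightarrow> 'b::{banach,second_countable_topology}"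
  assumes M: "prob_space M" and h[measurable]: "h \<in> borel_measurable M" and sym: "symmetric_rv M h"
    and C: "\<And>k (x::nat \<Rightarrow> 'b). (\<Sum>i<k. (norm (x i))\<^sup>2) \<le> C * rademacher_moment k x" "C \<ge> 0"
    and t: "t \<ge> 0"
    and bd: "\<exists>\<^sub>\<infinity>m. (\<integral>\<^sup>+\<omega>. indicator {v. t * sqrt (real m) < norm v} (psum (\<lambda>_. h) m \<omega>) \<partial>iid_seq M) \<le> ennreal (1/288)"
  shows "second_moment (iid_seq M) (psum (\<lambda>_. h) n) \<le> ennreal (4 * C * t\<^sup>2 * real n)"
proof (cases "n = 0")
  case True
  then show ?thesis by (simp add: psum_def)
next
  case False
  define H where "H = psum (\<lambda>_. h) n"
  let ?S = "iid_seq M" and ?S2 = "iid_seq (iid_seq M)"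
  interpret S: prob_space ?S using M by (rule prob_space_iid_seq)
  interpret S2: prob_space ?S2 by (intro prob_space_iid_seq S.prob_space_axioms)
  have Hm[measurable]: "H \<in> borel_measurable ?S" by (simp add: H_def)
  \<comment> \<open>For a bounded variable the empirical mean over the blocks is close to the true
    mean with a probability controlled by the number of blocks alone; \<open>R\<close> is removed at
    the end by monotone convergence.\<close>
  have truncated: "S.expectation (\<lambda>\<omega>. min ((norm (H \<omega>))\<^sup>2) R) \<le> 4 * C * t\<^sup>2 * real n" (is "?\<mu> \<le> _") if R: "R > 0" for R
  proof (rule field_le_epsilon)
    fix \<eta> :: real assume \<eta>: "\<eta> > 0"
    let ?T = "\<lambda>i \<Omega>. min ((norm (H (\<Omega> i)))\<^sup>2) R"
    have "eventually (\<lambda>k::nat. exp (- 2 * real k * \<eta>\<^sup>2 / R\<^sup>2) < 1 / 2) sequentially"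
      using R \<eta> by real_asymp
    then obtain K where K: "\<And>k. k \<ge> K \<Longrightarrow> exp (- 2 * real k * \<eta>\<^sup>2 / R\<^sup>2) < 1 / 2"
      by (auto simp: eventually_sequentially)
    \<comment> \<open>This size of \<open>m\<close> yields at least \<open>K + 1\<close> complete
      blocks, hence at least one.\<close>
    obtain m where m: "m \<ge> n * (K + 1)"
      and bdm: "(\<integral>\<^sup>+\<omega>. indicator {v. t * sqrt (real m) < norm v} (psum (\<lambda>_. h) m \<omega>) \<partial>?S) \<le> ennreal (1/288)"
      using bd by (auto simp: INFM_nat_le)
    define k where "k = m div n"
    define u where "u = t * sqrt (real m)"
    have u: "u \<ge> 0" "u\<^sup>2 = t\<^sup>2 * real m" using t by (auto simp: u_def power_mult_distrib)
    have k: "k \<ge> K" "k > 0" using div_le_mono[OF m, of n] False by (auto simp: k_def)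
    have mk: "m = k * n + m mod n" by (simp add: k_def)
    \<comment> \<open>The incomplete block is shorter than one complete block, so at least half of
      \<open>m\<close> is covered by complete blocks.\<close>
    have "m mod n < n" using False by simp
    also have "n \<le> k * n" using k by simp
    finally have mk2: "real m \<le> 2 * real k * real n" using mk
      by (metis add_le_cancel_left less_imp_le_nat mult_2 of_nat_le_iff of_nat_mult of_nat_numeral mult.assoc)
    define F :: "'b \<Rightarrow> real" where "F = indicator {v. u < norm v}"
    have [measurable]: "F \<in> borel_measurable borel" by (simp add: F_def)
    \<comment> \<open>Twice \<open>a\<close> is the sum of \<open>a + b\<close> and
      \<open>a - b\<close>, so one of the two has norm above \<open>u\<close> if \<open>a\<close>
      has. With \<open>b\<close> the symmetric incomplete block both are equally likely to be large,
      and dropping it costs the factor 2.\<close>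
    have F: "ennreal (F a) \<le> ennreal (F (a + b)) + ennreal (F (a - b))" for a b
    proof (cases "u < norm a")
      case True
      have "2 * norm a = norm ((a + b) + (a - b))" by (simp flip: scaleR_2)
      also have "\<dots> \<le> norm (a + b) + norm (a - b)" by (rule norm_triangle_ineq)
      finally show ?thesis using True by (auto simp: F_def indicator_def)
    qed (simp add: F_def)
    have sym_r: "(\<integral>\<^sup>+\<omega>. ennreal (F (a - psum (\<lambda>_. h) r \<omega>)) \<partial>?S) = (\<integral>\<^sup>+\<omega>. ennreal (F (a + psum (\<lambda>_. h) r \<omega>)) \<partial>?S)" for a r
      using symmetric_rvD[OF symmetric_rv_psum[OF M], of "\<lambda>_. h" "\<lambda>v. ennreal (F (a + v))" r] sym by simp
    have "(\<integral>\<^sup>+\<Omega>. ennreal (F (0 + psum (\<lambda>_. H) k \<Omega>)) \<partial>?S2) = (\<integral>\<^sup>+\<omega>. ennreal (F (0 + psum (\<lambda>_. h) (k * n) \<omega>)) \<partial>?S)"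
      unfolding H_def by (rule nn_integral_psum_blocks[OF M, where F = "\<lambda>v. ennreal (F v)"]) auto
    also have "\<dots> = (\<integral>\<^sup>+\<omega>. \<integral>\<^sup>+\<omega>'. ennreal (F (psum (\<lambda>_. h) (k * n) \<omega>)) \<partial>?S \<partial>?S)"
      by (simp add: S.emeasure_space_1)
    also have "\<dots> \<le> (\<integral>\<^sup>+\<omega>. \<integral>\<^sup>+\<omega>'. ennreal (F (psum (\<lambda>_. h) (k * n) \<omega> + psum (\<lambda>_. h) (m mod n) \<omega>')) +
        ennreal (F (psum (\<lambda>_. h) (k * n) \<omega> - psum (\<lambda>_. h) (m mod n) \<omega>')) \<partial>?S \<partial>?S)"
      by (intro nn_integral_mono F)
    also have "\<dots> = 2 * (\<integral>\<^sup>+\<omega>. \<integral>\<^sup>+\<omega>'. ennreal (F (0 + psum (\<lambda>_. h) (k * n) \<omega> + psum (\<lambda>_. h) (m mod n) \<omega>')) \<partial>?S \<partial>?S)"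
      by (simp add: nn_integral_add sym_r nn_integral_cmult flip: mult_2)
    also have "(\<integral>\<^sup>+\<omega>. \<integral>\<^sup>+\<omega>'. ennreal (F (0 + psum (\<lambda>_. h) (k * n) \<omega> + psum (\<lambda>_. h) (m mod n) \<omega>')) \<partial>?S \<partial>?S) =
      (\<integral>\<^sup>+\<omega>. ennreal (F (0 + psum (\<lambda>_. h) (k * n + m mod n) \<omega>)) \<partial>?S)"
      by (subst nn_integral_psum_add[OF M, where F = "\<lambda>v. ennreal (F v)"]) auto
    also have "\<dots> \<le> ennreal (1/288)"
      using bdm unfolding mk[symmetric] by (simp add: F_def u_def ennreal_indicator)
    finally have PF: "(\<integral>\<^sup>+\<Omega>. ennreal (F (0 + psum (\<lambda>_. H) k \<Omega>)) \<partial>?S2) \<le> 2 * ennreal (1/288)"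
      by (simp add: mult_left_mono)
    let ?p = "\<lambda>\<Omega>. rademacher_avg F (\<lambda>i. H (\<Omega> i)) k 0"
    have symH: "symmetric_rv ?S H" unfolding H_def by (intro symmetric_rv_psum M sym) auto
    \<comment> \<open>Outcomes at which, with the block values fixed, random signs produce a large
      sum too often; Markov's inequality bounds their probability.\<close>
    define A where "A = {\<Omega> \<in> space ?S2. 1 / 36 < ?p \<Omega>}"
    have [measurable]: "A \<in> sets ?S2" unfolding A_def by measurable
    have "emeasure ?S2 A = (\<integral>\<^sup>+\<Omega>. indicator A \<Omega> \<partial>?S2)" by simp
    also have "\<dots> \<le> (\<integral>\<^sup>+\<Omega>. ennreal 36 * ennreal (?p \<Omega>) \<partial>?S2)"
    proof (intro nn_integral_mono)
      fix \<Omega>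
      show "indicator A \<Omega> \<le> ennreal 36 * ennreal (?p \<Omega>)"
      proof (cases "\<Omega> \<in> A")
        case True
        then have "ennreal 1 \<le> ennreal (36 * ?p \<Omega>)" by (intro ennreal_leI) (simp add: A_def)
        with True show ?thesis by (simp add: ennreal_mult')
      qed simp
    qed
    also have "\<dots> = ennreal 36 * (\<integral>\<^sup>+\<Omega>. ennreal (F (0 + psum (\<lambda>_. H) k \<Omega>)) \<partial>?S2)"
      by (subst nn_integral_cmult, measurable, subst nn_integral_rademacher_avg[OF S.prob_space_axioms])
         (auto simp: F_def intro: symH)
    also have "\<dots> \<le> ennreal 36 * (2 * ennreal (1/288))" by (intro mult_left_mono PF) auto
    also have "\<dots> = ennreal (1/4)" by (simp add: ennreal_mult''[symmetric] flip: ennreal_numeral)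
    finally have PA: "S2.prob A \<le> 1 / 4" by (simp add: S2.emeasure_eq_measure)
    \<comment> \<open>Outcomes whose empirical mean of the truncated squares falls short of the
      expectation by at least \<eta>.\<close>
    define B where "B = {\<Omega> \<in> space ?S2. (\<Sum>i<k. ?T i \<Omega>) \<le> (\<Sum>i<k. S2.expectation (?T i)) - real k * \<eta>}"
    have [measurable]: "B \<in> sets ?S2" unfolding B_def by measurable
    have ET: "S2.expectation (?T i) = ?\<mu>" for i
    proof -
      have "?\<mu> = (\<integral>\<omega>. min ((norm (H \<omega>))\<^sup>2) R \<partial>distr ?S2 ?S (\<lambda>\<Omega>. \<Omega> i))"
        by (simp add: iid_seq_component[OF S.prob_space_axioms])
      also have "\<dots> = S2.expectation (?T i)" by (rule integral_distr) auto
      finally show ?thesis by simp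
    qed
    interpret Hf: Hoeffding_ineq ?S2 "{..<k}" ?T "\<lambda>_. 0" "\<lambda>_. R" "\<Sum>i<k. S2.expectation (?T i)"
    proof unfold_locales
      show "S2.indep_vars (\<lambda>_. borel) ?T {..<k}"
        by (rule S2.indep_vars_compose2[OF S2.indep_vars_subset[OF indep_vars_iid_seq[OF S.prob_space_axioms]],
              where Y = "\<lambda>_ \<omega>. min ((norm (H \<omega>))\<^sup>2) R"]) auto
    qed (use R in auto)
    have "S2.prob B \<le> exp (- 2 * (real k * \<eta>)\<^sup>2 / (\<Sum>i<k. (R - 0)\<^sup>2))"
      unfolding B_def using \<eta> R k by (intro Hf.Hoeffding_ineq_le) auto
    also have "\<dots> = exp (- 2 * real k * \<eta>\<^sup>2 / R\<^sup>2)" using k R by (simp add: power2_eq_square)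
    also have "\<dots> < 1 / 2" using K k by auto
    finally have PB: "S2.prob B < 1 / 2" .
    \<comment> \<open>One outcome outside both sets is enough, since the bound wanted on
      \<open>?\<mu>\<close> is deterministic. At that outcome hypercontractivity and cotype 2 are
      applied to the fixed vectors \<open>H (\<Omega> i)\<close>.\<close>
    have "S2.prob (A \<union> B) \<le> S2.prob A + S2.prob B" by (intro measure_Un_le) auto
    with PA PB have "S2.prob (A \<union> B) < 1" by simp
    then have "A \<union> B \<noteq> space ?S2" using S2.prob_space by auto
    moreover have "A \<union> B \<subseteq> space ?S2" by (auto simp: A_def B_def)
    ultimately obtain \<Omega> where \<Omega>: "\<Omega> \<in> space ?S2" "\<Omega> \<notin> A" "\<Omega> \<notin> B" by blast
    then have "?p \<Omega> \<le> 1 / 36" by (auto simp: A_def)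
    then have "rademacher_avg (\<lambda>x. (norm x)\<^sup>2) (\<lambda>i. H (\<Omega> i)) k 0 \<le> 2 * u\<^sup>2"
      using u by (intro rademacher_avg_second_moment_le) (auto simp: F_def)
    then have le: "C * rademacher_moment k (\<lambda>i. H (\<Omega> i)) \<le> C * (2 * u\<^sup>2)"
      using C(2) by (intro mult_left_mono) (auto simp: rademacher_moment_eq_avg)
    have "real k * (?\<mu> - \<eta>) < (\<Sum>i<k. ?T i \<Omega>)"
      using \<Omega> by (auto simp: B_def ET algebra_simps)
    also have "\<dots> \<le> (\<Sum>i<k. (norm (H (\<Omega> i)))\<^sup>2)" by (intro sum_mono) auto
    also have "\<dots> \<le> C * rademacher_moment k (\<lambda>i. H (\<Omega> i))" by (rule C)
    also note le
    also have "C * (2 * u\<^sup>2) \<le> C * (2 * (t\<^sup>2 * (2 * real k * real n)))"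
      unfolding u using C(2) mk2 by (intro mult_left_mono) auto
    also have "\<dots> = real k * (4 * C * t\<^sup>2 * real n)" by simp
    finally have "?\<mu> - \<eta> < 4 * C * t\<^sup>2 * real n" using k by simp
    then show "?\<mu> \<le> 4 * C * t\<^sup>2 * real n + \<eta>" by simp
  qed
  have "second_moment ?S H \<le> ennreal (4 * C * t\<^sup>2 * real n)"
  proof (rule nn_integral_le_of_truncations)
    fix R :: real assume R: "R > 0"
    have "(\<integral>\<^sup>+\<omega>. ennreal (min ((norm (H \<omega>))\<^sup>2) R) \<partial>?S) = ennreal (S.expectation (\<lambda>\<omega>. min ((norm (H \<omega>))\<^sup>2) R))"
      using R by (intro nn_integral_eq_integral S.integrable_const_bound[of _ R]) auto
    also have "\<dots> \<le> ennreal (4 * C * t\<^sup>2 * real n)" by (intro ennreal_leI truncated R)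
    finally show "(\<integral>\<^sup>+\<omega>. ennreal (min ((norm (H \<omega>))\<^sup>2) R) \<partial>?S) \<le> ennreal (4 * C * t\<^sup>2 * real n)" .
  qed measurable
  then show ?thesis by (simp add: H_def)
qed

lemma integrable_of_square:
  fixes h :: "'a \<Rightarrow> 'b::{banach,second_countable_topology}"
  assumes "prob_space M" and [measurable]: "h \<in> borel_measurable M"
    and fin: "second_moment M h < \<infinity>"
  shows "integrable M h"
proof -
  interpret prob_space M by fact
  have "x \<le> 1 + x\<^sup>2" for x :: real
  proof -
    have "2 * x \<le> x\<^sup>2 + 1" using zero_le_power2[of "x - 1"] by (simp add: power2_diff)
    then show ?thesis using zero_le_power2[of x] by linarith
  qed
  then have "(\<integral>\<^sup>+x. ennreal (norm (h x)) \<partial>M) \<le> (\<integral>\<^sup>+x. 1 + ennreal ((norm (h x))\<^sup>2) \<partial>M)"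
    by (intro nn_integral_mono) (simp flip: ennreal_1 ennreal_plus)
  also have "\<dots> < \<infinity>" using fin by (simp add: nn_integral_add emeasure_space_1)
  finally show ?thesis by (intro integrableI_bounded) auto
qed

text \<open>By Fubini, for some fixed \<open>x\<close> the variable \<open>h x - h y\<close> has a
  finite second moment in \<open>y\<close>, and \<open>h y\<close> differs from it by a constant and
  a sign.\<close>

lemma symmetrization_square_finite:
  fixes h :: "'a \<Rightarrow> 'b::{banach,second_countable_topology}"
  assumes M: "prob_space M" and [measurable]: "h \<in> borel_measurable M"
    and fin: "second_moment (M \<Otimes>\<^sub>M M) (\<lambda>p. case p of (x, y) \<Rightarrow> h x - h y) < \<infinity>"
  shows "second_moment M h < \<infinity>"
proof -
  interpret M: prob_space M by fact
  have "(\<integral>\<^sup>+x. \<integral>\<^sup>+y. ennreal ((norm (case (x, y) of (x, y) \<Rightarrow> h x - h y))\<^sup>2) \<partial>M \<partial>M) < \<infinity>"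
    using fin by (subst M.nn_integral_fst) measurable
  then have "AE x in M. second_moment M (\<lambda>y. h x - h y) \<noteq> \<infinity>"
    by (intro nn_integral_noteq_infinite) auto
  then obtain x where x: "second_moment M (\<lambda>y. h x - h y) \<noteq> \<infinity>"
    using eventually_happens'[OF M.ae_filter_bot] by blast
  have "second_moment M (\<lambda>y. h x - (h x - h y)) \<le>
    2 * second_moment M (\<lambda>y. h x) + 2 * second_moment M (\<lambda>y. h x - h y)"
    by (rule nn_integral_norm_square_diff_le) auto
  also have "\<dots> < \<infinity>" using x by (simp add: M.emeasure_space_1 ennreal_mult_less_top less_top)
  finally show ?thesis by simp
qed

text \<open>Passing to the symmetrized variable doubles both the threshold and the probability:
  hence 576 = 2 * 288 and 16 = 4 * 2^2. The mean vanishes because, on a common event, the sum is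
  within order \<open>sqrt m\<close> both of 0 and of \<open>m\<close> times the mean, for
  arbitrarily large \<open>m\<close>.\<close>

lemma cotype2_stochastically_bounded:
  fixes h :: "'a \<Rightarrow> 'b::{banach,second_countable_topology}"
  assumes M: "prob_space M" and h[measurable]: "h \<in> borel_measurable M"
    and C: "\<And>k (x::nat \<Rightarrow> 'b). (\<Sum>i<k. (norm (x i))\<^sup>2) \<le> C * rademacher_moment k x" "C \<ge> 0"
    and t: "t \<ge> 0"
    and bd: "\<exists>\<^sub>\<infinity>m. (\<integral>\<^sup>+\<omega>. indicator {v. t * sqrt (real m) < norm v} (psum (\<lambda>_. h) m \<omega>) \<partial>iid_seq M) \<le> ennreal (1/576)"
  shows "second_moment M h < \<infinity>" and "integrable M h" and "(\<integral>x. h x \<partial>M) = 0"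
    and "second_moment (iid_seq M) (psum (\<lambda>_. h) n) \<le> ennreal (16 * C * t\<^sup>2 * real n)"
proof -
  interpret M: prob_space M by fact
  interpret MM: pair_prob_space M M ..
  let ?S = "iid_seq M"
  interpret S: prob_space ?S using M by (rule prob_space_iid_seq)
  let ?h = "\<lambda>(x, y). h x - h y"
  have "\<exists>\<^sub>\<infinity>m. (\<integral>\<^sup>+\<omega>. indicator {v. (2 * t) * sqrt (real m) < norm v} (psum (\<lambda>_. ?h) m \<omega>) \<partial>iid_seq (M \<Otimes>\<^sub>M M)) \<le> ennreal (1/288)"
    using bd
  proof (rule INFM_mono)
    fix m
    assume le: "(\<integral>\<^sup>+\<omega>. indicator {v. t * sqrt (real m) < norm v} (psum (\<lambda>_. h) m \<omega>) \<partial>?S) \<le> ennreal (1/576)"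
    let ?I = "indicator {v. t * sqrt (real m) < norm v} :: 'b \<Rightarrow> ennreal"
    have I: "indicator {v. (2 * t) * sqrt (real m) < norm v} (a - b) \<le> ?I a + ?I b" for a b :: 'b
      using norm_triangle_ineq4[of a b] by (auto simp: indicator_def)
    have "(\<integral>\<^sup>+\<omega>. indicator {v. (2 * t) * sqrt (real m) < norm v} (0 + psum (\<lambda>_. ?h) m \<omega>) \<partial>iid_seq (M \<Otimes>\<^sub>M M)) =
      (\<integral>\<^sup>+\<omega>. \<integral>\<^sup>+\<omega>'. indicator {v. (2 * t) * sqrt (real m) < norm v} (0 + psum (\<lambda>_. h) m \<omega> - psum (\<lambda>_. h) m \<omega>') \<partial>?S \<partial>?S)"
      by (rule nn_integral_psum_diff[OF M]) auto
    also have "\<dots> \<le> (\<integral>\<^sup>+\<omega>. \<integral>\<^sup>+\<omega>'. ?I (psum (\<lambda>_. h) m \<omega>) + ?I (psum (\<lambda>_. h) m \<omega>') \<partial>?S \<partial>?S)"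
      using I by (intro nn_integral_mono) simp
    also have "\<dots> = (\<integral>\<^sup>+\<omega>. ?I (psum (\<lambda>_. h) m \<omega>) \<partial>?S) + (\<integral>\<^sup>+\<omega>. ?I (psum (\<lambda>_. h) m \<omega>) \<partial>?S)"
      by (simp add: nn_integral_add S.emeasure_space_1)
    also have "\<dots> \<le> ennreal (1/576) + ennreal (1/576)" by (intro add_mono le)
    also have "\<dots> = ennreal (1/288)" by (subst ennreal_plus[symmetric]) auto
    finally show "(\<integral>\<^sup>+\<omega>. indicator {v. (2 * t) * sqrt (real m) < norm v} (psum (\<lambda>_. ?h) m \<omega>) \<partial>iid_seq (M \<Otimes>\<^sub>M M)) \<le> ennreal (1/288)"
      by simp
  qed
  from cotype2_block_bound[OF MM.prob_space_axioms _ symmetric_rv_diff[OF M h] C _ this] t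
  have sq: "second_moment (iid_seq (M \<Otimes>\<^sub>M M)) (psum (\<lambda>_. ?h) n) \<le> ennreal (16 * C * t\<^sup>2 * real n)" for n
    by (simp add: power_mult_distrib mult_ac)
  \<comment> \<open>The bound for a single summand, n = 1.\<close>
  have "second_moment (M \<Otimes>\<^sub>M M) ?h < \<infinity>"
    using sq[of 1] nn_integral_iid_seq_component[OF MM.prob_space_axioms, of "\<lambda>p. ennreal ((norm (?h p))\<^sup>2)" 0]
    by (auto simp: psum_def intro: le_less_trans)
  then show fin: "second_moment M h < \<infinity>"
    by (rule symmetrization_square_finite[OF M h])
  then show int: "integrable M h" by (rule integrable_of_square[OF M h])
  define \<mu> where "\<mu> = (\<integral>x. h x \<partial>M)"
  have ps: "psum (\<lambda>_ x. h x - \<mu>) n \<omega> = psum (\<lambda>_. h) n \<omega> - real n *\<^sub>R \<mu>" for n \<omega>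
    by (simp add: psum_def sum_subtractf sum_constant_scaleR)
  have sq': "second_moment ?S (\<lambda>\<omega>. psum (\<lambda>_. h) n \<omega> - real n *\<^sub>R \<mu>) \<le> ennreal (16 * C * t\<^sup>2 * real n)" for n
  proof -
    have "second_moment ?S (\<lambda>\<omega>. 0 + psum (\<lambda>_ x. h x - \<mu>) n \<omega>) \<le>
      second_moment (iid_seq (M \<Otimes>\<^sub>M M)) (\<lambda>\<omega>. 0 + psum (\<lambda>_. ?h) n \<omega>)"
      using norm_square_symmetrization[OF M int] unfolding \<mu>_def
      by (intro nn_integral_psum_mono[where F = "\<lambda>v. ennreal ((norm v)\<^sup>2)"] M MM.prob_space_axioms) auto
    with sq show ?thesis by (simp add: ps) (rule order_trans)
  qed
  have "\<mu> = 0"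
  proof (rule ccontr)
    assume "\<mu> \<noteq> 0"
    \<comment> \<open>Chosen so that \<open>t * sqrt (real m) + sqrt a = L * sqrt (real m)\<close>
      for the \<open>a\<close> below, while \<open>m\<close> exceeds the square of
      \<open>L / norm \<mu>\<close>.\<close>
    define L where "L = t + sqrt (32 * C * t\<^sup>2 + 1)"
    obtain m where m: "m \<ge> nat \<lceil>(L / norm \<mu>)\<^sup>2\<rceil> + 1"
      and bdm: "(\<integral>\<^sup>+\<omega>. indicator {v. t * sqrt (real m) < norm v} (psum (\<lambda>_. h) m \<omega>) \<partial>?S) \<le> ennreal (1/576)"
      using bd by (auto simp: INFM_nat_le)
    have m0: "real m > 0" and mL: "(L / norm \<mu>)\<^sup>2 < real m" using m by linarith+
    \<comment> \<open>More than twice the second moment bound, so that Chebyshev leaves an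
      exceptional probability of at most 1/2; the summand 1 keeps \<open>a\<close> positive when
      \<open>C\<close> or \<open>t\<close> is 0.\<close>
    define a where "a = (32 * C * t\<^sup>2 + 1) * real m"
    have a: "a > 0" using m0 C(2) by (auto simp: a_def intro!: mult_pos_pos add_nonneg_pos)
    have "\<exists>\<omega>\<in>space ?S. norm (psum (\<lambda>_. h) m \<omega>) \<le> t * sqrt (real m) \<and> (norm (psum (\<lambda>_. h) m \<omega> - real m *\<^sub>R \<mu>))\<^sup>2 \<le> a"
    proof (rule ccontr)
      assume neg: "\<not> ?thesis"
      have "(1::ennreal) \<le> (\<integral>\<^sup>+\<omega>. 1 \<partial>?S)" by (simp add: S.emeasure_space_1)
      also have "\<dots> \<le> (\<integral>\<^sup>+\<omega>. indicator {v. t * sqrt (real m) < norm v} (psum (\<lambda>_. h) m \<omega>) +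
          ennreal (1/a) * ennreal ((norm (psum (\<lambda>_. h) m \<omega> - real m *\<^sub>R \<mu>))\<^sup>2) \<partial>?S)"
      proof (intro nn_integral_mono)
        fix \<omega> assume "\<omega> \<in> space ?S"
        with neg have "t * sqrt (real m) < norm (psum (\<lambda>_. h) m \<omega>) \<or> a < (norm (psum (\<lambda>_. h) m \<omega> - real m *\<^sub>R \<mu>))\<^sup>2"
          by (auto simp: not_le)
        then show "1 \<le> indicator {v. t * sqrt (real m) < norm v} (psum (\<lambda>_. h) m \<omega>) +
          ennreal (1/a) * ennreal ((norm (psum (\<lambda>_. h) m \<omega> - real m *\<^sub>R \<mu>))\<^sup>2)"
        proof
          assume "a < (norm (psum (\<lambda>_. h) m \<omega> - real m *\<^sub>R \<mu>))\<^sup>2"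
          then have "ennreal 1 \<le> ennreal (1/a * (norm (psum (\<lambda>_. h) m \<omega> - real m *\<^sub>R \<mu>))\<^sup>2)"
            using a by (intro ennreal_leI) (simp add: field_simps)
          then have "1 \<le> ennreal (1/a) * ennreal ((norm (psum (\<lambda>_. h) m \<omega> - real m *\<^sub>R \<mu>))\<^sup>2)"
            using a by (subst (asm) ennreal_mult') simp_all
          then show ?thesis by (rule add_increasing[OF zero_le])
        qed (simp add: indicator_def)
      qed
      also have "\<dots> = (\<integral>\<^sup>+\<omega>. indicator {v. t * sqrt (real m) < norm v} (psum (\<lambda>_. h) m \<omega>) \<partial>?S) +
          ennreal (1/a) * second_moment ?S (\<lambda>\<omega>. psum (\<lambda>_. h) m \<omega> - real m *\<^sub>R \<mu>)"
        by (simp add: nn_integral_add nn_integral_cmult)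
      also have "\<dots> \<le> ennreal (1/576) + ennreal (1/a) * ennreal (16 * C * t\<^sup>2 * real m)"
        by (intro add_mono mult_left_mono bdm sq') auto
      also have "\<dots> = ennreal (1/576 + 1/a * (16 * C * t\<^sup>2 * real m))"
        by (subst ennreal_mult'[symmetric], use a in simp, subst ennreal_plus[symmetric]) (use a C(2) in auto)
      also have "\<dots> < 1"
      proof -
        have "2 * (16 * C * t\<^sup>2 * real m) \<le> a" using m0 by (simp add: a_def algebra_simps)
        then have "1/a * (16 * C * t\<^sup>2 * real m) \<le> 1/2" using a by (simp add: field_simps)
        then have "1/576 + 1/a * (16 * C * t\<^sup>2 * real m) < 1" by simp
        then have "ennreal (1/576 + 1/a * (16 * C * t\<^sup>2 * real m)) < ennreal 1" by (intro ennreal_lessI) auto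
        then show ?thesis by simp
      qed
      finally show False by simp
    qed
    then obtain \<omega> where 1: "norm (psum (\<lambda>_. h) m \<omega>) \<le> t * sqrt (real m)"
      and 2: "(norm (psum (\<lambda>_. h) m \<omega> - real m *\<^sub>R \<mu>))\<^sup>2 \<le> a" by auto
    from 2 have "norm (psum (\<lambda>_. h) m \<omega> - real m *\<^sub>R \<mu>) \<le> sqrt a" by (simp add: real_le_rsqrt)
    then have "real m * norm \<mu> \<le> t * sqrt (real m) + sqrt a"
      using 1 norm_triangle_ineq4[of "psum (\<lambda>_. h) m \<omega>" "psum (\<lambda>_. h) m \<omega> - real m *\<^sub>R \<mu>"] by simp
    also have "\<dots> = L * sqrt (real m)" unfolding a_def L_def real_sqrt_mult by (rule distrib_right[symmetric])
    finally have "sqrt (real m) * (sqrt (real m) * norm \<mu>) \<le> sqrt (real m) * L"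
      by (simp add: mult_ac flip: real_sqrt_mult mult.assoc)
    then have "sqrt (real m) * norm \<mu> \<le> L" by (rule mult_left_le_imp_le) (use m0 in simp)
    then have "sqrt (real m) \<le> L / norm \<mu>" using \<open>\<mu> \<noteq> 0\<close> by (simp add: field_simps)
    then have "(sqrt (real m))\<^sup>2 \<le> (L / norm \<mu>)\<^sup>2" by (intro power_mono) auto
    with mL show False by simp
  qed
  then show "(\<integral>x. h x \<partial>M) = 0" by (simp add: \<mu>_def)
  show "second_moment ?S (psum (\<lambda>_. h) n) \<le> ennreal (16 * C * t\<^sup>2 * real n)"
    using sq'[of n] by (simp add: \<open>\<mu> = 0\<close>)
qed

section \<open>Gaussian vectors and the multivariate central limit theorem\<close>

abbreviation gauss :: "real measure" where "gauss \<equiv> std_normal_distribution"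

lemma prob_space_gauss: "prob_space gauss"
  by (rule prob_space_normal_density) simp

lemma gauss_second_moment: "(\<integral>x. x\<^sup>2 \<partial>gauss) = 1" "integrable gauss (\<lambda>x. x\<^sup>2)"
  using std_normal_distribution_even_moments[of 1] by (auto simp: fact_numeral)

lemma integrable_gauss_id: "integrable gauss (\<lambda>x. x)"
  using integrable_std_normal_distribution_moment[of 1] by auto

lemma symmetric_rv_gauss: "symmetric_rv gauss (\<lambda>x. x *\<^sub>R (v::'b::{real_normed_vector,second_countable_topology}))"
  unfolding symmetric_rv_def
proof safe
  fix G :: "'b \<Rightarrow> ennreal" assume [measurable]: "G \<in> borel_measurable borel"
  have "(\<integral>\<^sup>+x. ennreal (std_normal_density x) * G (x *\<^sub>R v) \<partial>lborel) =
    (\<integral>\<^sup>+x. ennreal (std_normal_density (- x)) * G ((- x) *\<^sub>R v) \<partial>lborel)"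
    by (subst nn_integral_real_affine[where c = "-1" and t = 0]) auto
  also have "\<dots> = (\<integral>\<^sup>+x. ennreal (std_normal_density x) * G (- (x *\<^sub>R v)) \<partial>lborel)"
    by (simp add: std_normal_density_def)
  finally show "(\<integral>\<^sup>+x. G (- (x *\<^sub>R v)) \<partial>gauss) = (\<integral>\<^sup>+x. G (x *\<^sub>R v) \<partial>gauss)"
    by (simp add: nn_integral_density)
qed

lemma nn_integral_psum_square_real:
  fixes e :: "'a \<Rightarrow> real"
  assumes M: "prob_space M" and e: "integrable M e" "(\<integral>x. e x \<partial>M) = 0" "integrable M (\<lambda>x. (e x)\<^sup>2)"
  shows "(\<integral>\<^sup>+\<omega>. ennreal ((s + psum (\<lambda>_. e) n \<omega>)\<^sup>2) \<partial>iid_seq M) = ennreal (s\<^sup>2 + real n * (\<integral>x. (e x)\<^sup>2 \<partial>M))"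
proof (induction n arbitrary: s)
  case 0
  show ?case using nn_integral_psum_0[OF M, of "\<lambda>_. e" "\<lambda>v. ennreal (v\<^sup>2)" s] e by simp
next
  case (Suc n)
  interpret prob_space M by fact
  let ?q = "\<integral>x. (e x)\<^sup>2 \<partial>M"
  note [measurable] = borel_measurable_integrable[OF e(1)]
  have q: "?q \<ge> 0" by simp
  have i: "integrable M (\<lambda>x. (s + e x)\<^sup>2 + real n * ?q)" using e by (simp add: power2_sum)
  have "(\<integral>\<^sup>+\<omega>. ennreal ((s + psum (\<lambda>_. e) (Suc n) \<omega>)\<^sup>2) \<partial>iid_seq M) =
    (\<integral>\<^sup>+x. ennreal ((s + e x)\<^sup>2 + real n * ?q) \<partial>M)"
    by (subst nn_integral_psum_Suc[OF M, where F = "\<lambda>v. ennreal (v\<^sup>2)"]) (auto simp: Suc.IH)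
  also have "\<dots> = ennreal (\<integral>x. (s + e x)\<^sup>2 + real n * ?q \<partial>M)"
    using q by (intro nn_integral_eq_integral i) auto
  also have "(\<integral>x. (s + e x)\<^sup>2 + real n * ?q \<partial>M) = s\<^sup>2 + real (Suc n) * ?q"
    using e by (simp add: power2_sum prob_space algebra_simps)
  finally show ?case .
qed

text \<open>The argument 1 suffices because \<open>e\<close> later ranges over all linear
  combinations of the coordinates. Among these are null variables, for which the normalized sum is
  almost surely 0; the central limit theorem is applied to the others.\<close>

lemma char_normalized_sum_tendsto:
  fixes e :: "'a \<Rightarrow> real"
  assumes M: "prob_space M" and e: "integrable M e" "(\<integral>x. e x \<partial>M) = 0" "integrable M (\<lambda>x. (e x)\<^sup>2)"
  shows "(\<lambda>n. char (distr (iid_seq M) borel (\<lambda>\<omega>. psum (\<lambda>_. e) n \<omega> / sqrt (real n))) 1)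
    \<longlonglongrightarrow> of_real (exp (- (\<integral>x. (e x)\<^sup>2 \<partial>M) / 2))"
proof -
  interpret prob_space M by fact
  interpret S: prob_space "iid_seq M" using M by (rule prob_space_iid_seq)
  note [measurable] = borel_measurable_integrable[OF e(1)]
  let ?q = "\<integral>x. (e x)\<^sup>2 \<partial>M"
  have q: "?q \<ge> 0" by simp
  have comp: "(\<integral>\<omega>. f (\<omega> i) \<partial>iid_seq M) = (\<integral>x. f x \<partial>M)" if "f \<in> borel_measurable M" for f :: "'a \<Rightarrow> real" and i
    by (subst iid_seq_component[OF M, of i, symmetric], subst integral_distr) (use that in auto)
  have compi: "integrable (iid_seq M) (\<lambda>\<omega>. f (\<omega> i))" if "integrable M f" for f :: "'a \<Rightarrow> real" and i
    using that by (subst (asm) iid_seq_component[OF M, of i, symmetric], subst (asm) integrable_distr_eq) auto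
  show ?thesis
  proof (cases "?q = 0")
    case True
    have "AE x in M. e x = 0"
      using True integral_nonneg_eq_0_iff_AE[OF e(3)] by auto
    then have "AE \<omega> in iid_seq M. e (\<omega> i) = 0" for i
      by (intro AE_PiM_component) (auto intro: M)
    then have ae: "AE \<omega> in iid_seq M. \<forall>i. e (\<omega> i) = 0" by (simp add: AE_all_countable)
    have "char (distr (iid_seq M) borel (\<lambda>\<omega>. psum (\<lambda>_. e) n \<omega> / sqrt (real n))) 1 = 1" for n
    proof -
      have "char (distr (iid_seq M) borel (\<lambda>\<omega>. psum (\<lambda>_. e) n \<omega> / sqrt (real n))) 1 =
         (CLINT \<omega>|iid_seq M. iexp (psum (\<lambda>_. e) n \<omega> / sqrt (real n)))"
        unfolding char_def by (subst integral_distr) auto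
      also have "\<dots> = (CLINT \<omega>|iid_seq M. 1)"
        using ae by (intro integral_cong_AE) (auto simp: psum_def elim!: eventually_mono)
      finally show ?thesis by (simp add: S.prob_space)
    qed
    then show ?thesis by (simp add: True)
  next
    case False
    define \<sigma> where "\<sigma> = sqrt ?q"
    have "?q > 0" using False q by (metis order_le_less)
    then have \<sigma>: "\<sigma> > 0" "\<sigma>\<^sup>2 = ?q" by (auto simp: \<sigma>_def)
    have w: "weak_conv_m (\<lambda>n. distr (iid_seq M) borel (\<lambda>\<omega>. (\<Sum>i<n. e (\<omega> i)) / sqrt (real n * \<sigma>\<^sup>2))) gauss"
    proof (rule S.central_limit_theorem_zero_mean)
      show "S.indep_vars (\<lambda>i. borel) (\<lambda>i \<omega>. e (\<omega> i)) UNIV"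
        by (rule S.indep_vars_compose2[OF indep_vars_iid_seq[OF M], where Y = "\<lambda>_. e"]) auto
      show "S.expectation (\<lambda>\<omega>. e (\<omega> n)) = 0" "S.expectation (\<lambda>\<omega>. (e (\<omega> n) - S.expectation (\<lambda>\<omega>. e (\<omega> n)))\<^sup>2) = \<sigma>\<^sup>2"
        "integrable (iid_seq M) (\<lambda>\<omega>. (e (\<omega> n))\<^sup>2)" for n
        using comp[of e n] comp[of "\<lambda>x. (e x)\<^sup>2" n] compi[of "\<lambda>x. (e x)\<^sup>2" n] e \<sigma> by auto
      show "distr (iid_seq M) borel (\<lambda>\<omega>. e (\<omega> n)) = distr M borel e" for n
        by (subst (2) iid_seq_component[OF M, of n, symmetric], subst distr_distr) (auto simp: comp_def)
    qed (use \<sigma> in auto)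
    \<comment> \<open>Evaluating at \<sigma> undoes the division by the standard deviation.\<close>
    have "(\<lambda>n. char (distr (iid_seq M) borel (\<lambda>\<omega>. (\<Sum>i<n. e (\<omega> i)) / sqrt (real n * \<sigma>\<^sup>2))) \<sigma>) \<longlonglongrightarrow> char gauss \<sigma>"
      by (rule levy_continuity1[OF _ real_dist_normal_dist w]) (auto intro: S.real_distribution_distr)
    moreover have "char (distr (iid_seq M) borel (\<lambda>\<omega>. (\<Sum>i<n. e (\<omega> i)) / sqrt (real n * \<sigma>\<^sup>2))) \<sigma> =
      char (distr (iid_seq M) borel (\<lambda>\<omega>. psum (\<lambda>_. e) n \<omega> / sqrt (real n))) 1" for n
    proof -
      have eq: "\<sigma> * (x / sqrt (real n * \<sigma>\<^sup>2)) = 1 * (x / sqrt (real n))" for x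
        using \<sigma>(1) by (simp add: real_sqrt_mult)
      have "char (distr (iid_seq M) borel (\<lambda>\<omega>. (\<Sum>i<n. e (\<omega> i)) / sqrt (real n * \<sigma>\<^sup>2))) \<sigma> =
        (CLINT \<omega>|iid_seq M. iexp (\<sigma> * ((\<Sum>i<n. e (\<omega> i)) / sqrt (real n * \<sigma>\<^sup>2))))"
        unfolding char_def by (rule integral_distr) auto
      also have "\<dots> = (CLINT \<omega>|iid_seq M. iexp (1 * (psum (\<lambda>_. e) n \<omega> / sqrt (real n))))"
        by (simp only: eq psum_def)
      also have "\<dots> = char (distr (iid_seq M) borel (\<lambda>\<omega>. psum (\<lambda>_. e) n \<omega> / sqrt (real n))) 1"
        unfolding char_def by (rule integral_distr[symmetric]) auto
      finally show ?thesis .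
    qed
    ultimately show ?thesis by (simp add: char_std_normal_distribution \<sigma>)
  qed
qed

lemma char_gauss_combination:
  assumes K: "finite K"
  shows "char (distr (iid_seq gauss) borel (\<lambda>g. \<Sum>k\<in>K. \<alpha> k * g k)) 1 = of_real (exp (- (\<Sum>k\<in>K. (\<alpha> k)\<^sup>2) / 2))"
proof -
  interpret S: prob_space "iid_seq gauss" by (intro prob_space_iid_seq prob_space_gauss)
  have "S.indep_vars (\<lambda>i. borel) (\<lambda>k g. \<alpha> k * g k) K"
    by (rule S.indep_vars_compose2[OF S.indep_vars_subset[OF indep_vars_iid_seq[OF prob_space_gauss]], where Y = "\<lambda>k x. \<alpha> k * x"]) auto
  then have "char (distr (iid_seq gauss) borel (\<lambda>g. \<Sum>k\<in>K. \<alpha> k * g k)) 1 =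
    (\<Prod>k\<in>K. char (distr (iid_seq gauss) borel (\<lambda>g. \<alpha> k * g k)) 1)"
    by (rule S.char_distr_sum)
  also have "\<dots> = (\<Prod>k\<in>K. char gauss (\<alpha> k))"
  proof (rule prod.cong[OF refl])
    fix k
    have "char gauss (\<alpha> k) = (CLINT x|distr (iid_seq gauss) gauss (\<lambda>g. g k). iexp (\<alpha> k * x))"
      by (simp only: iid_seq_component[OF prob_space_gauss] char_def)
    also have "\<dots> = char (distr (iid_seq gauss) borel (\<lambda>g. \<alpha> k * g k)) 1"
      unfolding char_def by (subst (1 2) integral_distr) auto
    finally show "char (distr (iid_seq gauss) borel (\<lambda>g. \<alpha> k * g k)) 1 = char gauss (\<alpha> k)" ..
  qed
  also have "\<dots> = of_real (exp (- (\<Sum>k\<in>K. (\<alpha> k)\<^sup>2) / 2))"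
    using K by (simp add: char_std_normal_distribution exp_sum[symmetric] sum_negf sum_divide_distrib flip: of_real_prod)
  finally show ?thesis .
qed

section \<open>Trigonometric polynomials and the Cramer-Wold device\<close>

lemma expectation_cos_eq_char:
  fixes Y :: "'a \<Rightarrow> real"
  assumes "prob_space M" and [measurable]: "Y \<in> borel_measurable M"
  shows "(\<integral>\<omega>. cos (Y \<omega> + b) \<partial>M) = Re (cis b * char (distr M borel Y) 1)"
proof -
  interpret prob_space M by fact
  have "cis b * char (distr M borel Y) 1 = (CLINT \<omega>|M. cis b * iexp (Y \<omega>))"
    unfolding char_def by (subst integral_distr) auto
  also have "Re \<dots> = (\<integral>\<omega>. Re (cis b * iexp (Y \<omega>)) \<partial>M)"
    by (intro integral_Re[symmetric] integrable_const_bound[of _ 1]) (auto simp: norm_mult)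
  also have "\<dots> = (\<integral>\<omega>. cos (Y \<omega> + b) \<partial>M)"
    by (simp add: cis_conv_exp[symmetric] cis_mult add.commute)
  finally show ?thesis by simp
qed

text \<open>Trigonometric polynomials in the coordinates of \<open>K\<close>; the phase
  \<open>b\<close> makes sines available. Taking sums of single cosines as the definition reduces
  convergence of expectations to characteristic functions.\<close>

inductive trig_fun :: "nat set \<Rightarrow> ((nat \<Rightarrow> real) \<Rightarrow> real) \<Rightarrow> bool" for K where
  cos: "trig_fun K (\<lambda>t. c * cos ((\<Sum>k\<in>K. \<alpha> k * t k) + b))"
| add: "trig_fun K p \<Longrightarrow> trig_fun K q \<Longrightarrow> trig_fun K (\<lambda>t. p t + q t)"

lemma trig_fun_const: "trig_fun K (\<lambda>_. c)"
  using trig_fun.cos[of K c "\<lambda>_. 0" 0] by simp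

text \<open>The product-to-sum formula. It makes the sums of cosines an algebra, as
  Stone-Weierstrass demands.\<close>

lemma trig_fun_mult_cos: "trig_fun K p \<Longrightarrow> trig_fun K (\<lambda>t. p t * (c * cos ((\<Sum>k\<in>K. \<alpha> k * t k) + b)))"
proof (induction rule: trig_fun.induct)
  case (cos c' \<alpha>' b')
  have "(c' * cos ((\<Sum>k\<in>K. \<alpha>' k * t k) + b')) * (c * cos ((\<Sum>k\<in>K. \<alpha> k * t k) + b)) =
     (c' * c / 2) * cos ((\<Sum>k\<in>K. (\<alpha>' k - \<alpha> k) * t k) + (b' - b)) +
     (c' * c / 2) * cos ((\<Sum>k\<in>K. (\<alpha>' k + \<alpha> k) * t k) + (b' + b))" for t
  proof -
    have "(\<Sum>k\<in>K. (\<alpha>' k - \<alpha> k) * t k) + (b' - b) = ((\<Sum>k\<in>K. \<alpha>' k * t k) + b') - ((\<Sum>k\<in>K. \<alpha> k * t k) + b)"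
      "(\<Sum>k\<in>K. (\<alpha>' k + \<alpha> k) * t k) + (b' + b) = ((\<Sum>k\<in>K. \<alpha>' k * t k) + b') + ((\<Sum>k\<in>K. \<alpha> k * t k) + b)"
      by (simp_all add: algebra_simps sum.distrib sum_subtractf)
    then show ?thesis by (simp only: cos_diff cos_add) (simp add: field_simps)
  qed
  then show ?case by (simp only:) (intro trig_fun.intros)
next
  case (add p q)
  then show ?case by (simp only: distrib_right) (intro trig_fun.intros)
qed

lemma trig_fun_mult: "trig_fun K q \<Longrightarrow> trig_fun K r \<Longrightarrow> trig_fun K (\<lambda>t. r t * q t)"
proof (induction rule: trig_fun.induct)
  case (cos c \<alpha> b)
  then show ?case by (rule trig_fun_mult_cos)
next
  case (add p q)
  then show ?case by (auto simp: distrib_left intro: trig_fun.add)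
qed

lemma trig_fun_polynomial:
  assumes "real_polynomial_function (f :: real \<Rightarrow> real)" "trig_fun K p"
  shows "trig_fun K (\<lambda>t. f (p t))"
  using assms(1)
proof (induction rule: real_polynomial_function.induct)
  case (linear f)
  then obtain c where "f = (\<lambda>x. x * c)" by (auto simp: real_bounded_linear)
  then show ?case using trig_fun_mult[OF trig_fun_const assms(2)] by simp
qed (auto intro: trig_fun_const trig_fun.add trig_fun_mult)

lemma trig_fun_continuous: "trig_fun K p \<Longrightarrow> continuous_on A p"
proof (induction rule: trig_fun.induct)
  case (cos c \<alpha> b)
  have "continuous_on A (\<lambda>t::nat \<Rightarrow> real. t k)" for k
    by (rule continuous_on_subset[OF continuous_on_product_coordinates]) simp
  then show ?case by (intro continuous_intros)
qed (intro continuous_intros)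

lemma trig_fun_bounded: "trig_fun K p \<Longrightarrow> \<exists>B. \<forall>t. \<bar>p t\<bar> \<le> B"
proof (induction rule: trig_fun.induct)
  case (cos c \<alpha> b)
  have "\<bar>c * cos x\<bar> \<le> \<bar>c\<bar>" for x by (simp add: abs_mult mult_left_le)
  then show ?case by blast
next
  case (add p q)
  then obtain B B' where "\<And>t. \<bar>p t\<bar> \<le> B" "\<And>t. \<bar>q t\<bar> \<le> B'" by blast
  then have "\<bar>p t + q t\<bar> \<le> B + B'" for t by (rule order_trans[OF abs_triangle_ineq add_mono])
  then show ?case by blast
qed

lemma trig_fun_measurable:
  "trig_fun K p \<Longrightarrow> (\<And>k. (\<lambda>\<omega>. X \<omega> k) \<in> borel_measurable M) \<Longrightarrow> (\<lambda>\<omega>. p (X \<omega>)) \<in> borel_measurable M"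
  by (induction rule: trig_fun.induct) auto

text \<open>Coordinates outside \<open>K\<close> are pinned to 0, so that functions of the
  coordinates in \<open>K\<close> separate the points of the cube.\<close>

lemma compact_cube: "compact {t::nat \<Rightarrow> real. \<forall>k. t k \<in> (if k \<in> K then {-R..R} else {0})}"
proof -
  have "compactin (product_topology (\<lambda>i. euclidean) UNIV) (PiE UNIV (\<lambda>k. if k \<in> K then {-R..R} else {0::real}))"
    by (subst compactin_PiE) auto
  also have "PiE UNIV (\<lambda>k. if k \<in> K then {-R..R} else {0::real}) = {t. \<forall>k. t k \<in> (if k \<in> K then {-R..R} else {0})}"
    by (simp add: PiE_UNIV_domain Pi_def)
  finally show ?thesis by (simp add: euclidean_product_topology)
qed

text \<open>
  Stone-Weierstrass only controls the approximation on the cube. Composing with a polynomial close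
  to the truncation at \<open>\<plusminus>1\<close> makes it bounded everywhere.
\<close>

lemma trig_fun_dense:
  fixes F :: "(nat \<Rightarrow> real) \<Rightarrow> real"
  assumes K: "finite K" and R: "R > 0" and \<epsilon>: "\<epsilon> > 0"
    and F: "continuous_on UNIV F" "\<And>t. \<bar>F t\<bar> \<le> 1"
  defines "Q \<equiv> {t::nat \<Rightarrow> real. \<forall>k. t k \<in> (if k \<in> K then {-R..R} else {0})}"
  obtains q where "trig_fun K q" "\<And>t. t \<in> Q \<Longrightarrow> \<bar>F t - q t\<bar> \<le> \<epsilon>" "\<And>t. \<bar>q t\<bar> \<le> 1 + \<epsilon>"
proof -
  interpret function_ring_on "Collect (trig_fun K)" Q
  proof
    show "compact Q" unfolding Q_def by (rule compact_cube)
    fix x y assume xy: "x \<in> Q" "y \<in> Q" "x \<noteq> y"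
    then obtain j where j: "x j \<noteq> y j" by auto
    with xy have jK: "j \<in> K" unfolding Q_def by (metis (mono_tags, lifting) mem_Collect_eq singletonD)
    \<comment> \<open>This scale maps \<open>{-R..R}\<close> into the interval on which the sine is
      injective; the phase \<open>- (pi/2)\<close> below turns the cosine into that sine.\<close>
    define a where "a = pi / (4 * R)"
    have *: "z \<in> Q \<Longrightarrow> z k \<in> (if k \<in> K then {-R..R} else {0})" for z k unfolding Q_def by blast
    have "x j \<in> {-R..R}" "y j \<in> {-R..R}" using *[OF xy(1), of j] *[OF xy(2), of j] jK by auto
    then have ab: "\<bar>a * x j\<bar> \<le> pi / 4" "\<bar>a * y j\<bar> \<le> pi / 4"
      using R by (auto simp: a_def abs_mult field_simps)
    have sin: "1 * cos ((\<Sum>k\<in>K. (if k = j then a else 0) * t k) + (- (pi/2))) = sin (a * t j)" for t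
    proof -
      have "(\<Sum>k\<in>K. (if k = j then a else 0) * t k) = a * t j"
        using jK K by (simp add: if_distrib[of "\<lambda>x. x * _"] sum.delta cong: if_cong)
      then show ?thesis by (simp add: cos_diff)
    qed
    have "sin (a * x j) \<noteq> sin (a * y j)"
    proof
      assume "sin (a * x j) = sin (a * y j)"
      moreover have "\<bar>a * x j\<bar> \<le> pi / 2" "\<bar>a * y j\<bar> \<le> pi / 2" using ab pi_gt_zero by linarith+
      ultimately have "a * x j = a * y j" by (meson abs_le_D1 abs_le_D2 minus_le_iff sin_inj_pi)
      with j R show False by (simp add: a_def)
    qed
    then show "\<exists>f\<in>Collect (trig_fun K). f x \<noteq> f y"
      using trig_fun.cos[of K 1 "\<lambda>k. if k = j then a else 0" "- (pi/2)"] unfolding sin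
      by (intro bexI[of _ "\<lambda>t. sin (a * t j)"]) auto
  qed (auto intro: trig_fun.add trig_fun_mult trig_fun_const trig_fun_continuous)
  have "\<epsilon> / 2 > 0" using \<epsilon> by simp
  from Stone_Weierstrass_basic[OF continuous_on_subset[OF F(1)] this] obtain p where
    p: "trig_fun K p" "\<And>t. t \<in> Q \<Longrightarrow> \<bar>F t - p t\<bar> < \<epsilon> / 2" by auto
  obtain A where A: "\<And>t. \<bar>p t\<bar> \<le> A" using trig_fun_bounded[OF p(1)] by blast
  \<comment> \<open>Truncation is 1-Lipschitz and fixes the values of \<open>F\<close>, so it does
    not worsen the approximation by \<open>p\<close>; half of \<epsilon> is spent on
    \<open>p\<close> and half on the polynomial \<open>r\<close>.\<close>
  define clip where "clip x = max (- 1) (min 1 x)" for x :: real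
  have clip: "\<bar>clip x\<bar> \<le> 1" "\<bar>clip x - clip y\<bar> \<le> \<bar>x - y\<bar>" "\<bar>x\<bar> \<le> 1 \<Longrightarrow> clip x = x" for x y
    unfolding clip_def by (simp_all add: max_def min_def abs_le_iff) linarith+
  have "continuous_on {-A..A} clip" unfolding clip_def by (intro continuous_intros)
  then obtain r where r: "real_polynomial_function r" "\<And>x. x \<in> {-A..A} \<Longrightarrow> \<bar>clip x - r x\<bar> < \<epsilon> / 2"
    using Stone_Weierstrass_real_polynomial_function[of "{-A..A}" clip "\<epsilon> / 2"] \<epsilon> by (metis compact_Icc half_gt_zero)
  have rp: "\<bar>clip (p t) - r (p t)\<bar> < \<epsilon> / 2" for t using A[of t] by (intro r) auto
  show ?thesis
  proof (rule that[of "\<lambda>t. r (p t)"])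
    show "trig_fun K (\<lambda>t. r (p t))" by (rule trig_fun_polynomial[OF r(1) p(1)])
    show "\<bar>r (p t)\<bar> \<le> 1 + \<epsilon>" for t using rp[of t] clip(1)[of "p t"] \<epsilon> by linarith
    fix t assume "t \<in> Q"
    then show "\<bar>F t - r (p t)\<bar> \<le> \<epsilon>"
      using p(2)[of t] rp[of t] clip(2)[of "F t" "p t"] clip(3)[OF F(2)[of t]] by linarith
  qed
qed

text \<open>Outside the cube some coordinate exceeds \<open>R\<close>, so the crude bound
  \<open>2 + \<epsilon>\<close> times the sum of the squares over \<open>R^2\<close> dominates the
  difference. Second moments at most 1 make the resulting error uniform over all such
  \<open>X\<close>.\<close>

lemma trig_fun_approximation_error:
  fixes X :: "'a \<Rightarrow> nat \<Rightarrow> real" and F :: "(nat \<Rightarrow> real) \<Rightarrow> real"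
  assumes "prob_space M" and K: "finite K" and R: "R > 0"
    and FX[measurable]: "(\<lambda>\<omega>. F (X \<omega>)) \<in> borel_measurable M" and qX[measurable]: "(\<lambda>\<omega>. q (X \<omega>)) \<in> borel_measurable M"
    and F: "\<And>t. \<bar>F t\<bar> \<le> 1" and q: "\<And>t. \<bar>q t\<bar> \<le> 1 + \<epsilon>"
    and Fq: "\<And>t. t \<in> {t. \<forall>k. t k \<in> (if k \<in> K then {-R..R} else {0})} \<Longrightarrow> \<bar>F t - q t\<bar> \<le> \<epsilon>"
    and X: "\<And>\<omega> k. k \<notin> K \<Longrightarrow> X \<omega> k = 0" "\<And>k. k \<in> K \<Longrightarrow> integrable M (\<lambda>\<omega>. (X \<omega> k)\<^sup>2)"
      "\<And>k. k \<in> K \<Longrightarrow> (\<integral>\<omega>. (X \<omega> k)\<^sup>2 \<partial>M) \<le> 1"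
    and \<epsilon>: "\<epsilon> > 0"
  shows "\<bar>(\<integral>\<omega>. F (X \<omega>) \<partial>M) - (\<integral>\<omega>. q (X \<omega>) \<partial>M)\<bar> \<le> \<epsilon> + (2 + \<epsilon>) * (real (card K) / R\<^sup>2)"
proof -
  interpret prob_space M by fact
  have iF: "integrable M (\<lambda>\<omega>. F (X \<omega>))" by (rule integrable_const_bound[of _ 1]) (auto simp: F)
  have iq: "integrable M (\<lambda>\<omega>. q (X \<omega>))" by (rule integrable_const_bound[of _ "1 + \<epsilon>"]) (auto simp: q)
  have bound: "\<bar>F (X \<omega>) - q (X \<omega>)\<bar> \<le> \<epsilon> + (2 + \<epsilon>) * (\<Sum>k\<in>K. (X \<omega> k)\<^sup>2 / R\<^sup>2)" for \<omega>
  proof (cases "\<forall>k\<in>K. \<bar>X \<omega> k\<bar> \<le> R")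
    case True
    then have "X \<omega> \<in> {t. \<forall>k. t k \<in> (if k \<in> K then {-R..R} else {0})}"
      using X(1) by (auto simp: abs_le_iff minus_le_iff)
    then have "\<bar>F (X \<omega>) - q (X \<omega>)\<bar> \<le> \<epsilon>" by (rule Fq)
    also have "\<dots> \<le> \<epsilon> + (2 + \<epsilon>) * (\<Sum>k\<in>K. (X \<omega> k)\<^sup>2 / R\<^sup>2)"
      using \<epsilon> by (simp add: sum_nonneg)
    finally show ?thesis .
  next
    case False
    then obtain k where k: "k \<in> K" "R < \<bar>X \<omega> k\<bar>" by auto
    have "R\<^sup>2 \<le> \<bar>X \<omega> k\<bar>\<^sup>2" using k R by (intro power_mono) auto
    then have "1 \<le> (X \<omega> k)\<^sup>2 / R\<^sup>2" using R by simp
    also have "\<dots> \<le> (\<Sum>k\<in>K. (X \<omega> k)\<^sup>2 / R\<^sup>2)" using k K by (intro member_le_sum) auto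
    finally have "2 + \<epsilon> \<le> (2 + \<epsilon>) * (\<Sum>k\<in>K. (X \<omega> k)\<^sup>2 / R\<^sup>2)" using \<epsilon> by simp
    moreover have "\<bar>F (X \<omega>) - q (X \<omega>)\<bar> \<le> 2 + \<epsilon>" using F[of "X \<omega>"] q[of "X \<omega>"] by linarith
    ultimately show ?thesis using \<epsilon> by linarith
  qed
  have "\<bar>(\<integral>\<omega>. F (X \<omega>) \<partial>M) - (\<integral>\<omega>. q (X \<omega>) \<partial>M)\<bar> = \<bar>\<integral>\<omega>. F (X \<omega>) - q (X \<omega>) \<partial>M\<bar>"
    using iF iq by simp
  also have "\<dots> \<le> (\<integral>\<omega>. \<bar>F (X \<omega>) - q (X \<omega>)\<bar> \<partial>M)" by (rule integral_abs_bound)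
  also have "\<dots> \<le> (\<integral>\<omega>. \<epsilon> + (2 + \<epsilon>) * (\<Sum>k\<in>K. (X \<omega> k)\<^sup>2 / R\<^sup>2) \<partial>M)"
    using iF iq X(2) by (intro integral_mono bound) auto
  also have "\<dots> = \<epsilon> + (2 + \<epsilon>) * (\<Sum>k\<in>K. (\<integral>\<omega>. (X \<omega> k)\<^sup>2 \<partial>M) / R\<^sup>2)"
    using X(2) by (simp add: prob_space)
  also have "\<dots> \<le> \<epsilon> + (2 + \<epsilon>) * (\<Sum>k\<in>K. 1 / R\<^sup>2)"
    using X(3) \<epsilon> by (intro add_left_mono mult_left_mono sum_mono divide_right_mono) auto
  finally show ?thesis by simp
qed

lemma normalized_psum_combination:
  "(1 / sqrt (real n)) *\<^sub>R psum (\<lambda>_ z. \<Sum>k\<in>K. e k z *\<^sub>R x k) n \<omega> =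
    (\<Sum>k\<in>K. (psum (\<lambda>_. e k) n \<omega> / sqrt (real n)) *\<^sub>R x k)"
  unfolding psum_def by (subst sum.swap) (simp add: scaleR_sum_left scaleR_sum_right sum_divide_distrib)

text \<open>The vectors \<open>x k\<close> enter only through \<open>F\<close>, so the claim
  concerns finitely many real coordinates. Expectations of trigonometric polynomials converge by
  characteristic functions, and the error of replacing \<open>F\<close> by such a polynomial is
  uniform in \<open>n\<close> since the coordinates have variance at most 1.\<close>

theorem multivariate_clt:
  fixes e :: "nat \<Rightarrow> 'a \<Rightarrow> real" and x :: "nat \<Rightarrow> 'b::{real_normed_vector,second_countable_topology}"
  assumes M: "prob_space M" and K: "finite K"
    and e: "\<And>k. k \<in> K \<Longrightarrow> integrable M (e k)" "\<And>k. k \<in> K \<Longrightarrow> (\<integral>z. e k z \<partial>M) = 0"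
      "\<And>j k. j \<in> K \<Longrightarrow> k \<in> K \<Longrightarrow> integrable M (\<lambda>z. e j z * e k z)"
      "\<And>j k. j \<in> K \<Longrightarrow> k \<in> K \<Longrightarrow> (\<integral>z. e j z * e k z \<partial>M) = (if j = k then 1 else 0)"
    and f: "continuous_on UNIV f" "\<And>v. \<bar>f v\<bar> \<le> (1::real)"
  shows "(\<lambda>n. \<integral>\<omega>. f ((1 / sqrt (real n)) *\<^sub>R psum (\<lambda>_ z. \<Sum>k\<in>K. e k z *\<^sub>R x k) n \<omega>) \<partial>iid_seq M)
    \<longlonglongrightarrow> (\<integral>g. f (\<Sum>k\<in>K. g k *\<^sub>R x k) \<partial>iid_seq gauss)"
proof -
  interpret prob_space M by fact
  interpret S: prob_space "iid_seq M" using M by (rule prob_space_iid_seq)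
  interpret G: prob_space "iid_seq gauss" by (intro prob_space_iid_seq prob_space_gauss)
  have em[measurable]: "k \<in> K \<Longrightarrow> e k \<in> borel_measurable M" for k using e(1) by (rule borel_measurable_integrable)
  have fm[measurable]: "f \<in> borel_measurable borel" using f(1) by (rule borel_measurable_continuous_onI)
  define F where "F t = f (\<Sum>k\<in>K. t k *\<^sub>R x k)" for t :: "nat \<Rightarrow> real"
  \<comment> \<open>The value 0 outside \<open>K\<close> is what places these points in the
    cube.\<close>
  define T where "T n \<omega> k = (if k \<in> K then psum (\<lambda>_. e k) n \<omega> / sqrt (real n) else 0)" for n \<omega> k
  define Z where "Z g k = (if k \<in> K then g k else 0)" for g :: "nat \<Rightarrow> real" and k
  have FT: "f ((1 / sqrt (real n)) *\<^sub>R psum (\<lambda>_ z. \<Sum>k\<in>K. e k z *\<^sub>R x k) n \<omega>) = F (T n \<omega>)" for n \<omega>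
    unfolding normalized_psum_combination F_def T_def by (simp cong: sum.cong)
  have FZ: "f (\<Sum>k\<in>K. g k *\<^sub>R x k) = F (Z g)" for g
    unfolding F_def Z_def by (simp cong: sum.cong)
  have Tm: "(\<lambda>\<omega>. T n \<omega> k) \<in> borel_measurable (iid_seq M)" for n k by (cases "k \<in> K") (simp_all add: T_def)
  have Zm: "(\<lambda>g. Z g k) \<in> borel_measurable (iid_seq gauss)" for k by (cases "k \<in> K") (simp_all add: Z_def)
  have FTm: "(\<lambda>\<omega>. F (T n \<omega>)) \<in> borel_measurable (iid_seq M)" for n
    using Tm[of n] unfolding F_def by measurable
  have FZm: "(\<lambda>g. F (Z g)) \<in> borel_measurable (iid_seq gauss)"
    using Zm unfolding F_def by measurable
  have F1: "\<bar>F t\<bar> \<le> 1" for t by (simp add: F_def f)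
  have Fc: "continuous_on UNIV F"
    unfolding F_def by (intro continuous_on_compose2[OF f(1)] continuous_intros) auto
  have T2: "integrable (iid_seq M) (\<lambda>\<omega>. (T n \<omega> k)\<^sup>2)" "(\<integral>\<omega>. (T n \<omega> k)\<^sup>2 \<partial>iid_seq M) \<le> 1" if "k \<in> K" for n k
  proof -
    have e2: "integrable M (\<lambda>z. (e k z)\<^sup>2)" "(\<integral>z. (e k z)\<^sup>2 \<partial>M) = 1"
      using e(3,4)[OF that that] by (auto simp: power2_eq_square)
    have nn: "(\<integral>\<^sup>+\<omega>. ennreal ((psum (\<lambda>_. e k) n \<omega>)\<^sup>2) \<partial>iid_seq M) = ennreal (real n)"
      using nn_integral_psum_square_real[OF M e(1)[OF that] e(2)[OF that] e2(1), of 0 n] e2(2) by simp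
    have i: "integrable (iid_seq M) (\<lambda>\<omega>. (psum (\<lambda>_. e k) n \<omega>)\<^sup>2)"
      by (rule integrableI_nonneg) (use that nn in auto)
    moreover have "(\<integral>\<omega>. (psum (\<lambda>_. e k) n \<omega>)\<^sup>2 \<partial>iid_seq M) = real n"
      by (subst integral_eq_nn_integral) (use that nn in auto)
    ultimately show "integrable (iid_seq M) (\<lambda>\<omega>. (T n \<omega> k)\<^sup>2)" "(\<integral>\<omega>. (T n \<omega> k)\<^sup>2 \<partial>iid_seq M) \<le> 1"
      using that by (auto simp: T_def power_divide)
  qed
  have Z2: "integrable (iid_seq gauss) (\<lambda>g. (Z g k)\<^sup>2)" "(\<integral>g. (Z g k)\<^sup>2 \<partial>iid_seq gauss) \<le> 1" if "k \<in> K" for k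
  proof -
    have c: "gauss = distr (iid_seq gauss) gauss (\<lambda>g. g k)" by (simp only: iid_seq_component[OF prob_space_gauss])
    have "integrable (distr (iid_seq gauss) gauss (\<lambda>g. g k)) (\<lambda>x. x\<^sup>2)"
      using gauss_second_moment(2) c by simp
    then show "integrable (iid_seq gauss) (\<lambda>g. (Z g k)\<^sup>2)"
      using that by (subst (asm) integrable_distr_eq) (auto simp: Z_def)
    have "(\<integral>x. x\<^sup>2 \<partial>distr (iid_seq gauss) gauss (\<lambda>g. g k)) = 1"
      using gauss_second_moment(1) c by simp
    then show "(\<integral>g. (Z g k)\<^sup>2 \<partial>iid_seq gauss) \<le> 1"
      using that by (subst (asm) integral_distr) (auto simp: Z_def)
  qed
  have trig: "(\<lambda>n. \<integral>\<omega>. p (T n \<omega>) \<partial>iid_seq M) \<longlonglongrightarrow> (\<integral>g. p (Z g) \<partial>iid_seq gauss)" if "trig_fun K p" for p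
    using that
  proof (induction rule: trig_fun.induct)
    case (cos c \<alpha> b)
    define u where "u z = (\<Sum>k\<in>K. \<alpha> k * e k z)" for z
    have um[measurable]: "u \<in> borel_measurable M" unfolding u_def by measurable
    have u2: "(u z)\<^sup>2 = (\<Sum>j\<in>K. \<Sum>k\<in>K. \<alpha> j * \<alpha> k * (e j z * e k z))" for z
      unfolding u_def power2_eq_square by (simp add: sum_product mult_ac)
    have iu: "integrable M u" "(\<integral>z. u z \<partial>M) = 0" "integrable M (\<lambda>z. (u z)\<^sup>2)"
      unfolding u2 using e by (auto simp: u_def[abs_def])
    \<comment> \<open>Orthonormality turns the variance of the combination into the sum of squares
      in the characteristic function of the Gaussian combination.\<close>
    have "(\<integral>z. (u z)\<^sup>2 \<partial>M) = (\<Sum>j\<in>K. \<Sum>k\<in>K. \<alpha> j * \<alpha> k * (if j = k then 1 else 0))"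
      unfolding u2 using e by (simp cong: sum.cong)
    also have "\<dots> = (\<Sum>k\<in>K. (\<alpha> k)\<^sup>2)"
      using K by (simp add: if_distrib[of "\<lambda>x. _ * x"] power2_eq_square cong: if_cong)
    finally have var: "(\<integral>z. (u z)\<^sup>2 \<partial>M) = (\<Sum>k\<in>K. (\<alpha> k)\<^sup>2)" .
    have sT: "(\<Sum>k\<in>K. \<alpha> k * T n \<omega> k) = psum (\<lambda>_. u) n \<omega> / sqrt (real n)" for n \<omega>
      unfolding psum_def u_def by (subst sum.swap)
        (simp add: T_def psum_def sum_divide_distrib sum_distrib_left cong: sum.cong)
    have sZ: "(\<Sum>k\<in>K. \<alpha> k * Z g k) = (\<Sum>k\<in>K. \<alpha> k * g k)" for g
      by (simp add: Z_def cong: sum.cong)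
    have A: "(\<integral>\<omega>. c * cos ((\<Sum>k\<in>K. \<alpha> k * T n \<omega> k) + b) \<partial>iid_seq M) =
      c * Re (cis b * char (distr (iid_seq M) borel (\<lambda>\<omega>. psum (\<lambda>_. u) n \<omega> / sqrt (real n))) 1)" for n
      unfolding sT by (subst expectation_cos_eq_char[OF S.prob_space_axioms, symmetric]) auto
    have B: "(\<integral>g. c * cos ((\<Sum>k\<in>K. \<alpha> k * Z g k) + b) \<partial>iid_seq gauss) =
      c * Re (cis b * of_real (exp (- (\<Sum>k\<in>K. (\<alpha> k)\<^sup>2) / 2)))"
      unfolding sZ char_gauss_combination[OF K, symmetric]
      by (subst expectation_cos_eq_char[OF G.prob_space_axioms, symmetric]) auto
    show ?case unfolding A B
      using char_normalized_sum_tendsto[OF M iu] unfolding var by (intro tendsto_intros)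
  next
    case (add p q)
    have "integrable (iid_seq M) (\<lambda>\<omega>. p (T n \<omega>))" "integrable (iid_seq gauss) (\<lambda>g. p (Z g))" if p: "trig_fun K p" for p n
    proof -
      obtain B where "\<And>t. \<bar>p t\<bar> \<le> B" using trig_fun_bounded[OF p] by blast
      then show "integrable (iid_seq M) (\<lambda>\<omega>. p (T n \<omega>))" "integrable (iid_seq gauss) (\<lambda>g. p (Z g))"
        using trig_fun_measurable[OF p, of "T n", OF Tm] trig_fun_measurable[OF p, of Z, OF Zm]
        by (auto intro!: S.integrable_const_bound[of _ B] G.integrable_const_bound[of _ B])
    qed
    with add show ?case by (simp add: tendsto_add)
  qed
  show ?thesis unfolding FT FZ
  proof (rule LIMSEQ_I)
    fix r :: real assume r: "r > 0"
    \<comment> \<open>The three errors add up to less than 4\<epsilon> + \<epsilon> + 4\<epsilon>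
      \<le> 9r/10. In \<open>R\<close> the square root gives
      \<open>card K / R^2 \<le> \<epsilon>\<close>, and the added 1 keeps \<open>R\<close> positive
      for empty \<open>K\<close>.\<close>
    define \<epsilon> where "\<epsilon> = min 1 (r / 10)"
    have \<epsilon>: "\<epsilon> > 0" "\<epsilon> \<le> 1" "\<epsilon> \<le> r / 10" using r by (auto simp: \<epsilon>_def)
    define R where "R = sqrt (real (card K) / \<epsilon>) + 1"
    have R: "R > 0" using \<epsilon> by (simp add: R_def add_nonneg_pos)
    have "real (card K) / \<epsilon> = (sqrt (real (card K) / \<epsilon>))\<^sup>2" using \<epsilon> by simp
    also have "\<dots> \<le> R\<^sup>2" using \<epsilon> by (intro power_mono) (auto simp: R_def)
    finally have KR: "real (card K) / R\<^sup>2 \<le> \<epsilon>" using R \<epsilon> by (simp add: field_simps)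
    obtain q where q: "trig_fun K q" "\<And>t. t \<in> {t. \<forall>k. t k \<in> (if k \<in> K then {-R..R} else {0})} \<Longrightarrow> \<bar>F t - q t\<bar> \<le> \<epsilon>" "\<And>t. \<bar>q t\<bar> \<le> 1 + \<epsilon>"
      by (rule trig_fun_dense[OF K R \<epsilon>(1) Fc F1], rule that)
    have "\<epsilon> + (2 + \<epsilon>) * (real (card K) / R\<^sup>2) \<le> \<epsilon> + 3 * \<epsilon>"
      using KR \<epsilon> by (intro add_left_mono mult_mono) auto
    then have err: "\<epsilon> + (2 + \<epsilon>) * (real (card K) / R\<^sup>2) \<le> 4 * \<epsilon>" by simp
    have 1: "\<bar>(\<integral>\<omega>. F (T n \<omega>) \<partial>iid_seq M) - (\<integral>\<omega>. q (T n \<omega>) \<partial>iid_seq M)\<bar> \<le> 4 * \<epsilon>" for n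
      by (rule order_trans[OF trig_fun_approximation_error[where M = "iid_seq M" and X = "T n", OF S.prob_space_axioms K R FTm
            trig_fun_measurable[OF q(1) Tm] F1 q(3) q(2) _ T2 \<epsilon>(1)] err]) (auto simp: T_def)
    have 2: "\<bar>(\<integral>g. F (Z g) \<partial>iid_seq gauss) - (\<integral>g. q (Z g) \<partial>iid_seq gauss)\<bar> \<le> 4 * \<epsilon>"
      by (rule order_trans[OF trig_fun_approximation_error[where M = "iid_seq gauss" and X = Z, OF G.prob_space_axioms K R FZm
            trig_fun_measurable[OF q(1) Zm] F1 q(3) q(2) _ Z2 \<epsilon>(1)] err]) (auto simp: Z_def)
    obtain n0 where n0: "\<And>n. n \<ge> n0 \<Longrightarrow> norm ((\<integral>\<omega>. q (T n \<omega>) \<partial>iid_seq M) - (\<integral>g. q (Z g) \<partial>iid_seq gauss)) < \<epsilon>"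
      using LIMSEQ_D[OF trig[OF q(1)] \<epsilon>(1)] by blast
    show "\<exists>no. \<forall>n\<ge>no. norm ((\<integral>\<omega>. F (T n \<omega>) \<partial>iid_seq M) - (\<integral>g. F (Z g) \<partial>iid_seq gauss)) < r"
    proof (intro exI allI impI)
      fix n assume "n \<ge> n0"
      from n0[OF this] 1[of n] 2 \<epsilon> r show "norm ((\<integral>\<omega>. F (T n \<omega>) \<partial>iid_seq M) - (\<integral>g. F (Z g) \<partial>iid_seq gauss)) < r"
        unfolding real_norm_def by linarith
    qed
  qed
qed

section \<open>Orthonormal expansions\<close>

text \<open>Boundedness passes to products and survives multiplication by a variable that is only
  integrable, so every integral in the Gram-Schmidt process exists.\<close>

definition bounded_rv :: "'a measure \<Rightarrow> ('a \<Rightarrow> real) \<Rightarrow> bool" where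
  "bounded_rv M a \<longleftrightarrow> a \<in> borel_measurable M \<and> (\<exists>C. \<forall>\<omega>. \<bar>a \<omega>\<bar> \<le> C)"

lemma bounded_rv_mult: "bounded_rv M a \<Longrightarrow> bounded_rv M b \<Longrightarrow> bounded_rv M (\<lambda>\<omega>. a \<omega> * b \<omega>)"
proof -
  assume a: "bounded_rv M a" and b: "bounded_rv M b"
  then obtain C D where "\<And>\<omega>. \<bar>a \<omega>\<bar> \<le> C" "\<And>\<omega>. \<bar>b \<omega>\<bar> \<le> D" by (auto simp: bounded_rv_def)
  then have "\<bar>a \<omega> * b \<omega>\<bar> \<le> C * D" for \<omega> unfolding abs_mult by (intro mult_mono') auto
  with a b show ?thesis by (auto simp: bounded_rv_def)
qed

lemma bounded_rv_const: "bounded_rv M (\<lambda>_. c)"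
  by (auto simp: bounded_rv_def)

lemma bounded_rv_diff: "bounded_rv M a \<Longrightarrow> bounded_rv M b \<Longrightarrow> bounded_rv M (\<lambda>\<omega>. a \<omega> - b \<omega>)"
proof -
  assume a: "bounded_rv M a" and b: "bounded_rv M b"
  then obtain C D where "\<And>\<omega>. \<bar>a \<omega>\<bar> \<le> C" "\<And>\<omega>. \<bar>b \<omega>\<bar> \<le> D" by (auto simp: bounded_rv_def)
  then have "\<bar>a \<omega> - b \<omega>\<bar> \<le> C + D" for \<omega> by (rule order_trans[OF abs_triangle_ineq4 add_mono])
  with a b show ?thesis by (auto simp: bounded_rv_def)
qed

lemma bounded_rv_sum: "(\<And>i. i \<in> I \<Longrightarrow> bounded_rv M (a i)) \<Longrightarrow> bounded_rv M (\<lambda>\<omega>. \<Sum>i\<in>I. a i \<omega>)"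
proof (induction I rule: infinite_finite_induct)
  case (insert i I)
  then show ?case
    using bounded_rv_diff[of M "a i" "\<lambda>\<omega>. 0 - (\<Sum>i\<in>I. a i \<omega>)"] bounded_rv_diff[OF bounded_rv_const[of M 0], of "\<lambda>\<omega>. \<Sum>i\<in>I. a i \<omega>"]
    by simp
qed (auto simp: bounded_rv_def)

lemma bounded_rv_integrable: "prob_space M \<Longrightarrow> bounded_rv M a \<Longrightarrow> integrable M a"
proof -
  assume "prob_space M" and a: "bounded_rv M a"
  then interpret prob_space M by simp
  from a obtain C where "a \<in> borel_measurable M" "\<And>\<omega>. \<bar>a \<omega>\<bar> \<le> C" by (auto simp: bounded_rv_def)
  then show ?thesis by (intro integrable_const_bound[of _ C]) auto
qed

lemma bounded_rv_scaleR_integrable: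
  fixes X :: "'a \<Rightarrow> 'b::{banach,second_countable_topology}"
  assumes "bounded_rv M a" "integrable M X"
  shows "integrable M (\<lambda>\<omega>. a \<omega> *\<^sub>R X \<omega>)"
proof -
  obtain C where C: "\<And>\<omega>. \<bar>a \<omega>\<bar> \<le> C" and [measurable]: "a \<in> borel_measurable M"
    using assms by (auto simp: bounded_rv_def)
  note [measurable] = borel_measurable_integrable[OF assms(2)]
  have "C \<ge> 0" using C order_trans[OF abs_ge_zero] by blast
  show ?thesis
    by (rule Bochner_Integration.integrable_bound[of M "\<lambda>\<omega>. C * norm (X \<omega>)"])
       (use assms(2) C \<open>C \<ge> 0\<close> in \<open>auto intro!: mult_right_mono\<close>)
qed

text \<open>
  If the remainder \<open>r\<close> is null, then division by \<open>sqrt 0 = 0\<close> makes the vector identically zero.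
\<close>

fun gram_schmidt :: "'a measure \<Rightarrow> (nat \<Rightarrow> 'a \<Rightarrow> real) \<Rightarrow> nat \<Rightarrow> 'a \<Rightarrow> real" where
  "gram_schmidt M f k =
    (let r = (\<lambda>\<omega>. f k \<omega> - (\<Sum>j<k. (\<integral>z. f k z * gram_schmidt M f j z \<partial>M) * gram_schmidt M f j \<omega>))
     in (\<lambda>\<omega>. r \<omega> / sqrt (\<integral>z. r z * r z \<partial>M)))"

declare gram_schmidt.simps[simp del]

context
  fixes M :: "'a measure" and f :: "nat \<Rightarrow> 'a \<Rightarrow> real"
  assumes M: "prob_space M" and f: "\<And>k. bounded_rv M (f k)"
begin

private abbreviation "e \<equiv> gram_schmidt M f"
private definition "c k j = (\<integral>z. f k z * e j z \<partial>M)"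
private definition "r k \<omega> = f k \<omega> - (\<Sum>j<k. c k j * e j \<omega>)"

private lemma e_eq: "e k \<omega> = r k \<omega> / sqrt (\<integral>z. r k z * r k z \<partial>M)"
  unfolding r_def c_def by (subst gram_schmidt.simps) (simp add: Let_def)

lemma bounded_rv_gram_schmidt: "bounded_rv M (gram_schmidt M f k)"
proof (induction k rule: less_induct)
  case (less k)
  have "bounded_rv M (r k)" unfolding r_def
    by (intro bounded_rv_diff f bounded_rv_sum bounded_rv_mult bounded_rv_const less) auto
  then have "bounded_rv M (\<lambda>\<omega>. (1 / sqrt (\<integral>z. r k z * r k z \<partial>M)) * r k \<omega>)"
    by (intro bounded_rv_mult bounded_rv_const)
  then show ?case by (simp add: e_eq[abs_def])
qed

private lemma br: "bounded_rv M (r k)" unfolding r_def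
  by (intro bounded_rv_diff f bounded_rv_sum bounded_rv_mult bounded_rv_const bounded_rv_gram_schmidt)

private lemmas int = bounded_rv_integrable[OF M]

private lemma integral_combination:
  "(\<integral>z. (\<Sum>i\<in>I. a i * (e i z * e j z)) \<partial>M) = (\<Sum>i\<in>I. a i * (\<integral>z. e i z * e j z \<partial>M))"
  by (subst Bochner_Integration.integral_sum)
     (auto intro!: int bounded_rv_mult bounded_rv_gram_schmidt bounded_rv_const)

private lemma norm_cases:
  "(\<forall>\<omega>. e k \<omega> = 0) \<and> (\<integral>z. r k z * r k z \<partial>M) = 0 \<or> (\<integral>z. e k z * e k z \<partial>M) = 1 \<and> (\<integral>z. r k z * r k z \<partial>M) > 0"
proof (cases "(\<integral>z. r k z * r k z \<partial>M) = 0")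
  case True
  then show ?thesis by (simp add: e_eq)
next
  case False
  let ?q = "\<integral>z. r k z * r k z \<partial>M"
  have "?q \<ge> 0" by (intro integral_nonneg_AE) auto
  with False have q: "?q > 0" by linarith
  have "(\<integral>z. e k z * e k z \<partial>M) = (\<integral>z. (r k z * r k z) / ?q \<partial>M)"
    unfolding e_eq using q by (intro Bochner_Integration.integral_cong) (auto simp: field_simps)
  also have "\<dots> = 1" using q by simp
  finally show ?thesis using q by simp
qed

lemma gram_schmidt_orthogonal: "j \<noteq> k \<Longrightarrow> (\<integral>z. gram_schmidt M f j z * gram_schmidt M f k z \<partial>M) = 0"
proof -
  have "\<forall>j<k. (\<integral>z. e k z * e j z \<partial>M) = 0" for k
  proof (induction k rule: less_induct)
    case (less k)
    have IH: "(\<integral>z. e i z * e j z \<partial>M) = 0" if "i < k" "j < k" "i \<noteq> j" for i j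
      using less[of i] less[of j] that by (cases i j rule: linorder_cases) (auto simp: mult.commute)
    show ?case
    proof (intro allI impI)
      fix j assume j: "j < k"
      have "(\<integral>z. r k z * e j z \<partial>M) = (\<integral>z. f k z * e j z - (\<Sum>i<k. c k i * (e i z * e j z)) \<partial>M)"
        by (simp add: r_def left_diff_distrib sum_distrib_right mult.assoc)
      also have "\<dots> = c k j - (\<Sum>i<k. c k i * (\<integral>z. e i z * e j z \<partial>M))"
        by (subst Bochner_Integration.integral_diff)
          (auto intro!: int bounded_rv_mult f bounded_rv_gram_schmidt bounded_rv_sum bounded_rv_const
            simp: integral_combination c_def[of k j])
      also have "(\<Sum>i<k. c k i * (\<integral>z. e i z * e j z \<partial>M)) = (\<Sum>i<k. if i = j then c k j * (\<integral>z. e j z * e j z \<partial>M) else 0)"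
        by (intro sum.cong) (auto simp: IH j)
      also have "\<dots> = c k j * (\<integral>z. e j z * e j z \<partial>M)" using j by simp
      also have "c k j - c k j * (\<integral>z. e j z * e j z \<partial>M) = 0"
        using norm_cases[of j] by (auto simp: c_def)
      finally show "(\<integral>z. e k z * e j z \<partial>M) = 0"
        unfolding e_eq[of k] by (simp add: field_simps)
    qed
  qed
  note * = this
  have "(\<integral>z. e j z * e k z \<partial>M) = (\<integral>z. e k z * e j z \<partial>M)" by (simp only: mult.commute)
  with *[of j] *[of k] show "j \<noteq> k \<Longrightarrow> (\<integral>z. e j z * e k z \<partial>M) = 0"
    by (metis linorder_neqE_nat)
qed

lemma gram_schmidt_normalized:
  "(\<forall>\<omega>. gram_schmidt M f k \<omega> = 0) \<or> (\<integral>z. gram_schmidt M f k z * gram_schmidt M f k z \<partial>M) = 1"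
  using norm_cases by blast

lemma gram_schmidt_0: "f 0 = (\<lambda>_. 1) \<Longrightarrow> gram_schmidt M f 0 \<omega> = 1"
proof -
  assume "f 0 = (\<lambda>_. 1)"
  then have "r 0 = (\<lambda>_. 1)" by (simp add: r_def fun_eq_iff)
  then show ?thesis using prob_space.prob_space[OF M] by (simp add: e_eq)
qed

private lemma AE_expansion: "AE \<omega> in M. f k \<omega> = (\<Sum>j<Suc k. c k j * e j \<omega>)"
proof (cases "(\<integral>z. r k z * r k z \<partial>M) = 0")
  case True
  then have "AE \<omega> in M. r k \<omega> * r k \<omega> = 0"
    by (subst (asm) integral_nonneg_eq_0_iff_AE) (auto intro!: int bounded_rv_mult br)
  moreover have "e k \<omega> = 0" for \<omega> using True by (simp add: e_eq)
  ultimately show ?thesis by (auto simp: r_def elim!: eventually_mono)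
next
  case False
  let ?q = "\<integral>z. r k z * r k z \<partial>M"
  have q: "?q > 0" using False norm_cases[of k] by auto
  have r: "r k \<omega> = sqrt ?q * e k \<omega>" for \<omega> using q by (simp add: e_eq)
  have fk: "f k \<omega> = sqrt ?q * e k \<omega> + (\<Sum>j<k. c k j * e j \<omega>)" for \<omega>
    using r[of \<omega>] by (simp add: r_def)
  have "c k k = (\<integral>z. sqrt ?q * (e k z * e k z) + (\<Sum>j<k. c k j * (e j z * e k z)) \<partial>M)"
    unfolding c_def[of k k] by (subst fk) (simp add: distrib_right sum_distrib_right mult.assoc)
  also have "\<dots> = sqrt ?q * (\<integral>z. e k z * e k z \<partial>M) + (\<Sum>j<k. c k j * (\<integral>z. e j z * e k z \<partial>M))"
    by (subst Bochner_Integration.integral_add)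
       (auto intro!: int bounded_rv_mult bounded_rv_gram_schmidt bounded_rv_sum bounded_rv_const
         simp: integral_combination)
  also have "\<dots> = sqrt ?q" using q norm_cases[of k] by (simp add: gram_schmidt_orthogonal)
  finally show ?thesis using fk by simp
qed

text \<open>Almost everywhere \<open>f k\<close> is a combination of the vectors \<open>e j\<close>
  with j \<le> k. Its inner products with \<open>X\<close> and with the partial sum therefore
  produce the same combination of coefficients \<open>x j\<close>, and the residual is orthogonal to
  \<open>f k\<close>.\<close>

lemma gram_schmidt_projection:
  fixes X :: "'a \<Rightarrow> 'b::{banach,second_countable_topology}"
  assumes X: "integrable M X" and k: "k < N"
  defines "x \<equiv> \<lambda>j. \<integral>z. gram_schmidt M f j z *\<^sub>R X z \<partial>M"
  shows "(\<integral>\<omega>. f k \<omega> *\<^sub>R (X \<omega> - (\<Sum>j<N. gram_schmidt M f j \<omega> *\<^sub>R x j)) \<partial>M) = 0"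
proof -
  note [measurable] = borel_measurable_integrable[OF X]
  have em[measurable]: "e j \<in> borel_measurable M" for j using bounded_rv_gram_schmidt[of j] by (simp add: bounded_rv_def)
  have fm[measurable]: "f j \<in> borel_measurable M" for j using f[of j] by (simp add: bounded_rv_def)
  have fe: "(\<integral>z. f k z * e j z \<partial>M) = (if j \<le> k then c k j else 0)" for j
  proof (cases "j \<le> k")
    case False
    have "(\<integral>z. f k z * e j z \<partial>M) = (\<integral>z. (\<Sum>i<Suc k. c k i * (e i z * e j z)) \<partial>M)"
      using AE_expansion[of k]
      by (intro integral_cong_AE) (auto simp: sum_distrib_right mult.assoc distrib_right elim!: eventually_mono)
    also have "\<dots> = (\<Sum>i<Suc k. c k i * (\<integral>z. e i z * e j z \<partial>M))"
      by (rule integral_combination)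
    also have "\<dots> = 0" using False by (intro sum.neutral) (auto simp: gram_schmidt_orthogonal)
    finally show ?thesis using False by simp
  qed (simp add: c_def)
  have ieX: "integrable M (\<lambda>\<omega>. e j \<omega> *\<^sub>R X \<omega>)" for j
    by (rule bounded_rv_scaleR_integrable[OF bounded_rv_gram_schmidt X])
  have ie: "integrable M (\<lambda>\<omega>. (f k \<omega> * e j \<omega>) *\<^sub>R x j)" for j
    by (intro integrable_scaleR_left impI int bounded_rv_mult f bounded_rv_gram_schmidt)
  have "(\<integral>\<omega>. f k \<omega> *\<^sub>R X \<omega> \<partial>M) = (\<integral>\<omega>. (\<Sum>j<Suc k. c k j *\<^sub>R (e j \<omega> *\<^sub>R X \<omega>)) \<partial>M)"
    using AE_expansion[of k]
    by (intro integral_cong_AE) (auto simp: scaleR_sum_left scaleR_add_left elim!: eventually_mono)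
  also have "\<dots> = (\<Sum>j<Suc k. c k j *\<^sub>R x j)"
    unfolding x_def using ieX
    by (subst Bochner_Integration.integral_sum) (auto intro!: integrable_scaleR_right simp del: scaleR_scaleR sum.lessThan_Suc)
  finally have 1: "(\<integral>\<omega>. f k \<omega> *\<^sub>R X \<omega> \<partial>M) = (\<Sum>j<Suc k. c k j *\<^sub>R x j)" .
  have "(\<integral>\<omega>. (\<Sum>j<N. (f k \<omega> * e j \<omega>) *\<^sub>R x j) \<partial>M) = (\<Sum>j<N. (\<integral>\<omega>. f k \<omega> * e j \<omega> \<partial>M) *\<^sub>R x j)"
    using ie by (subst Bochner_Integration.integral_sum)
      (auto intro!: sum.cong integral_scaleR_left int bounded_rv_mult f bounded_rv_gram_schmidt)
  also have "\<dots> = (\<Sum>j<N. if j \<le> k then c k j *\<^sub>R x j else 0)"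
    by (intro sum.cong refl) (simp add: fe)
  also have "\<dots> = (\<Sum>j<Suc k. c k j *\<^sub>R x j)"
    using k by (intro sum.mono_neutral_cong_right) auto
  finally have 2: "(\<integral>\<omega>. (\<Sum>j<N. (f k \<omega> * e j \<omega>) *\<^sub>R x j) \<partial>M) = (\<Sum>j<Suc k. c k j *\<^sub>R x j)" .
  have "(\<integral>\<omega>. f k \<omega> *\<^sub>R (X \<omega> - (\<Sum>j<N. e j \<omega> *\<^sub>R x j)) \<partial>M) =
    (\<integral>\<omega>. f k \<omega> *\<^sub>R X \<omega> - (\<Sum>j<N. (f k \<omega> * e j \<omega>) *\<^sub>R x j) \<partial>M)"
    by (simp add: scaleR_diff_right scaleR_sum_right)
  also have "\<dots> = 0"
    using ie by (subst Bochner_Integration.integral_diff)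
      (auto simp: 1 2 intro!: bounded_rv_scaleR_integrable f X)
  finally show ?thesis .
qed

text \<open>The k-th vector is a function of the values of \<open>f 0\<close>, ...,
  \<open>f k\<close> at the same point, so partial sums are constant on the cells of the
  partition.\<close>

lemma gram_schmidt_cong_point:
  "(\<And>i. i \<le> k \<Longrightarrow> f i \<omega> = f i \<omega>') \<Longrightarrow> gram_schmidt M f k \<omega> = gram_schmidt M f k \<omega>'"
proof (induction k rule: less_induct)
  case (less k)
  have "r k \<omega> = r k \<omega>'" unfolding r_def using less by (intro arg_cong2[where f = "(-)"] sum.cong) auto
  then show ?case by (simp add: e_eq)
qed

end

section \<open>Conditional expectation on finite partitions\<close>

lemma set_decode_bound: "k < 2 ^ l \<Longrightarrow> i \<in> set_decode k \<Longrightarrow> i < l"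
proof -
  assume k: "k < 2 ^ l" and i: "i \<in> set_decode k"
  have "2 ^ i \<le> (\<Sum>j\<in>set_decode k. (2::nat) ^ j)" using i by (intro member_le_sum) auto
  also have "\<dots> = k" using set_decode_inverse[of k] by (simp add: set_encode_def)
  also note k
  finally have "(2::nat) ^ i < 2 ^ l" .
  then show "i < l" by (rule power_less_imp_less_exp[rotated]) simp
qed

lemma set_encode_bound: "I \<subseteq> {..<l} \<Longrightarrow> set_encode I < 2 ^ l"
proof -
  assume I: "I \<subseteq> {..<l}"
  then have "set_encode I \<le> (\<Sum>j<l. 2 ^ j)" unfolding set_encode_def by (intro sum_mono2) auto
  also have "\<dots> < 2 ^ l" by (induction l) auto
  finally show ?thesis .
qed

text \<open>
  Under \<open>set_decode\<close> the numbers below \<open>2 ^ l\<close> are the subsets of \<open>{..<l}\<close>, so the first \<open>2 ^ l\<close>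
  functions span the indicators of the cells cut out by the first \<open>l\<close> sets.
\<close>

definition cylinder_fun :: "(nat \<Rightarrow> 'a set) \<Rightarrow> nat \<Rightarrow> 'a \<Rightarrow> real" where
  "cylinder_fun B k \<omega> = (if \<forall>i\<in>set_decode k. \<omega> \<in> B i then 1 else 0)"

definition same_cell :: "(nat \<Rightarrow> 'a set) \<Rightarrow> nat \<Rightarrow> 'a \<Rightarrow> 'a \<Rightarrow> bool" where
  "same_cell B l \<omega> \<omega>' \<longleftrightarrow> (\<forall>i<l. \<omega> \<in> B i \<longleftrightarrow> \<omega>' \<in> B i)"

context
  fixes M :: "'a measure" and B :: "nat \<Rightarrow> 'a set"
  assumes M: "prob_space M" and B: "\<And>i. B i \<in> sets M"
begin

private definition "cyl I J = {\<omega> \<in> space M. (\<forall>i\<in>I. \<omega> \<in> B i) \<and> (\<forall>i\<in>J. \<omega> \<notin> B i)}"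

private lemma cyl_sets[measurable]: "finite I \<Longrightarrow> finite J \<Longrightarrow> cyl I J \<in> sets M"
  unfolding cyl_def using B by measurable

lemma bounded_rv_cylinder_fun: "bounded_rv M (cylinder_fun B k)"
proof -
  have "cylinder_fun B k \<in> borel_measurable M"
    unfolding cylinder_fun_def[abs_def] using B by measurable
  moreover have "\<bar>cylinder_fun B k \<omega>\<bar> \<le> 1" for \<omega> by (simp add: cylinder_fun_def)
  ultimately show ?thesis by (auto simp: bounded_rv_def)
qed

lemma cylinder_fun_same_cell: "k < 2 ^ l \<Longrightarrow> same_cell B l \<omega> \<omega>' \<Longrightarrow> cylinder_fun B k \<omega> = cylinder_fun B k \<omega>'"
  using set_decode_bound[of k l] by (auto simp: cylinder_fun_def same_cell_def)

text \<open>Excluded sets are traded for included ones: the cylinder that also excludes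
  \<open>B j\<close> is the cylinder without this condition minus the one that includes
  \<open>B j\<close>.\<close>

private lemma integral_cyl_0:
  fixes D :: "'a \<Rightarrow> 'b::{banach,second_countable_topology}"
  assumes D: "integrable M D" and D0: "\<And>k. k < 2 ^ l \<Longrightarrow> (\<integral>\<omega>. cylinder_fun B k \<omega> *\<^sub>R D \<omega> \<partial>M) = 0"
  shows "finite J \<Longrightarrow> J \<subseteq> {..<l} \<Longrightarrow> I \<subseteq> {..<l} \<Longrightarrow> (\<integral>\<omega>. indicator (cyl I J) \<omega> *\<^sub>R D \<omega> \<partial>M) = 0"
proof (induction J arbitrary: I rule: finite_induct)
  case empty
  then have fI: "finite I" by (auto intro: finite_subset)
  have "(\<integral>\<omega>. indicator (cyl I {}) \<omega> *\<^sub>R D \<omega> \<partial>M) = (\<integral>\<omega>. cylinder_fun B (set_encode I) \<omega> *\<^sub>R D \<omega> \<partial>M)"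
    using fI by (intro Bochner_Integration.integral_cong) (auto simp: cyl_def cylinder_fun_def indicator_def)
  with D0[OF set_encode_bound] empty show ?case by simp
next
  case (insert j J)
  then have fin: "finite I" "finite (insert j I)" "finite J" by (auto intro: finite_subset)
  have "(\<integral>\<omega>. indicator (cyl I (insert j J)) \<omega> *\<^sub>R D \<omega> \<partial>M) =
    (\<integral>\<omega>. indicator (cyl I J) \<omega> *\<^sub>R D \<omega> - indicator (cyl (insert j I) J) \<omega> *\<^sub>R D \<omega> \<partial>M)"
    by (intro Bochner_Integration.integral_cong) (auto simp: cyl_def indicator_def)
  also have "\<dots> = 0"
    using insert fin D by (subst Bochner_Integration.integral_diff) (auto intro!: integrable_mult_indicator)
  finally show ?case .
qed

text \<open>The hypotheses say that \<phi> is the conditional expectation of \<psi> given the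
  partition into cells. On a cell with value v, its probability times the norm of v is at most the
  integral of the norm of \<psi>. Multiplying by the norm of v and summing bounds the second moment
  of \<phi> by the mean of the product of the norms, hence by the average of the two second
  moments.\<close>

lemma cell_jensen:
  fixes \<psi> \<phi> :: "'a \<Rightarrow> 'b::{banach,second_countable_topology}"
  assumes \<psi>: "integrable M \<psi>" and \<phi>: "integrable M \<phi>"
    and const: "\<And>\<omega> \<omega>'. \<omega> \<in> space M \<Longrightarrow> \<omega>' \<in> space M \<Longrightarrow> same_cell B l \<omega> \<omega>' \<Longrightarrow> \<phi> \<omega> = \<phi> \<omega>'"
    and D0: "\<And>k. k < 2 ^ l \<Longrightarrow> (\<integral>\<omega>. cylinder_fun B k \<omega> *\<^sub>R (\<psi> \<omega> - \<phi> \<omega>) \<partial>M) = 0"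
  shows "second_moment M \<phi> \<le> second_moment M \<psi>"
proof -
  interpret prob_space M by fact
  note [measurable] = borel_measurable_integrable[OF \<psi>] borel_measurable_integrable[OF \<phi>]
  define Q where "Q I = cyl I ({..<l} - I)" for I
  let ?P = "Pow {..<l}"
  have [measurable]: "I \<in> ?P \<Longrightarrow> Q I \<in> sets M" for I unfolding Q_def by (auto intro: cyl_sets finite_subset)
  define cell where "cell \<omega> = {i. i < l \<and> \<omega> \<in> B i}" for \<omega>
  have Q_iff: "\<omega> \<in> Q I \<longleftrightarrow> cell \<omega> = I" if "\<omega> \<in> space M" "I \<in> ?P" for \<omega> I
    using that by (auto simp: Q_def cyl_def cell_def)
  have same: "same_cell B l \<omega> \<omega>' \<longleftrightarrow> cell \<omega> = cell \<omega>'" for \<omega> \<omega>'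
    by (auto simp: same_cell_def cell_def)
  have split: "a \<omega> = (\<Sum>I\<in>?P. indicator (Q I) \<omega> * a \<omega>)" if "\<omega> \<in> space M" for a :: "'a \<Rightarrow> real" and \<omega>
  proof -
    have "(\<Sum>I\<in>?P. indicator (Q I) \<omega> * a \<omega>) = (\<Sum>I\<in>?P. if I = cell \<omega> then a \<omega> else 0)"
      using Q_iff[OF that] by (intro sum.cong) (auto simp: indicator_def)
    also have "\<dots> = a \<omega>" by (subst sum.delta) (auto simp: cell_def)
    finally show ?thesis by simp
  qed
  show ?thesis
  proof (cases "second_moment M \<psi> = \<infinity>")
    case False
    then have i\<psi>2: "integrable M (\<lambda>\<omega>. (norm (\<psi> \<omega>))\<^sup>2)"
      by (intro integrableI_nonneg) (auto simp: less_top)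
    have "\<exists>v. \<forall>\<omega>\<in>space M. cell \<omega> = I \<longrightarrow> \<phi> \<omega> = v" for I
      using const unfolding same by blast
    then obtain v where v: "\<And>\<omega> I. \<omega> \<in> space M \<Longrightarrow> cell \<omega> = I \<Longrightarrow> \<phi> \<omega> = v I" by metis
    have v': "\<phi> \<omega> = v (cell \<omega>)" if "\<omega> \<in> space M" for \<omega> using v[OF that refl] .
    \<comment> \<open>There are finitely many cells, so \<phi> is bounded; the finiteness of its
      second moment is what permits absorbing half of it at the end.\<close>
    define C where "C = (\<Sum>I\<in>?P. norm (v I))"
    have bdd: "norm (\<phi> \<omega>) \<le> C" if "\<omega> \<in> space M" for \<omega>
      unfolding v'[OF that] C_def by (intro member_le_sum) (auto simp: cell_def)
    have i\<phi>2: "integrable M (\<lambda>\<omega>. (norm (\<phi> \<omega>))\<^sup>2)"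
      using bdd by (intro integrable_const_bound[of _ "C\<^sup>2"]) (auto intro!: AE_I2 power_mono)
    have i\<phi>\<psi>: "integrable M (\<lambda>\<omega>. norm (\<phi> \<omega>) * norm (\<psi> \<omega>))"
    proof (rule Bochner_Integration.integrable_bound[of M "\<lambda>\<omega>. C * norm (\<psi> \<omega>)"])
      show "AE \<omega> in M. norm (norm (\<phi> \<omega>) * norm (\<psi> \<omega>)) \<le> norm (C * norm (\<psi> \<omega>))"
        using bdd by (intro AE_I2) (auto simp: abs_mult intro!: mult_right_mono order_trans[OF _ abs_ge_self])
    qed (use \<psi> in auto)
    have cell_le: "(\<integral>\<omega>. indicator (Q I) \<omega> * (norm (\<phi> \<omega>))\<^sup>2 \<partial>M) \<le> (\<integral>\<omega>. indicator (Q I) \<omega> * (norm (\<phi> \<omega>) * norm (\<psi> \<omega>)) \<partial>M)"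
      if I: "I \<in> ?P" for I
    proof -
      have [measurable]: "Q I \<in> sets M" using I by measurable
      have "(\<integral>\<omega>. indicator (Q I) \<omega> *\<^sub>R (\<psi> \<omega> - \<phi> \<omega>) \<partial>M) = 0"
        unfolding Q_def using I \<psi> \<phi> by (intro integral_cyl_0 D0) auto
      then have eq: "(\<integral>\<omega>. indicator (Q I) \<omega> *\<^sub>R \<psi> \<omega> \<partial>M) = (\<integral>\<omega>. indicator (Q I) \<omega> *\<^sub>R \<phi> \<omega> \<partial>M)"
        using \<psi> \<phi> by (simp add: scaleR_diff_right integrable_mult_indicator)
      have "(\<integral>\<omega>. indicator (Q I) \<omega> *\<^sub>R \<phi> \<omega> \<partial>M) = (\<integral>\<omega>. indicator (Q I) \<omega> *\<^sub>R v I \<partial>M)"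
        using I by (intro Bochner_Integration.integral_cong) (auto simp: indicator_def Q_iff v)
      also have "\<dots> = measure M (Q I) *\<^sub>R v I" by (subst integral_scaleR_left) (auto simp: emeasure_eq_measure)
      finally have "measure M (Q I) * norm (v I) = norm (\<integral>\<omega>. indicator (Q I) \<omega> *\<^sub>R \<psi> \<omega> \<partial>M)"
        by (simp add: eq)
      also have "\<dots> \<le> (\<integral>\<omega>. norm (indicator (Q I) \<omega> *\<^sub>R \<psi> \<omega>) \<partial>M)" by (rule integral_norm_bound)
      also have "\<dots> = (\<integral>\<omega>. indicator (Q I) \<omega> * norm (\<psi> \<omega>) \<partial>M)" by simp
      finally have le: "measure M (Q I) * norm (v I) \<le> (\<integral>\<omega>. indicator (Q I) \<omega> * norm (\<psi> \<omega>) \<partial>M)" .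
      have "(\<integral>\<omega>. indicator (Q I) \<omega> * (norm (\<phi> \<omega>))\<^sup>2 \<partial>M) = (\<integral>\<omega>. indicator (Q I) \<omega> * (norm (v I))\<^sup>2 \<partial>M)"
        using I by (intro Bochner_Integration.integral_cong) (auto simp: indicator_def Q_iff v)
      also have "\<dots> = norm (v I) * (measure M (Q I) * norm (v I))"
        by (simp add: power2_eq_square emeasure_eq_measure)
      also have "\<dots> \<le> norm (v I) * (\<integral>\<omega>. indicator (Q I) \<omega> * norm (\<psi> \<omega>) \<partial>M)"
        by (intro mult_left_mono le) auto
      also have "\<dots> = (\<integral>\<omega>. norm (v I) * (indicator (Q I) \<omega> * norm (\<psi> \<omega>)) \<partial>M)" by simp
      also have "\<dots> = (\<integral>\<omega>. indicator (Q I) \<omega> * (norm (\<phi> \<omega>) * norm (\<psi> \<omega>)) \<partial>M)"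
        using I by (intro Bochner_Integration.integral_cong) (auto simp: indicator_def Q_iff v)
      finally show ?thesis .
    qed
    have ind: "integrable M (\<lambda>\<omega>. indicator (Q I) \<omega> * a \<omega>)" if "I \<in> ?P" "integrable M a" for I and a :: "'a \<Rightarrow> real"
      using integrable_mult_indicator[of "Q I" M a] that by simp
    have "(\<integral>\<omega>. (norm (\<phi> \<omega>))\<^sup>2 \<partial>M) = (\<integral>\<omega>. (\<Sum>I\<in>?P. indicator (Q I) \<omega> * (norm (\<phi> \<omega>))\<^sup>2) \<partial>M)"
      by (intro Bochner_Integration.integral_cong refl split)
    also have "\<dots> = (\<Sum>I\<in>?P. \<integral>\<omega>. indicator (Q I) \<omega> * (norm (\<phi> \<omega>))\<^sup>2 \<partial>M)"
      using i\<phi>2 by (intro Bochner_Integration.integral_sum ind)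
    also have "\<dots> \<le> (\<Sum>I\<in>?P. \<integral>\<omega>. indicator (Q I) \<omega> * (norm (\<phi> \<omega>) * norm (\<psi> \<omega>)) \<partial>M)"
      by (intro sum_mono cell_le)
    also have "\<dots> = (\<integral>\<omega>. (\<Sum>I\<in>?P. indicator (Q I) \<omega> * (norm (\<phi> \<omega>) * norm (\<psi> \<omega>))) \<partial>M)"
      using i\<phi>\<psi> by (intro Bochner_Integration.integral_sum[symmetric] ind)
    also have "\<dots> = (\<integral>\<omega>. norm (\<phi> \<omega>) * norm (\<psi> \<omega>) \<partial>M)"
      by (intro Bochner_Integration.integral_cong refl split[symmetric])
    also have "\<dots> \<le> (\<integral>\<omega>. (norm (\<phi> \<omega>))\<^sup>2 / 2 + (norm (\<psi> \<omega>))\<^sup>2 / 2 \<partial>M)"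
    proof (intro integral_mono)
      show "norm (\<phi> \<omega>) * norm (\<psi> \<omega>) \<le> (norm (\<phi> \<omega>))\<^sup>2 / 2 + (norm (\<psi> \<omega>))\<^sup>2 / 2" for \<omega>
        using zero_le_power2[of "norm (\<phi> \<omega>) - norm (\<psi> \<omega>)"] by (simp add: power2_eq_square algebra_simps)
    qed (use i\<phi>2 i\<psi>2 i\<phi>\<psi> in auto)
    also have "\<dots> = (\<integral>\<omega>. (norm (\<phi> \<omega>))\<^sup>2 \<partial>M) / 2 + (\<integral>\<omega>. (norm (\<psi> \<omega>))\<^sup>2 \<partial>M) / 2"
      using i\<phi>2 i\<psi>2 by simp
    finally have "(\<integral>\<omega>. (norm (\<phi> \<omega>))\<^sup>2 \<partial>M) \<le> (\<integral>\<omega>. (norm (\<psi> \<omega>))\<^sup>2 \<partial>M)" by simp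
    then show ?thesis
      using i\<phi>2 i\<psi>2 by (simp add: nn_integral_eq_integral ennreal_leI)
  qed simp
qed

end

text \<open>The sets enumerate all level sets of a sequence of simple functions tending to
  \<open>X\<close>. Each of these functions has finitely many level sets, so it is constant on the
  cells of every sufficiently late partition.\<close>

lemma generating_sequence:
  fixes X :: "'a \<Rightarrow> 'b::{banach,second_countable_topology}"
  assumes M: "prob_space M" and X[measurable]: "X \<in> borel_measurable M"
    and fin: "second_moment M X < \<infinity>"
  obtains B :: "nat \<Rightarrow> 'a set" where "\<And>i. B i \<in> sets M"
    and "\<And>\<epsilon>::real. \<epsilon> > 0 \<Longrightarrow> \<exists>Y L. simple_function M Y \<and> second_moment M (\<lambda>\<omega>. X \<omega> - Y \<omega>) \<le> ennreal \<epsilon> \<and>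
      (\<forall>l\<ge>L. \<forall>\<omega>\<in>space M. \<forall>\<omega>'\<in>space M. same_cell B l \<omega> \<omega>' \<longrightarrow> Y \<omega> = Y \<omega>')"
proof -
  interpret prob_space M by fact
  obtain S where S: "\<And>i. simple_function M (S i)" "\<And>\<omega>. \<omega> \<in> space M \<Longrightarrow> (\<lambda>i. S i \<omega>) \<longlonglongrightarrow> X \<omega>"
    "\<And>i \<omega>. \<omega> \<in> space M \<Longrightarrow> dist (S i \<omega>) 0 \<le> 2 * dist (X \<omega>) 0"
    using borel_measurable_implies_sequence_metric[OF X, of 0] by blast
  have Sm[measurable]: "S i \<in> borel_measurable M" for i using S(1) by (rule borel_measurable_simple_function)
  define \<B> where "\<B> = (\<Union>i. (\<lambda>y. S i -` {y} \<inter> space M) ` (S i ` space M))"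
  have c\<B>: "countable \<B>"
    unfolding \<B>_def using S(1) by (intro countable_UN countableI_type countable_image countable_finite simple_functionD)
  have ne: "\<B> \<noteq> {}" using not_empty by (auto simp: \<B>_def)
  define B where "B = from_nat_into \<B>"
  have rB: "range B = \<B>" unfolding B_def by (rule range_from_nat_into[OF ne c\<B>])
  have Bsets: "B i \<in> sets M" for i
  proof -
    have "B i \<in> \<B>" using rB by auto
    then show ?thesis unfolding \<B>_def using S(1) by (auto intro: simple_functionD)
  qed
  have conv: "(\<lambda>i. \<integral>\<^sup>+\<omega>. ennreal ((norm (X \<omega> - S i \<omega>))\<^sup>2) \<partial>M) \<longlonglongrightarrow> (\<integral>\<^sup>+\<omega>. 0 \<partial>M)"
  \<comment> \<open>The approximations have norm at most twice that of \<open>X\<close>, so the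
    difference has at most three times that norm; 9 is its square.\<close>
  proof (rule nn_integral_dominated_convergence[where w = "\<lambda>\<omega>. ennreal 9 * ennreal ((norm (X \<omega>))\<^sup>2)"])
    fix i
    show "AE \<omega> in M. ennreal ((norm (X \<omega> - S i \<omega>))\<^sup>2) \<le> ennreal 9 * ennreal ((norm (X \<omega>))\<^sup>2)"
    proof (rule AE_I2)
      fix \<omega> assume "\<omega> \<in> space M"
      then have "norm (X \<omega> - S i \<omega>) \<le> 3 * norm (X \<omega>)"
        using S(3)[of \<omega> i] norm_triangle_ineq4[of "X \<omega>" "S i \<omega>"] by simp
      then have "(norm (X \<omega> - S i \<omega>))\<^sup>2 \<le> (3 * norm (X \<omega>))\<^sup>2" by (intro power_mono) auto
      then show "ennreal ((norm (X \<omega> - S i \<omega>))\<^sup>2) \<le> ennreal 9 * ennreal ((norm (X \<omega>))\<^sup>2)"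
        by (subst ennreal_mult'[symmetric]) (auto simp: power_mult_distrib intro!: ennreal_leI)
    qed
  next
    show "AE \<omega> in M. (\<lambda>i. ennreal ((norm (X \<omega> - S i \<omega>))\<^sup>2)) \<longlonglongrightarrow> 0"
    proof (rule AE_I2)
      fix \<omega> assume "\<omega> \<in> space M"
      then have "(\<lambda>i. (norm (X \<omega> - S i \<omega>))\<^sup>2) \<longlonglongrightarrow> (norm (X \<omega> - X \<omega>))\<^sup>2"
        by (intro tendsto_intros S(2))
      then show "(\<lambda>i. ennreal ((norm (X \<omega> - S i \<omega>))\<^sup>2)) \<longlonglongrightarrow> 0"
        using tendsto_ennrealI by fastforce
    qed
  qed (use fin in \<open>auto simp: nn_integral_cmult ennreal_mult_less_top\<close>)
  show ?thesis
  proof (rule that[of B])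
    fix \<epsilon> :: real assume \<epsilon>: "\<epsilon> > 0"
    have "\<forall>\<^sub>F i in sequentially. second_moment M (\<lambda>\<omega>. X \<omega> - S i \<omega>) < ennreal \<epsilon>"
      using order_tendstoD(2)[OF conv, of "ennreal \<epsilon>"] \<epsilon> by simp
    then obtain i where i: "second_moment M (\<lambda>\<omega>. X \<omega> - S i \<omega>) < ennreal \<epsilon>"
      by (auto simp: eventually_sequentially)
    have "\<exists>j. B j = S i -` {y} \<inter> space M" if "y \<in> S i ` space M" for y
    proof -
      have "S i -` {y} \<inter> space M \<in> range B" unfolding rB \<B>_def using that by blast
      then show ?thesis by auto
    qed
    then obtain j where j: "\<And>y. y \<in> S i ` space M \<Longrightarrow> B (j y) = S i -` {y} \<inter> space M" by metis
    have finj: "finite (j ` S i ` space M)" using S(1) by (intro finite_imageI simple_functionD)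
    have "S i \<omega> = S i \<omega>'" if "l \<ge> Suc (Max (j ` S i ` space M))" "\<omega> \<in> space M" "\<omega>' \<in> space M" "same_cell B l \<omega> \<omega>'" for l \<omega> \<omega>'
    proof -
      have "j (S i \<omega>) \<le> Max (j ` S i ` space M)" using that by (intro Max_ge finj) auto
      then have "j (S i \<omega>) < l" using that by simp
      moreover have "\<omega> \<in> B (j (S i \<omega>))" using that by (auto simp: j)
      ultimately have "\<omega>' \<in> B (j (S i \<omega>))" using that(4) by (auto simp: same_cell_def)
      then show ?thesis using that by (auto simp: j)
    qed
    then have "\<forall>l\<ge>Suc (Max (j ` S i ` space M)). \<forall>\<omega>\<in>space M. \<forall>\<omega>'\<in>space M. same_cell B l \<omega> \<omega>' \<longrightarrow> S i \<omega> = S i \<omega>'"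
      by blast
    then show "\<exists>Y L. simple_function M Y \<and> second_moment M (\<lambda>\<omega>. X \<omega> - Y \<omega>) \<le> ennreal \<epsilon> \<and>
      (\<forall>l\<ge>L. \<forall>\<omega>\<in>space M. \<forall>\<omega>'\<in>space M. same_cell B l \<omega> \<omega>' \<longrightarrow> Y \<omega> = Y \<omega>')"
      using S(1)[of i] less_imp_le[OF i] by blast
  qed (rule Bsets)
qed

text \<open>
  The alternative \<open>x k = 0\<close> accounts for \<open>e 0 = 1\<close> and for the null vectors of the
  Gram-Schmidt process.
\<close>

locale orthonormal_expansion =
  fixes M :: "'a measure" and X :: "'a \<Rightarrow> 'b::{banach,second_countable_topology}"
    and e :: "nat \<Rightarrow> 'a \<Rightarrow> real" and x :: "nat \<Rightarrow> 'b"
  assumes M: "prob_space M" and X[measurable]: "X \<in> borel_measurable M"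
    and sq: "second_moment M X < \<infinity>" and mean: "(\<integral>\<omega>. X \<omega> \<partial>M) = 0"
    and e: "\<And>k. integrable M (e k)" "\<And>j k. integrable M (\<lambda>z. e j z * e k z)"
      "\<And>j k. j \<noteq> k \<Longrightarrow> (\<integral>z. e j z * e k z \<partial>M) = 0"
      "\<And>k. x k = 0 \<or> (\<integral>z. e k z \<partial>M) = 0 \<and> (\<integral>z. e k z * e k z \<partial>M) = 1"
    and jensen: "\<And>l l' s. l \<le> l' \<Longrightarrow>
       second_moment M (\<lambda>\<omega>. s + ((\<Sum>k<2^l'. e k \<omega> *\<^sub>R x k) - (\<Sum>k<2^l. e k \<omega> *\<^sub>R x k))) \<le>
       second_moment M (\<lambda>\<omega>. s + (X \<omega> - (\<Sum>k<2^l. e k \<omega> *\<^sub>R x k)))"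
    and x0: "x 0 = 0"
    and approx: "\<And>\<epsilon>::real. \<epsilon> > 0 \<Longrightarrow>
       \<exists>L. \<forall>l\<ge>L. second_moment M (\<lambda>\<omega>. X \<omega> - (\<Sum>k<2^l. e k \<omega> *\<^sub>R x k)) \<le> ennreal \<epsilon>"

lemma orthonormal_expansion_exists:
  fixes X :: "'a \<Rightarrow> 'b::{banach,second_countable_topology}"
  assumes M: "prob_space M" and X[measurable]: "X \<in> borel_measurable M"
    and fin: "second_moment M X < \<infinity>" and X0: "(\<integral>\<omega>. X \<omega> \<partial>M) = 0"
  shows "\<exists>e x. orthonormal_expansion M X e x"
proof -
  interpret prob_space M by fact
  obtain B :: "nat \<Rightarrow> 'a set" where B: "\<And>i. B i \<in> sets M"
    and approx: "\<And>\<epsilon>::real. \<epsilon> > 0 \<Longrightarrow> \<exists>Y L. simple_function M Y \<and> second_moment M (\<lambda>\<omega>. X \<omega> - Y \<omega>) \<le> ennreal \<epsilon> \<and>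
      (\<forall>l\<ge>L. \<forall>\<omega>\<in>space M. \<forall>\<omega>'\<in>space M. same_cell B l \<omega> \<omega>' \<longrightarrow> Y \<omega> = Y \<omega>')"
    by (rule generating_sequence[OF M X fin], rule that)
  define f where "f = cylinder_fun B"
  define e where "e = gram_schmidt M f"
  define x where "x k = (\<integral>z. e k z *\<^sub>R X z \<partial>M)" for k
  define A where "A l \<omega> = (\<Sum>k<2^l. e k \<omega> *\<^sub>R x k)" for l :: nat and \<omega>
  have fb: "bounded_rv M (f k)" for k unfolding f_def by (rule bounded_rv_cylinder_fun[OF M B])
  have eb: "bounded_rv M (e k)" for k unfolding e_def by (rule bounded_rv_gram_schmidt[OF M fb])
  have iX: "integrable M X" by (rule integrable_of_square[OF M X fin])
  have iA: "integrable M (A l)" for l unfolding A_def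
    by (intro Bochner_Integration.integrable_sum integrable_scaleR_left impI bounded_rv_integrable[OF M eb])
  note [measurable] = borel_measurable_integrable[OF iA]
  \<comment> \<open>The number 0 encodes the empty intersection. Hence \<open>e 0\<close> is the
    constant 1, the coefficient \<open>x 0\<close> is the mean of \<open>X\<close>, and
    orthogonality to \<open>e 0\<close> centres all other vectors.\<close>
  have f0: "f 0 = (\<lambda>_. 1)" by (simp add: f_def cylinder_fun_def fun_eq_iff)
  have e0: "e 0 \<omega> = 1" for \<omega> unfolding e_def by (rule gram_schmidt_0[where f = f and M = M, OF M fb f0])
  have x0: "x 0 = 0" by (simp add: x_def e0 X0)
  have proj: "(\<integral>\<omega>. f k \<omega> *\<^sub>R (X \<omega> - A l \<omega>) \<partial>M) = 0" if "k < 2 ^ l" for k l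
    using gram_schmidt_projection[OF M fb iX that] by (simp add: A_def x_def e_def)
  have Acell: "A l \<omega> = A l \<omega>'" if "same_cell B l' \<omega> \<omega>'" "l \<le> l'" for l l' \<omega> \<omega>'
  proof -
    have le: "(2::nat) ^ l \<le> 2 ^ l'" using that by simp
    then have "e k \<omega> = e k \<omega>'" if "k < 2 ^ l" for k
      unfolding e_def using that
      by (intro gram_schmidt_cong_point[OF M fb]) (use le in \<open>auto simp: f_def intro!: cylinder_fun_same_cell[OF M B _ \<open>same_cell B l' \<omega> \<omega>'\<close>]
          simp del: power_increasing_iff\<close>)
    then show ?thesis unfolding A_def by (intro sum.cong) auto
  qed
  show ?thesis
  proof (intro exI[of _ e] exI[of _ x] orthonormal_expansion.intro)
    show "integrable M (e k)" for k by (rule bounded_rv_integrable[OF M eb])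
    show "integrable M (\<lambda>z. e j z * e k z)" for j k by (intro bounded_rv_integrable[OF M] bounded_rv_mult eb)
    show orth: "(\<integral>z. e j z * e k z \<partial>M) = 0" if "j \<noteq> k" for j k
      unfolding e_def by (rule gram_schmidt_orthogonal[OF M fb that])
    show "x k = 0 \<or> (\<integral>z. e k z \<partial>M) = 0 \<and> (\<integral>z. e k z * e k z \<partial>M) = 1" for k
    proof (cases "k = 0")
      case False
      then have "(\<integral>z. e k z \<partial>M) = 0" using orth[of k 0] by (simp add: e0)
      then show ?thesis using gram_schmidt_normalized[where f = f and k = k, OF M fb] by (auto simp: x_def e_def)
    qed (simp add: x0)
    show "x 0 = 0" by (rule x0)
    show "second_moment M (\<lambda>\<omega>. s + ((\<Sum>k<2^l'. e k \<omega> *\<^sub>R x k) - (\<Sum>k<2^l. e k \<omega> *\<^sub>R x k))) \<le>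
       second_moment M (\<lambda>\<omega>. s + (X \<omega> - (\<Sum>k<2^l. e k \<omega> *\<^sub>R x k)))" if "l \<le> l'" for l l' s
      unfolding A_def[symmetric]
    proof (rule cell_jensen[OF M B, where l = l'])
      show "s + (A l' \<omega> - A l \<omega>) = s + (A l' \<omega>' - A l \<omega>')" if "same_cell B l' \<omega> \<omega>'" for \<omega> \<omega>'
        using Acell[OF that \<open>l \<le> l'\<close>] Acell[OF that, of l'] by simp
      show "(\<integral>\<omega>. cylinder_fun B k \<omega> *\<^sub>R (s + (X \<omega> - A l \<omega>) - (s + (A l' \<omega> - A l \<omega>))) \<partial>M) = 0" if "k < 2 ^ l'" for k
        using proj[OF that] by (simp add: f_def)
    qed (use iX iA in auto)
    fix \<epsilon> :: real assume \<epsilon>: "\<epsilon> > 0"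
    then obtain Y L where Y: "simple_function M Y" "second_moment M (\<lambda>\<omega>. X \<omega> - Y \<omega>) \<le> ennreal (\<epsilon> / 4)"
      and L': "\<forall>l\<ge>L. \<forall>\<omega>\<in>space M. \<forall>\<omega>'\<in>space M. same_cell B l \<omega> \<omega>' \<longrightarrow> Y \<omega> = Y \<omega>'"
      using approx[of "\<epsilon> / 4"] by auto
    have L: "Y \<omega> = Y \<omega>'" if "l \<ge> L" "\<omega> \<in> space M" "\<omega>' \<in> space M" "same_cell B l \<omega> \<omega>'" for l \<omega> \<omega>'
      using L' that by blast
    have [measurable]: "Y \<in> borel_measurable M" using Y(1) by (rule borel_measurable_simple_function)
    have iY: "integrable M Y"
      by (rule integrable_const_bound[of _ "Max (norm ` Y ` space M)"])
         (use simple_functionD(1)[OF Y(1)] in auto)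
    have "second_moment M (\<lambda>\<omega>. X \<omega> - A l \<omega>) \<le> ennreal \<epsilon>" if "l \<ge> L" for l
    proof -
      \<comment> \<open>As \<open>Y\<close> is constant on the cells, \<open>A l - Y\<close> is the
        conditional expectation of \<open>X - Y\<close> and is no larger in L^2.\<close>
      have "second_moment M (\<lambda>\<omega>. A l \<omega> - Y \<omega>) \<le> second_moment M (\<lambda>\<omega>. X \<omega> - Y \<omega>)"
      proof (rule cell_jensen[OF M B, where l = l])
        show "A l \<omega> - Y \<omega> = A l \<omega>' - Y \<omega>'" if "\<omega> \<in> space M" "\<omega>' \<in> space M" "same_cell B l \<omega> \<omega>'" for \<omega> \<omega>'
          using Acell[OF that(3), of l] L[OF \<open>l \<ge> L\<close> that] by simp
        show "(\<integral>\<omega>. cylinder_fun B k \<omega> *\<^sub>R (X \<omega> - Y \<omega> - (A l \<omega> - Y \<omega>)) \<partial>M) = 0" if "k < 2 ^ l" for k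
          using proj[OF that] by (simp add: f_def)
      qed (use iX iA iY in auto)
      with Y(2) have AY: "second_moment M (\<lambda>\<omega>. A l \<omega> - Y \<omega>) \<le> ennreal (\<epsilon> / 4)" by (rule order_trans[rotated])
      have "second_moment M (\<lambda>\<omega>. (X \<omega> - Y \<omega>) - (A l \<omega> - Y \<omega>)) \<le>
        2 * second_moment M (\<lambda>\<omega>. X \<omega> - Y \<omega>) + 2 * second_moment M (\<lambda>\<omega>. A l \<omega> - Y \<omega>)"
        by (rule nn_integral_norm_square_diff_le) auto
      also have "\<dots> \<le> 2 * ennreal (\<epsilon> / 4) + 2 * ennreal (\<epsilon> / 4)" by (intro add_mono mult_left_mono Y AY) auto
      also have "\<dots> = ennreal \<epsilon>"
        using \<epsilon> by (simp flip: ennreal_numeral ennreal_mult' ennreal_plus)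
      finally show ?thesis by simp
    qed
    then show "\<exists>L. \<forall>l\<ge>L. second_moment M (\<lambda>\<omega>. X \<omega> - (\<Sum>k<2^l. e k \<omega> *\<^sub>R x k)) \<le> ennreal \<epsilon>"
      unfolding A_def by blast
  qed (rule M X fin X0)+
qed

section \<open>Weak limits of normalized sums\<close>

text \<open>Lipschitz minorants of a bounded continuous function give a lower bound on the limit
  inferior; the same bound for its negative closes the gap.\<close>

lemma weakly_convergesI_Lipschitz:
  fixes \<nu> :: "'b::{metric_space,second_countable_topology} measure"
  assumes \<mu>: "\<And>n. prob_space (\<mu> n)" "\<And>n. sets (\<mu> n) = sets borel"
    and \<nu>: "prob_space \<nu>" "sets \<nu> = sets borel"
    and lim: "\<And>(f::'b \<Rightarrow> real) L. (\<And>u v. \<bar>f u - f v\<bar> \<le> L * dist u v) \<Longrightarrow> (\<And>v. \<bar>f v\<bar> \<le> 1) \<Longrightarrow>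
      (\<lambda>n. \<integral>x. f x \<partial>\<mu> n) \<longlonglongrightarrow> (\<integral>x. f x \<partial>\<nu>)"
  shows "weakly_converges \<mu> \<nu>"
proof -
  interpret \<nu>: prob_space \<nu> by fact
  note [measurable_cong] = \<mu>(2) \<nu>(2)
  have lower: "\<forall>\<^sub>F n in sequentially. (\<integral>x. f x \<partial>\<nu>) - \<epsilon> < (\<integral>x. f x \<partial>\<mu> n)"
    if f: "continuous_on UNIV f" "\<And>v. \<bar>f v\<bar> \<le> 1" and \<epsilon>: "\<epsilon> > 0" for f :: "'b \<Rightarrow> real" and \<epsilon>
  proof -
    \<comment> \<open>the Lipschitz functions \<open>F k\<close> increase to \<open>f\<close>\<close>
    define F where "F k x = (INF y. f y + real k * dist x y)" for k :: nat and x
    have bd: "-1 \<le> f y + real k * dist x y" for k x y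
      using f(2)[of y] by (simp add: abs_le_iff add_increasing2)
    then have bdd: "bdd_below (range (\<lambda>y. f y + real k * dist x y))" for k x
      by (intro bdd_belowI[of _ "-1"]) auto
    have F_le: "F k x \<le> f x" for k x
      unfolding F_def using cINF_lower[OF bdd[of k x], of x] by simp
    have F_ge: "-1 \<le> F k x" for k x unfolding F_def by (intro cINF_greatest bd) auto
    have F1: "\<bar>F k x\<bar> \<le> 1" for k x
      using F_le[of k x] F_ge[of k x] f(2)[of x] by (auto simp: abs_le_iff)
    have half: "F k u \<le> F k v + real k * dist u v" for k u v
    proof -
      have "F k u - real k * dist u v \<le> f y + real k * dist v y" for y
      proof -
        have "F k u \<le> f y + real k * dist u y" unfolding F_def by (rule cINF_lower[OF bdd]) simp
        also have "real k * dist u y \<le> real k * (dist u v + dist v y)"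
          by (intro mult_left_mono dist_triangle) auto
        finally show ?thesis by (simp add: algebra_simps)
      qed
      then have "F k u - real k * dist u v \<le> F k v" unfolding F_def[of k v] by (intro cINF_greatest) auto
      then show ?thesis by simp
    qed
    have Lip: "\<bar>F k u - F k v\<bar> \<le> real k * dist u v" for k u v
      using half[of k u v] half[of k v u] by (simp add: abs_le_iff dist_commute)
    have Fc: "continuous_on UNIV (F k)" for k
    proof (rule continuous_onI)
      fix x :: 'b and e :: real assume "e > 0"
      have "dist (F k x') (F k x) \<le> e" if "dist x' x < e / (real k + 1)" for x'
      proof -
        have "real k * dist x' x \<le> (real k + 1) * dist x' x" by (intro mult_right_mono) auto
        also have "\<dots> \<le> e" using that by (simp add: field_simps)
        finally show ?thesis using Lip[of k x' x] by (simp add: dist_real_def)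
      qed
      then show "\<exists>d>0. \<forall>x'\<in>UNIV. dist x' x < d \<longrightarrow> dist (F k x') (F k x) \<le> e"
        using \<open>e > 0\<close> by (intro exI[of _ "e / (real k + 1)"]) auto
    qed
    have [measurable]: "F k \<in> borel_measurable borel" for k by (rule borel_measurable_continuous_onI[OF Fc])
    have [measurable]: "f \<in> borel_measurable borel" by (rule borel_measurable_continuous_onI[OF f(1)])
    have Flim: "(\<lambda>k. F k x) \<longlonglongrightarrow> f x" for x
    proof (rule LIMSEQ_I)
      fix e :: real assume e: "e > 0"
      obtain d where d: "d > 0" "\<And>y. dist y x < d \<Longrightarrow> \<bar>f y - f x\<bar> < e / 2"
        using f(1)[unfolded continuous_on_iff, rule_format, of x "e / 2"] e by (auto simp: dist_real_def)
      show "\<exists>no. \<forall>k\<ge>no. norm (F k x - f x) < e"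
      proof (intro exI allI impI)
        \<comment> \<open>Within distance \<open>d\<close> continuity suffices. Farther away the
          penalty is at least 2, which no difference of values of \<open>f\<close> exceeds.\<close>
        fix k assume k: "k \<ge> nat \<lceil>2 / d\<rceil>"
        then have "2 / d \<le> real k" by linarith
        then have kd: "2 \<le> real k * d" using d(1) by (simp add: field_simps)
        have "f x - e / 2 \<le> f y + real k * dist x y" for y
        proof (cases "dist y x < d")
          case True
          have "f x - e / 2 \<le> f y" using d(2)[OF True] by linarith
          then show ?thesis by (simp add: add_increasing2)
        next
          case False
          then have "real k * d \<le> real k * dist x y" by (intro mult_left_mono) (auto simp: dist_commute)
          then show ?thesis using kd f(2)[of x] f(2)[of y] e by linarith
        qed
        then have "f x - e / 2 \<le> F k x" unfolding F_def by (intro cINF_greatest) auto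
        then show "norm (F k x - f x) < e" using F_le[of k x] e by simp
      qed
    qed
    have "(\<lambda>k. \<integral>x. F k x \<partial>\<nu>) \<longlonglongrightarrow> (\<integral>x. f x \<partial>\<nu>)"
      by (rule integral_dominated_convergence[where w = "\<lambda>_. 1"]) (auto simp: Flim F1)
    then have "\<forall>\<^sub>F k in sequentially. (\<integral>x. f x \<partial>\<nu>) - \<epsilon> / 2 < (\<integral>x. F k x \<partial>\<nu>)"
      using \<epsilon> by (intro order_tendstoD) auto
    then obtain k where k: "(\<integral>x. f x \<partial>\<nu>) - \<epsilon> / 2 < (\<integral>x. F k x \<partial>\<nu>)" by (auto simp: eventually_sequentially)
    have "\<forall>\<^sub>F n in sequentially. (\<integral>x. F k x \<partial>\<nu>) - \<epsilon> / 2 < (\<integral>x. F k x \<partial>\<mu> n)"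
      using order_tendstoD(1)[OF lim[OF Lip F1]] \<epsilon> by simp
    then show ?thesis
    proof eventually_elim
      case (elim n)
      interpret \<mu>: prob_space "\<mu> n" by fact
      have "(\<integral>x. F k x \<partial>\<mu> n) \<le> (\<integral>x. f x \<partial>\<mu> n)"
        by (intro integral_mono F_le \<mu>.integrable_const_bound[of _ 1]) (auto simp: F1 f)
      with elim k show ?case by linarith
    qed
  qed
  have one: "(\<lambda>n. \<integral>x. f x \<partial>\<mu> n) \<longlonglongrightarrow> (\<integral>x. f x \<partial>\<nu>)"
    if f: "continuous_on UNIV f" "\<And>v. \<bar>f v\<bar> \<le> 1" for f :: "'b \<Rightarrow> real"
  proof (rule order_tendstoI)
    fix a assume "a < (\<integral>x. f x \<partial>\<nu>)"
    then show "\<forall>\<^sub>F n in sequentially. a < (\<integral>x. f x \<partial>\<mu> n)"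
      using lower[OF f, of "(\<integral>x. f x \<partial>\<nu>) - a"] by simp
  next
    fix a assume "(\<integral>x. f x \<partial>\<nu>) < a"
    then show "\<forall>\<^sub>F n in sequentially. (\<integral>x. f x \<partial>\<mu> n) < a"
      using lower[of "\<lambda>x. - f x" "a - (\<integral>x. f x \<partial>\<nu>)"] f by (simp add: continuous_on_minus)
  qed
  show ?thesis unfolding weakly_converges_def
  proof (intro allI impI)
    fix f :: "'b \<Rightarrow> real" assume f: "continuous_on UNIV f" "bounded (range f)"
    then obtain B where B: "B > 0" "\<And>v. \<bar>f v\<bar> \<le> B" by (auto simp: bounded_pos)
    have "(\<lambda>n. B * (\<integral>x. f x / B \<partial>\<mu> n)) \<longlonglongrightarrow> B * (\<integral>x. f x / B \<partial>\<nu>)"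
      using B f(1) by (intro tendsto_intros one continuous_intros) (auto simp: field_simps)
    then show "(\<lambda>n. \<integral>x. f x \<partial>\<mu> n) \<longlonglongrightarrow> (\<integral>x. f x \<partial>\<nu>)" using B by simp
  qed
qed

abbreviation nsum :: "('a \<Rightarrow> 'b::real_normed_vector) \<Rightarrow> nat \<Rightarrow> (nat \<Rightarrow> 'a) \<Rightarrow> 'b" where
  "nsum h n \<omega> \<equiv> (1 / sqrt (real n)) *\<^sub>R psum (\<lambda>_. h) n \<omega>"

text \<open>Second moments are lower semicontinuous under weak convergence, because the truncated
  squares are bounded continuous test functions; division by \<open>R\<close> scales them to at most
  1.\<close>

lemma second_moment_weak_limit:
  fixes h :: "'a \<Rightarrow> 'b::{real_normed_vector,second_countable_topology}"
  assumes M: "prob_space M" "prob_space N" and [measurable]: "h \<in> borel_measurable M" "Z \<in> borel_measurable N"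
    and lim: "\<And>f. continuous_on UNIV f \<Longrightarrow> (\<And>v. \<bar>f v\<bar> \<le> (1::real)) \<Longrightarrow>
      (\<lambda>n. \<integral>\<omega>. f (nsum h n \<omega>) \<partial>iid_seq M) \<longlonglongrightarrow> (\<integral>g. f (Z g) \<partial>N)"
    and c: "\<And>n. second_moment (iid_seq M) (psum (\<lambda>_. h) n) \<le> ennreal (c * real n)" "c \<ge> 0"
  shows "second_moment N Z \<le> ennreal c"
proof -
  interpret S: prob_space "iid_seq M" using M(1) by (rule prob_space_iid_seq)
  interpret N: prob_space N by fact
  have trunc: "(\<integral>\<^sup>+g. ennreal (min ((norm (Z g))\<^sup>2) R) \<partial>N) \<le> ennreal c" if R: "R > 0" for R
  proof -
    define f where "f v = min ((norm v)\<^sup>2 / R) 1" for v :: 'b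
    have f: "continuous_on UNIV f" "\<bar>f v\<bar> \<le> 1" "0 \<le> f v" for v
      using R by (auto simp: f_def intro!: continuous_intros)
    have [measurable]: "f \<in> borel_measurable borel" by (rule borel_measurable_continuous_onI[OF f(1)])
    have "(\<integral>\<omega>. f (nsum h n \<omega>) \<partial>iid_seq M) \<le> c / R" for n
    proof -
      have "ennreal (\<integral>\<omega>. f (nsum h n \<omega>) \<partial>iid_seq M) = (\<integral>\<^sup>+\<omega>. ennreal (f (nsum h n \<omega>)) \<partial>iid_seq M)"
        using f by (intro nn_integral_eq_integral[symmetric] S.integrable_const_bound[of _ 1]) auto
      also have "\<dots> \<le> (\<integral>\<^sup>+\<omega>. ennreal (1 / (real n * R)) * ennreal ((norm (psum (\<lambda>_. h) n \<omega>))\<^sup>2) \<partial>iid_seq M)"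
      proof (rule nn_integral_mono)
        fix \<omega>
        have "f (nsum h n \<omega>) \<le> 1 / (real n * R) * (norm (psum (\<lambda>_. h) n \<omega>))\<^sup>2"
          using R by (simp add: f_def power_mult_distrib power_divide min.coboundedI1)
        then show "ennreal (f (nsum h n \<omega>)) \<le> ennreal (1 / (real n * R)) * ennreal ((norm (psum (\<lambda>_. h) n \<omega>))\<^sup>2)"
          using R by (subst ennreal_mult'[symmetric]) (auto intro: ennreal_leI)
      qed
      also have "\<dots> \<le> ennreal (1 / (real n * R)) * ennreal (c * real n)"
        by (subst nn_integral_cmult) (auto intro: mult_left_mono c(1))
      also have "\<dots> = ennreal (1 / (real n * R) * (c * real n))" using R by (intro ennreal_mult'[symmetric]) auto
      also have "\<dots> \<le> ennreal (c / R)" using R c(2) by (intro ennreal_leI) (auto simp: field_simps)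
      finally show ?thesis using R c(2) by (simp add: ennreal_le_iff)
    qed
    then have le: "(\<integral>g. f (Z g) \<partial>N) \<le> c / R" by (intro LIMSEQ_le_const2[OF lim[OF f(1,2)]]) auto
    have "(\<integral>\<^sup>+g. ennreal (min ((norm (Z g))\<^sup>2) R) \<partial>N) = (\<integral>\<^sup>+g. ennreal R * ennreal (f (Z g)) \<partial>N)"
      using R by (intro nn_integral_cong, subst ennreal_mult'[symmetric]) (auto simp: f_def min_def field_simps)
    also have "\<dots> = ennreal R * ennreal (\<integral>g. f (Z g) \<partial>N)"
      using f by (subst nn_integral_cmult, measurable, subst nn_integral_eq_integral) (auto intro!: N.integrable_const_bound[of _ 1])
    also have "\<dots> = ennreal (R * (\<integral>g. f (Z g) \<partial>N))" using R by (intro ennreal_mult'[symmetric]) auto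
    also have "\<dots> \<le> ennreal (R * (c / R))" using R by (intro ennreal_leI mult_left_mono le) auto
    finally show ?thesis using R by simp
  qed
  show ?thesis by (rule nn_integral_le_of_truncations[OF _ trunc]) measurable
qed

text \<open>
  At \<open>t\<^sup>2 = 1152 * c\<close> Chebyshev's inequality gives half the probability \<open>1/576\<close> allowed in
  \<open>cotype2_stochastically_bounded\<close>; \<open>18432 = 16 * 1152\<close>.
\<close>

lemma cotype2_second_moment_bound:
  fixes h :: "'a \<Rightarrow> 'b::{banach,second_countable_topology}"
  assumes M: "prob_space M" "prob_space N" and [measurable]: "h \<in> borel_measurable M" "Z \<in> borel_measurable N"
    and lim: "\<And>f. continuous_on UNIV f \<Longrightarrow> (\<And>v. \<bar>f v\<bar> \<le> (1::real)) \<Longrightarrow>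
      (\<lambda>n. \<integral>\<omega>. f (nsum h n \<omega>) \<partial>iid_seq M) \<longlonglongrightarrow> (\<integral>g. f (Z g) \<partial>N)"
    and C: "\<And>k (x::nat \<Rightarrow> 'b). (\<Sum>i<k. (norm (x i))\<^sup>2) \<le> C * rademacher_moment k x" "C \<ge> 0"
    and c: "second_moment N Z \<le> ennreal c" "c > 0"
  shows "second_moment (iid_seq M) (psum (\<lambda>_. h) n) \<le> ennreal (18432 * C * c * real n)"
proof -
  interpret S: prob_space "iid_seq M" using M(1) by (rule prob_space_iid_seq)
  interpret N: prob_space N by fact
  define t where "t = sqrt (1152 * c)"
  have t: "t > 0" "t\<^sup>2 = 1152 * c" using c(2) by (auto simp: t_def)
  define f where "f v = min ((norm v)\<^sup>2 / t\<^sup>2) 1" for v :: 'b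
  have f: "continuous_on UNIV f" "\<bar>f v\<bar> \<le> 1" "0 \<le> f v" for v
    using t(1) by (auto simp: f_def intro!: continuous_intros)
  have [measurable]: "f \<in> borel_measurable borel" by (rule borel_measurable_continuous_onI[OF f(1)])
  have "ennreal (\<integral>g. f (Z g) \<partial>N) = (\<integral>\<^sup>+g. ennreal (f (Z g)) \<partial>N)"
    using f by (intro nn_integral_eq_integral[symmetric] N.integrable_const_bound[of _ 1]) auto
  also have "\<dots> \<le> (\<integral>\<^sup>+g. ennreal (1 / t\<^sup>2) * ennreal ((norm (Z g))\<^sup>2) \<partial>N)"
    by (intro nn_integral_mono, subst ennreal_mult'[symmetric]) (auto simp: f_def intro!: ennreal_leI)
  also have "\<dots> \<le> ennreal (1 / t\<^sup>2) * ennreal c"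
    by (subst nn_integral_cmult) (auto intro: mult_left_mono c(1))
  also have "\<dots> = ennreal (1 / t\<^sup>2 * c)" by (intro ennreal_mult'[symmetric]) auto
  also have "1 / t\<^sup>2 * c = 1 / 1152" using c(2) by (simp add: t)
  finally have "(\<integral>g. f (Z g) \<partial>N) \<le> 1 / 1152" by (simp add: ennreal_le_iff)
  then have "\<forall>\<^sub>F n in sequentially. (\<integral>\<omega>. f (nsum h n \<omega>) \<partial>iid_seq M) < 1 / 576"
    by (intro order_tendstoD(2)[OF lim[OF f(1,2)]]) auto
  then have ev: "\<forall>\<^sub>F n in sequentially. (\<integral>\<omega>. f (nsum h n \<omega>) \<partial>iid_seq M) < 1 / 576 \<and> n > 0"
    using eventually_gt_at_top by (intro eventually_conj)
  have "\<forall>\<^sub>F m in sequentially. (\<integral>\<^sup>+\<omega>. indicator {v. t * sqrt (real m) < norm v} (psum (\<lambda>_. h) m \<omega>) \<partial>iid_seq M) \<le> ennreal (1/576)"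
    using ev
  proof eventually_elim
    case (elim m)
    have "(\<integral>\<^sup>+\<omega>. indicator {v. t * sqrt (real m) < norm v} (psum (\<lambda>_. h) m \<omega>) \<partial>iid_seq M) \<le>
      (\<integral>\<^sup>+\<omega>. ennreal (f (nsum h m \<omega>)) \<partial>iid_seq M)"
    proof (rule nn_integral_mono)
      fix \<omega>
      show "indicator {v. t * sqrt (real m) < norm v} (psum (\<lambda>_. h) m \<omega>) \<le> ennreal (f (nsum h m \<omega>))"
      proof (cases "t * sqrt (real m) < norm (psum (\<lambda>_. h) m \<omega>)")
        case True
        have "(t * sqrt (real m))\<^sup>2 \<le> (norm (psum (\<lambda>_. h) m \<omega>))\<^sup>2" using True t by (intro power_mono) auto
        then have "f (nsum h m \<omega>) = 1" using t(1) elim by (simp add: f_def power_mult_distrib power_divide field_simps)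
        then show ?thesis by (simp add: indicator_def)
      qed simp
    qed
    also have "\<dots> = ennreal (\<integral>\<omega>. f (nsum h m \<omega>) \<partial>iid_seq M)"
      using f by (intro nn_integral_eq_integral S.integrable_const_bound[of _ 1]) auto
    also have "\<dots> \<le> ennreal (1/576)" using elim by (intro ennreal_leI) auto
    finally show ?case .
  qed
  then have "\<exists>\<^sub>\<infinity>m. (\<integral>\<^sup>+\<omega>. indicator {v. t * sqrt (real m) < norm v} (psum (\<lambda>_. h) m \<omega>) \<partial>iid_seq M) \<le> ennreal (1/576)"
    by (intro MOST_INFM) (auto simp: cofinite_eq_sequentially)
  from cotype2_stochastically_bounded(4)[OF M(1) _ C _ this, of n] t show ?thesis
    by (simp add: mult_ac)
qed

text \<open>Cauchy-Schwarz alone, hence quadratic growth in \<open>n\<close>. This is good enough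
  where \<open>n\<close> is fixed before the variable is made small.\<close>

lemma nn_integral_psum_square_le:
  fixes h :: "'a \<Rightarrow> 'b::{real_normed_vector,second_countable_topology}"
  assumes M: "prob_space M" and [measurable]: "h \<in> borel_measurable M"
  shows "second_moment (iid_seq M) (psum (\<lambda>_. h) n) \<le>
    ennreal ((real n)\<^sup>2) * second_moment M h"
proof -
  have "second_moment (iid_seq M) (psum (\<lambda>_. h) n) \<le>
    (\<integral>\<^sup>+\<omega>. (\<Sum>i<n. ennreal (real n) * ennreal ((norm (h (\<omega> i)))\<^sup>2)) \<partial>iid_seq M)"
  proof (rule nn_integral_mono)
    fix \<omega>
    have "(norm (psum (\<lambda>_. h) n \<omega>))\<^sup>2 \<le> (\<Sum>i<n. norm (h (\<omega> i)))\<^sup>2"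
      unfolding psum_def by (intro power_mono norm_sum) auto
    also have "\<dots> \<le> (\<Sum>i<n. (norm (h (\<omega> i)))\<^sup>2) * card {..<n}" by (rule sum_squared_le_sum_of_squares)
    finally have "ennreal ((norm (psum (\<lambda>_. h) n \<omega>))\<^sup>2) \<le> ennreal (\<Sum>i<n. real n * (norm (h (\<omega> i)))\<^sup>2)"
      by (intro ennreal_leI) (simp add: sum_distrib_left mult.commute)
    then show "ennreal ((norm (psum (\<lambda>_. h) n \<omega>))\<^sup>2) \<le> (\<Sum>i<n. ennreal (real n) * ennreal ((norm (h (\<omega> i)))\<^sup>2))"
      by (simp add: ennreal_mult flip: sum_ennreal)
  qed
  also have "\<dots> = (\<Sum>i<n. ennreal (real n) * second_moment M h)"
    by (simp add: nn_integral_sum nn_integral_cmult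
        nn_integral_iid_seq_component[OF M, of "\<lambda>x. ennreal ((norm (h x))\<^sup>2)"])
  also have "\<dots> = ennreal ((real n)\<^sup>2) * second_moment M h"
    by (simp add: power2_eq_square ennreal_mult mult_ac ennreal_of_nat_eq_real_of_nat)
  finally show ?thesis .
qed

section \<open>Blocks of Gaussian series\<close>

lemma symmetric_rv_gauss_sum:
  fixes x :: "nat \<Rightarrow> 'b::{real_normed_vector,second_countable_topology}"
  shows "symmetric_rv (iid_seq gauss) (\<lambda>g. \<Sum>k\<in>{a..<b}. g k *\<^sub>R x k)"
proof -
  have eq: "(\<Sum>k\<in>{a..<b}. g k *\<^sub>R x k) = psum (\<lambda>k z. z *\<^sub>R (if a \<le> k then x k else 0)) b g" for g :: "nat \<Rightarrow> real"
    unfolding psum_def by (intro sum.mono_neutral_cong_left) auto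
  show ?thesis unfolding eq[abs_def]
    by (rule symmetric_rv_psum[OF prob_space_gauss _ symmetric_rv_gauss]) measurable
qed

lemma nn_integral_gauss_sum_split:
  fixes x :: "nat \<Rightarrow> 'b::{real_normed_vector,second_countable_topology}"
  assumes [measurable]: "F \<in> borel_measurable borel" and abc: "a \<le> b" "b \<le> c"
  shows "(\<integral>\<^sup>+g. F (s + (\<Sum>k\<in>{a..<c}. g k *\<^sub>R x k)) \<partial>iid_seq gauss) =
    (\<integral>\<^sup>+g. \<integral>\<^sup>+g'. F (s + (\<Sum>k\<in>{a..<b}. g k *\<^sub>R x k) + (\<Sum>k\<in>{b..<c}. g' k *\<^sub>R x k)) \<partial>iid_seq gauss \<partial>iid_seq gauss)"
proof -
  interpret G: prob_space "iid_seq gauss" by (intro prob_space_iid_seq prob_space_gauss)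
  \<comment> \<open>Partial sums start at index 0, so the coefficients below the lower end of the
    range are padded with zeros.\<close>
  let ?h = "\<lambda>a k z. z *\<^sub>R (if a \<le> k then x k else 0)"
  have eq: "(\<Sum>k\<in>{a..<b}. g k *\<^sub>R x k) = psum (?h a) b g" for a b and g :: "nat \<Rightarrow> real"
    unfolding psum_def by (intro sum.mono_neutral_cong_left) auto
  have split: "(\<integral>\<^sup>+g. F (s + (\<Sum>k\<in>{a..<c}. g k *\<^sub>R x k)) \<partial>iid_seq gauss) =
    (\<integral>\<^sup>+g. \<integral>\<^sup>+g'. F (s + (\<Sum>k\<in>{a..<b}. g k *\<^sub>R x k) + psum (\<lambda>i z. z *\<^sub>R x (b + i)) (c - b) g') \<partial>iid_seq gauss \<partial>iid_seq gauss)"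
    if "a \<le> b" for a s
    unfolding eq using nn_integral_psum_add[OF prob_space_gauss, of F "?h a" s b "c - b"] abc that by simp
  have inner: "(\<integral>\<^sup>+g'. F (s + psum (\<lambda>i z. z *\<^sub>R x (b + i)) (c - b) g') \<partial>iid_seq gauss) =
     (\<integral>\<^sup>+g'. F (s + (\<Sum>k\<in>{b..<c}. g' k *\<^sub>R x k)) \<partial>iid_seq gauss)" for s
    by (subst split[of b s]) (simp_all add: G.emeasure_space_1)
  show ?thesis by (subst split[OF abc(1)]) (simp add: inner)
qed

text \<open>Disjoint blocks of one Gaussian sequence have the joint law of blocks taken from
  separate independent sequences. In the latter form they are independent summands to which cotype 2
  applies.\<close>

lemma nn_integral_gauss_blocks:
  fixes x :: "nat \<Rightarrow> 'b::{real_normed_vector,second_countable_topology}"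
  assumes [measurable]: "F \<in> borel_measurable borel"
  shows "mono p \<Longrightarrow> (\<integral>\<^sup>+\<Omega>. F (s + psum (\<lambda>j g. \<Sum>k\<in>{p j..<p (Suc j)}. g k *\<^sub>R x k) J \<Omega>) \<partial>iid_seq (iid_seq gauss)) =
    (\<integral>\<^sup>+g. F (s + (\<Sum>k\<in>{p 0..<p J}. g k *\<^sub>R x k)) \<partial>iid_seq gauss)"
proof (induction J arbitrary: p s)
  case 0
  interpret G: prob_space "iid_seq gauss" by (intro prob_space_iid_seq prob_space_gauss)
  interpret GG: prob_space "iid_seq (iid_seq gauss)" by (intro prob_space_iid_seq G.prob_space_axioms)
  show ?case by (simp add: psum_def G.emeasure_space_1 GG.emeasure_space_1)
next
  case (Suc J)
  interpret G: prob_space "iid_seq gauss" by (intro prob_space_iid_seq prob_space_gauss)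
  have m: "mono (\<lambda>j. p (Suc j))" using Suc.prems by (auto simp: mono_def)
  have le: "p 0 \<le> p (Suc 0)" "p (Suc 0) \<le> p (Suc J)" using Suc.prems by (auto simp: mono_def)
  show ?case
    by (subst nn_integral_psum_Suc[OF G.prob_space_axioms])
       (simp_all add: Suc.IH[OF m] nn_integral_gauss_sum_split[OF assms le])
qed

lemma mean_norm_le:
  fixes u :: "'a \<Rightarrow> 'b::{banach,second_countable_topology}"
  assumes M: "prob_space M" and [measurable]: "u \<in> borel_measurable M"
    and le: "second_moment M u \<le> ennreal (\<delta>\<^sup>2)" and \<delta>: "\<delta> > 0"
  shows "integrable M u" "(\<integral>x. norm (u x) \<partial>M) \<le> 2 * \<delta>"
proof -
  interpret prob_space M by fact
  show iu: "integrable M u" using le by (intro integrable_of_square[OF M]) (auto intro: le_less_trans)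
  have pt: "a \<le> \<delta> + a\<^sup>2 / \<delta>" for a :: real
  proof -
    have "0 \<le> (a - \<delta>)\<^sup>2 + a * a + \<delta> * \<delta>" by simp
    then have "2 * (a * \<delta>) \<le> 2 * (\<delta> * \<delta> + a\<^sup>2)" by (simp add: power2_eq_square algebra_simps)
    then show ?thesis using \<delta> by (simp add: field_simps)
  qed
  have "ennreal (\<integral>x. norm (u x) \<partial>M) = (\<integral>\<^sup>+x. ennreal (norm (u x)) \<partial>M)"
    using iu by (intro nn_integral_eq_integral[symmetric]) auto
  also have "\<dots> \<le> (\<integral>\<^sup>+x. ennreal \<delta> + ennreal (1 / \<delta>) * ennreal ((norm (u x))\<^sup>2) \<partial>M)"
  proof (rule nn_integral_mono)
    fix x
    have "ennreal (norm (u x)) \<le> ennreal (\<delta> + 1 / \<delta> * (norm (u x))\<^sup>2)"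
      using pt[of "norm (u x)"] by (intro ennreal_leI) simp
    also have "\<dots> = ennreal \<delta> + ennreal (1 / \<delta>) * ennreal ((norm (u x))\<^sup>2)"
      using \<delta> by (subst ennreal_mult'[symmetric], simp, subst ennreal_plus[symmetric]) auto
    finally show "ennreal (norm (u x)) \<le> ennreal \<delta> + ennreal (1 / \<delta>) * ennreal ((norm (u x))\<^sup>2)" .
  qed
  also have "\<dots> \<le> ennreal \<delta> + ennreal (1 / \<delta>) * ennreal (\<delta>\<^sup>2)"
    by (simp add: nn_integral_add nn_integral_cmult emeasure_space_1) (intro mult_left_mono le, simp)
  also have "\<dots> = ennreal (2 * \<delta>)"
    using \<delta> by (subst ennreal_mult'[symmetric], simp, subst ennreal_plus[symmetric]) (auto simp: power2_eq_square)
  finally show "(\<integral>x. norm (u x) \<partial>M) \<le> 2 * \<delta>" using \<delta> by (simp add: ennreal_le_iff)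
qed

lemma iid_copies_iid_seq:
  assumes M: "prob_space M" and [measurable]: "X \<in> borel_measurable M"
  shows "iid_copies M X (iid_seq M) (\<lambda>i \<omega>. X (\<omega> i))"
proof -
  interpret S: prob_space "iid_seq M" using M by (rule prob_space_iid_seq)
  have "S.indep_vars (\<lambda>_. borel) (\<lambda>i \<omega>. X (\<omega> i)) UNIV"
    by (rule S.indep_vars_compose2[OF indep_vars_iid_seq[OF M], where Y = "\<lambda>_. X"]) auto
  moreover have "distr (iid_seq M) borel (\<lambda>\<omega>. X (\<omega> i)) = distr M borel X" for i
    by (subst (2) iid_seq_component[OF M, of i, symmetric], subst distr_distr) (auto simp: comp_def)
  ultimately show ?thesis using S.prob_space_axioms by (simp add: iid_copies_def)
qed

lemma normalized_sum_eq_nsum: "normalized_sum (\<lambda>i \<omega>. X (\<omega> i)) n = nsum X n"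
  by (simp add: normalized_sum_def psum_def fun_eq_iff)

lemma CLT_iff_nsum:
  assumes "prob_space M" "X \<in> borel_measurable M"
  shows "CLT M X \<longleftrightarrow> converges_in_distribution (iid_seq M) (\<lambda>n. nsum X n)"
  using CLT_iff_iid_copies[OF iid_copies_iid_seq[OF assms]] by (simp add: normalized_sum_eq_nsum)

lemma CLTSS_iff_nsum:
  assumes "prob_space M" "X \<in> borel_measurable M"
  shows "CLTSS M X \<longleftrightarrow> (\<exists>m::nat \<Rightarrow> nat. strict_mono m \<and> (\<forall>n. 0 < m n) \<and>
     converges_in_distribution (iid_seq M) (\<lambda>n. nsum X (m n)))"
  using CLTSS_iff_iid_copies[OF iid_copies_iid_seq[OF assms]] by (simp add: normalized_sum_eq_nsum)

lemma CLT_imp_CLTSS: "CLT M X \<Longrightarrow> CLTSS M X"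
proof -
  assume "CLT M X"
  then obtain \<nu> where \<nu>: "prob_space \<nu>" "sets \<nu> = sets borel"
    "weakly_converges (\<lambda>n. distr (iid_space M X) borel (normalized_sum (\<lambda>i \<omega>. \<omega> i) n)) \<nu>"
    by (auto simp: CLT_def converges_in_distribution_def)
  \<comment> \<open>A subsequence consists of positive integers, so the index 0 is skipped.\<close>
  then have "weakly_converges (\<lambda>n. distr (iid_space M X) borel (normalized_sum (\<lambda>i \<omega>. \<omega> i) (Suc n))) \<nu>"
    unfolding weakly_converges_def using LIMSEQ_Suc by blast
  with \<nu> show ?thesis
    unfolding CLTSS_def converges_in_distribution_def by (intro exI[of _ Suc]) (auto intro: strict_monoI)
qed

section \<open>The central limit theorem from an orthonormal expansion\<close>

context orthonormal_expansion
begin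

text \<open>Partial sums of length a power of two are conditional expectations on cells, which is
  what makes \<open>jensen\<close> available between them. \<open>G l l'\<close> below is the
  Gaussian counterpart of \<open>A l' - A l\<close>.\<close>

definition A where "A l \<omega> = (\<Sum>k<2^l. e k \<omega> *\<^sub>R x k)" for l :: nat
definition G where "G l l' g = (\<Sum>k\<in>{2^l..<2^l'}. g k *\<^sub>R x k)" for l l' :: nat and g :: "nat \<Rightarrow> real"

lemma measurable_A[measurable]: "A l \<in> borel_measurable M"
  using borel_measurable_integrable[OF e(1)] unfolding A_def[abs_def] by measurable

lemma measurable_G[measurable]: "G l l' \<in> borel_measurable (iid_seq gauss)"
  unfolding G_def[abs_def] by measurable

lemma A_0: "A 0 \<omega> = 0" by (simp add: A_def x0)

lemma prob_spaces: "prob_space (iid_seq M)" "prob_space (iid_seq gauss)"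
  by (intro prob_space_iid_seq M prob_space_gauss)+

lemma integrable_X: "integrable M X" by (rule integrable_of_square[OF M X sq])

lemma integrable_A: "integrable M (A l)" and mean_A: "(\<integral>\<omega>. A l \<omega> \<partial>M) = 0"
proof -
  show "integrable M (A l)" unfolding A_def[abs_def] by (intro Bochner_Integration.integrable_sum integrable_scaleR_left impI e)
  have "(\<integral>\<omega>. A l \<omega> \<partial>M) = (\<Sum>k<2^l. (\<integral>\<omega>. e k \<omega> \<partial>M) *\<^sub>R x k)"
    unfolding A_def using e(1) by (subst Bochner_Integration.integral_sum) (auto intro!: sum.cong integral_scaleR_left)
  also have "\<dots> = 0" using e(4) by (intro sum.neutral) auto
  finally show "(\<integral>\<omega>. A l \<omega> \<partial>M) = 0" .
qed

lemma weak_limit_A: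
  assumes l: "l \<le> l'" and f: "continuous_on UNIV f" "\<And>v. \<bar>f v\<bar> \<le> (1::real)"
  shows "(\<lambda>n. \<integral>\<omega>. f (nsum (\<lambda>\<omega>. A l' \<omega> - A l \<omega>) n \<omega>) \<partial>iid_seq M) \<longlonglongrightarrow> (\<integral>g. f (G l l' g) \<partial>iid_seq gauss)"
proof -
  \<comment> \<open>Indices with zero coefficient are dropped, since there \<open>e k\<close> may
    fail to be centred or normalized.\<close>
  define K where "K = {k \<in> {2^l..<2^l'}. x k \<noteq> 0}"
  have le: "(2::nat)^l \<le> 2^l'" using l by simp
  have "A l' \<omega> - A l \<omega> = (\<Sum>k\<in>{2^l..<2^l'}. e k \<omega> *\<^sub>R x k)" for \<omega>
    unfolding A_def lessThan_atLeast0 using sum.atLeastLessThan_concat[of 0 "2^l" "2^l'" "\<lambda>k. e k \<omega> *\<^sub>R x k"] le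
    by (simp add: algebra_simps)
  also have "(\<Sum>k\<in>{2^l..<2^l'}. e k \<omega> *\<^sub>R x k) = (\<Sum>k\<in>K. e k \<omega> *\<^sub>R x k)" for \<omega>
    unfolding K_def by (intro sum.mono_neutral_right) auto
  finally have AK: "A l' \<omega> - A l \<omega> = (\<Sum>k\<in>K. e k \<omega> *\<^sub>R x k)" for \<omega> .
  have GK: "G l l' g = (\<Sum>k\<in>K. g k *\<^sub>R x k)" for g
    unfolding G_def K_def by (intro sum.mono_neutral_right) auto
  have "(\<integral>z. e k z \<partial>M) = 0" "(\<integral>z. e k z * e k z \<partial>M) = 1" if "k \<in> K" for k
    using e(4)[of k] that by (auto simp: K_def)
  then show ?thesis unfolding AK GK
    using e(1-3) by (intro multivariate_clt M f) (auto simp: K_def)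
qed

text \<open>Jensen's inequality passes the bound from \<open>X - A l\<close> to
  \<open>A l' - A l\<close> summand by summand, and the weak limit of the normalized sums inherits
  it.\<close>

lemma gauss_second_moment_le:
  assumes l: "l \<le> l'" and c: "\<And>n. second_moment (iid_seq M) (\<lambda>\<omega>. psum (\<lambda>_ \<omega>. X \<omega> - A l \<omega>) n \<omega>) \<le> ennreal (c * real n)" "c \<ge> 0"
  shows "second_moment (iid_seq gauss) (G l l') \<le> ennreal c"
proof (rule second_moment_weak_limit[OF M prob_spaces(2), where h = "\<lambda>\<omega>. A l' \<omega> - A l \<omega>"])
  fix n
  have "second_moment (iid_seq M) (\<lambda>\<omega>. 0 + psum (\<lambda>_ \<omega>. A l' \<omega> - A l \<omega>) n \<omega>) \<le>
    second_moment (iid_seq M) (\<lambda>\<omega>. 0 + psum (\<lambda>_ \<omega>. X \<omega> - A l \<omega>) n \<omega>)"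
    using jensen[OF l, folded A_def]
    by (intro nn_integral_psum_mono[where F = "\<lambda>v. ennreal ((norm v)\<^sup>2)"] M) auto
  also have "\<dots> \<le> ennreal (c * real n)" using c(1)[of n] by simp
  finally show "second_moment (iid_seq M) (\<lambda>\<omega>. psum (\<lambda>_ \<omega>. A l' \<omega> - A l \<omega>) n \<omega>) \<le> ennreal (c * real n)" by simp
qed (use weak_limit_A[OF l] c in auto)

definition small_remainders :: bool where
  "small_remainders \<longleftrightarrow> (\<forall>\<epsilon>>0. \<exists>L. \<forall>l\<ge>L. \<forall>n.
     second_moment (iid_seq M) (\<lambda>\<omega>. psum (\<lambda>_ \<omega>. X \<omega> - A l \<omega>) n \<omega>) \<le> ennreal (\<epsilon> * real n))"

lemma small_remaindersE:
  assumes small_remainders "\<epsilon> > 0"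
  obtains L where "\<And>l n. l \<ge> L \<Longrightarrow>
    second_moment (iid_seq M) (\<lambda>\<omega>. psum (\<lambda>_ \<omega>. X \<omega> - A l \<omega>) n \<omega>) \<le> ennreal (\<epsilon> * real n)"
proof -
  obtain L where "\<forall>l\<ge>L. \<forall>n.
    second_moment (iid_seq M) (\<lambda>\<omega>. psum (\<lambda>_ \<omega>. X \<omega> - A l \<omega>) n \<omega>) \<le> ennreal (\<epsilon> * real n)"
    using assms unfolding small_remainders_def by blast
  then show ?thesis by (intro that[of L]) blast
qed

text \<open>The Gaussian partial sums are Cauchy in L^1, and an almost surely convergent subsequence
  supplies the limit variable \<open>Y\<close>. For a Lipschitz test function three replacements
  remain: \<open>X\<close> by \<open>A l\<close>, uniformly in \<open>n\<close>; the sums of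
  \<open>A l\<close> by \<open>Z l\<close>, by the multivariate theorem; and \<open>Z l\<close> by
  \<open>Y\<close>.\<close>

lemma small_remainders_imp_CLT:
  assumes small: small_remainders
  shows "CLT M X"
proof -
  interpret S: prob_space "iid_seq M" by (rule prob_spaces)
  interpret N: prob_space "iid_seq gauss" by (rule prob_spaces)
  define Z where "Z l = G 0 l" for l
  have Zm[measurable]: "Z l \<in> borel_measurable (iid_seq gauss)" for l by (simp add: Z_def)
  have Zdiff: "Z l' g - Z l g = G l l' g" if "l \<le> l'" for l l' g
  proof -
    have "(2::nat)^l \<le> 2^l'" using that by simp
    then show ?thesis
      unfolding Z_def G_def using sum.atLeastLessThan_concat[of 1 "2^l" "2^l'" "\<lambda>k. g k *\<^sub>R x k"]
      by (simp add: algebra_simps)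
  qed
  have cauchy2: "\<exists>L. \<forall>l\<ge>L. \<forall>l'\<ge>L. (\<integral>g. norm (Z l g - Z l' g) \<partial>iid_seq gauss) \<le> 2 * \<delta>" if \<delta>: "\<delta> > 0" for \<delta>
  proof -
    have "\<delta>\<^sup>2 > 0" using \<delta> by simp
    obtain L where L: "\<And>l n. l \<ge> L \<Longrightarrow>
      second_moment (iid_seq M) (\<lambda>\<omega>. psum (\<lambda>_ \<omega>. X \<omega> - A l \<omega>) n \<omega>) \<le> ennreal (\<delta>\<^sup>2 * real n)"
      by (rule small_remaindersE[OF small \<open>\<delta>\<^sup>2 > 0\<close>], rule that)
    have 1: "(\<integral>g. norm (G l l' g) \<partial>iid_seq gauss) \<le> 2 * \<delta>" if "l \<ge> L" "l \<le> l'" for l l'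
      using gauss_second_moment_le[OF that(2) L[OF that(1)]] \<delta> by (auto intro: mean_norm_le[OF prob_spaces(2)])
    have 2: "(\<integral>g. norm (Z l' g - Z l g) \<partial>iid_seq gauss) \<le> 2 * \<delta>"
      if "l \<ge> L" "l \<le> l'" for l l'
      using 1[OF that] by (simp add: Zdiff[OF that(2)])
    show ?thesis
    proof (intro exI allI impI)
      fix l l' assume ll: "l \<ge> L" "l' \<ge> L"
      show "(\<integral>g. norm (Z l g - Z l' g) \<partial>iid_seq gauss) \<le> 2 * \<delta>"
      proof (cases "l \<le> l'")
        case True
        show ?thesis using 2[OF ll(1) True] by (simp add: norm_minus_commute)
      qed (use 2[OF ll(2)] in auto)
    qed
  qed
  have gi: "integrable (iid_seq gauss) (\<lambda>g. g k)" for k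
  proof -
    have "integrable (distr (iid_seq gauss) gauss (\<lambda>g. g k)) (\<lambda>x. x)"
      using integrable_gauss_id by (simp only: iid_seq_component[OF prob_space_gauss])
    then show ?thesis by (subst (asm) integrable_distr_eq) auto
  qed
  have Zi: "integrable (iid_seq gauss) (Z l)" for l
    unfolding Z_def G_def[abs_def] by (intro Bochner_Integration.integrable_sum integrable_scaleR_left impI gi)
  obtain r where r: "strict_mono r" "AE g in iid_seq gauss. Cauchy (\<lambda>j. Z (r j) g)"
  proof (rule cauchy_L1_AE_cauchy_subseq[OF Zi])
    fix \<epsilon> :: real assume "\<epsilon> > 0"
    then obtain L where "\<forall>l\<ge>L. \<forall>l'\<ge>L. (\<integral>g. norm (Z l g - Z l' g) \<partial>iid_seq gauss) \<le> 2 * (\<epsilon> / 4)"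
      using cauchy2[of "\<epsilon> / 4"] by auto
    moreover have "2 * (\<epsilon> / 4) < \<epsilon>" using \<open>\<epsilon> > 0\<close> by simp
    ultimately show "\<exists>L. \<forall>l\<ge>L. \<forall>l'\<ge>L. (\<integral>g. norm (Z l g - Z l' g) \<partial>iid_seq gauss) < \<epsilon>"
      by (meson le_less_trans)
  qed (rule that)
  define Y where "Y g = lim (\<lambda>j. Z (r j) g)" for g
  have Ym[measurable]: "Y \<in> borel_measurable (iid_seq gauss)"
    unfolding Y_def[abs_def] by (rule borel_measurable_lim_metric) measurable
  have Ylim: "AE g in iid_seq gauss. (\<lambda>j. Z (r j) g) \<longlonglongrightarrow> Y g"
    using r(2) by eventually_elim (auto simp: Y_def Cauchy_convergent_iff convergent_LIMSEQ_iff)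
  define \<nu> where "\<nu> = distr (iid_seq gauss) borel Y"
  have "weakly_converges (\<lambda>n. distr (iid_seq M) borel (nsum X n)) \<nu>"
  proof (rule weakly_convergesI_Lipschitz)
    fix f :: "'b \<Rightarrow> real" and L :: real
    assume Lip: "\<And>u v. \<bar>f u - f v\<bar> \<le> L * dist u v" and f1: "\<And>v. \<bar>f v\<bar> \<le> 1"
    define L' where "L' = \<bar>L\<bar> + 1"
    have L': "L' > 0" "\<bar>f u - f v\<bar> \<le> L' * norm (u - v)" for u v
    proof -
      have "L * norm (u - v) \<le> L' * norm (u - v)" by (intro mult_right_mono) (auto simp: L'_def)
      then show "\<bar>f u - f v\<bar> \<le> L' * norm (u - v)" using Lip[of u v] by (simp add: dist_norm)
    qed (simp add: L'_def add_nonneg_pos)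
    have "L'-lipschitz_on UNIV f"
      using L' by (intro lipschitz_onI) (auto simp: dist_real_def dist_norm less_imp_le)
    then have fc: "continuous_on UNIV f" by (rule lipschitz_on_continuous_on)
    have [measurable]: "f \<in> borel_measurable borel" by (rule borel_measurable_continuous_onI[OF fc])
    have fi: "integrable (iid_seq M) (\<lambda>\<omega>. f (nsum h n \<omega>))" if "h \<in> borel_measurable M" for h n
      using that by (intro S.integrable_const_bound[of _ 1]) (auto simp: f1)
    have "(\<lambda>n. \<integral>\<omega>. f (nsum X n \<omega>) \<partial>iid_seq M) \<longlonglongrightarrow> (\<integral>g. f (Y g) \<partial>iid_seq gauss)"
    proof (rule LIMSEQ_I)
      fix \<eta>' :: real assume "\<eta>' > 0"
      define \<eta> where "\<eta> = \<eta>' / 4"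
      have \<eta>: "\<eta> > 0" using \<open>\<eta>' > 0\<close> by (simp add: \<eta>_def)
      \<comment> \<open>A second moment at most the square of \<delta> gives a mean norm at most
        2\<delta>, so the Lipschitz error is at most \<eta>.\<close>
      define \<delta> where "\<delta> = \<eta> / (2 * L')"
      have \<delta>: "\<delta> > 0" "L' * (2 * \<delta>) = \<eta>" using \<eta> L'(1) by (auto simp: \<delta>_def)
      obtain l0 where l0: "\<And>l n. l \<ge> l0 \<Longrightarrow>
        second_moment (iid_seq M) (\<lambda>\<omega>. psum (\<lambda>_ \<omega>. X \<omega> - A l \<omega>) n \<omega>) \<le> ennreal (\<delta>\<^sup>2 * real n)"
        by (rule small_remaindersE[OF small zero_less_power[OF \<delta>(1), of 2]], rule that)
      have close: "\<bar>(\<integral>\<omega>. f (nsum X n \<omega>) \<partial>iid_seq M) - (\<integral>\<omega>. f (nsum (\<lambda>\<omega>. A l \<omega> - A 0 \<omega>) n \<omega>) \<partial>iid_seq M)\<bar> \<le> \<eta>"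
        if l: "l \<ge> l0" for l n
      proof -
        let ?u = "nsum (\<lambda>\<omega>. X \<omega> - A l \<omega>) n"
        have u: "nsum X n \<omega> - nsum (\<lambda>\<omega>. A l \<omega> - A 0 \<omega>) n \<omega> = ?u \<omega>" for \<omega>
          by (simp add: A_0 psum_def sum_subtractf scaleR_diff_right)
        have "second_moment (iid_seq M) ?u =
          (\<integral>\<^sup>+\<omega>. ennreal (1 / real n) * ennreal ((norm (psum (\<lambda>_ \<omega>. X \<omega> - A l \<omega>) n \<omega>))\<^sup>2) \<partial>iid_seq M)"
          by (intro nn_integral_cong, subst ennreal_mult'[symmetric]) (auto simp: power_mult_distrib power_divide)
        also have "\<dots> \<le> ennreal (1 / real n) * ennreal (\<delta>\<^sup>2 * real n)"
          by (subst nn_integral_cmult) (auto intro!: mult_left_mono l0[OF l])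
        also have "\<dots> = ennreal (1 / real n * (\<delta>\<^sup>2 * real n))" by (intro ennreal_mult'[symmetric]) auto
        also have "\<dots> \<le> ennreal (\<delta>\<^sup>2)" by (intro ennreal_leI) (auto simp: field_simps)
        finally have ule: "second_moment (iid_seq M) ?u \<le> ennreal (\<delta>\<^sup>2)" .
        have um: "?u \<in> borel_measurable (iid_seq M)" by measurable
        note u2 = mean_norm_le[OF S.prob_space_axioms um ule \<delta>(1)]
        have "\<bar>(\<integral>\<omega>. f (nsum X n \<omega>) \<partial>iid_seq M) - (\<integral>\<omega>. f (nsum (\<lambda>\<omega>. A l \<omega> - A 0 \<omega>) n \<omega>) \<partial>iid_seq M)\<bar> =
          \<bar>\<integral>\<omega>. f (nsum X n \<omega>) - f (nsum (\<lambda>\<omega>. A l \<omega> - A 0 \<omega>) n \<omega>) \<partial>iid_seq M\<bar>"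
          by (simp add: fi)
        also have "\<dots> \<le> (\<integral>\<omega>. \<bar>f (nsum X n \<omega>) - f (nsum (\<lambda>\<omega>. A l \<omega> - A 0 \<omega>) n \<omega>)\<bar> \<partial>iid_seq M)"
          by (rule integral_abs_bound)
        also have "\<dots> \<le> (\<integral>\<omega>. L' * norm (?u \<omega>) \<partial>iid_seq M)"
        proof (rule integral_mono)
          show "\<bar>f (nsum X n \<omega>) - f (nsum (\<lambda>\<omega>. A l \<omega> - A 0 \<omega>) n \<omega>)\<bar> \<le> L' * norm (?u \<omega>)" for \<omega>
            using L'(2)[of "nsum X n \<omega>" "nsum (\<lambda>\<omega>. A l \<omega> - A 0 \<omega>) n \<omega>"] unfolding u .
        qed (use u2 fi in \<open>auto simp del: norm_scaleR\<close>)
        also have "\<dots> = L' * (\<integral>\<omega>. norm (?u \<omega>) \<partial>iid_seq M)" by (rule integral_mult_right_zero)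
        also have "\<dots> \<le> L' * (2 * \<delta>)" using u2(2) L'(1) by (intro mult_left_mono) auto
        finally show ?thesis using \<delta>(2) by simp
      qed
      have "(\<lambda>j. \<integral>g. f (Z (r j) g) \<partial>iid_seq gauss) \<longlonglongrightarrow> (\<integral>g. f (Y g) \<partial>iid_seq gauss)"
      proof (rule integral_dominated_convergence[where w = "\<lambda>_. 1"])
        show "AE g in iid_seq gauss. (\<lambda>j. f (Z (r j) g)) \<longlonglongrightarrow> f (Y g)"
          using Ylim by eventually_elim (rule continuous_on_tendsto_compose[OF fc], auto)
      qed (auto simp: f1)
      from LIMSEQ_D[OF this \<eta>] obtain j0 where j0: "\<And>j. j \<ge> j0 \<Longrightarrow>
        \<bar>(\<integral>g. f (Z (r j) g) \<partial>iid_seq gauss) - (\<integral>g. f (Y g) \<partial>iid_seq gauss)\<bar> < \<eta>" by auto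
      \<comment> \<open>The level must belong to the convergent subsequence and also be at least
        \<open>l0\<close>.\<close>
      define l where "l = r (max j0 l0)"
      have l: "l \<ge> l0" using seq_suble[OF r(1), of "max j0 l0"] by (simp add: l_def)
      have lY: "\<bar>(\<integral>g. f (Z l g) \<partial>iid_seq gauss) - (\<integral>g. f (Y g) \<partial>iid_seq gauss)\<bar> < \<eta>"
        unfolding l_def by (rule j0) simp
      obtain n0 where n0: "\<And>n. n \<ge> n0 \<Longrightarrow> norm ((\<integral>\<omega>. f (nsum (\<lambda>\<omega>. A l \<omega> - A 0 \<omega>) n \<omega>) \<partial>iid_seq M) - (\<integral>g. f (Z l g) \<partial>iid_seq gauss)) < \<eta>"
        using LIMSEQ_D[OF weak_limit_A[OF le0 fc f1, of l] \<eta>] unfolding Z_def by blast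
      show "\<exists>no. \<forall>n\<ge>no. norm ((\<integral>\<omega>. f (nsum X n \<omega>) \<partial>iid_seq M) - (\<integral>g. f (Y g) \<partial>iid_seq gauss)) < \<eta>'"
      proof (intro exI allI impI)
        fix n assume "n \<ge> n0"
        from n0[OF this] close[OF l, of n] lY \<eta> show "norm ((\<integral>\<omega>. f (nsum X n \<omega>) \<partial>iid_seq M) - (\<integral>g. f (Y g) \<partial>iid_seq gauss)) < \<eta>'"
          unfolding real_norm_def \<eta>_def by linarith
      qed
    qed
    then show "(\<lambda>n. \<integral>x. f x \<partial>distr (iid_seq M) borel (nsum X n)) \<longlonglongrightarrow> (\<integral>x. f x \<partial>\<nu>)"
      unfolding \<nu>_def by (simp add: integral_distr)
  qed (auto simp: \<nu>_def intro!: S.prob_space_distr N.prob_space_distr)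
  moreover have "prob_space \<nu>" unfolding \<nu>_def by (rule N.prob_space_distr) measurable
  ultimately show ?thesis
    unfolding CLT_iff_nsum[OF M X] converges_in_distribution_def by (intro exI[of _ \<nu>]) (simp add: \<nu>_def)
qed

lemma type2_small_remainders:
  assumes C: "\<And>k (x::nat \<Rightarrow> 'b). rademacher_moment k x \<le> C * (\<Sum>i<k. (norm (x i))\<^sup>2)" "C \<ge> 0"
  shows small_remainders
  unfolding small_remainders_def
proof (intro allI impI)
  fix \<epsilon> :: real assume \<epsilon>: "\<epsilon> > 0"
  define \<delta> where "\<delta> = \<epsilon> / (4 * C + 1)"
  have \<delta>: "\<delta> > 0" "4 * C * \<delta> \<le> \<epsilon>" using \<epsilon> C(2) by (auto simp: \<delta>_def field_simps)
  obtain L where L: "\<And>l. l \<ge> L \<Longrightarrow> second_moment M (\<lambda>\<omega>. X \<omega> - A l \<omega>) \<le> ennreal \<delta>"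
    using approx[OF \<delta>(1)] unfolding A_def by blast
  show "\<exists>L. \<forall>l\<ge>L. \<forall>n. second_moment (iid_seq M) (\<lambda>\<omega>. psum (\<lambda>_ \<omega>. X \<omega> - A l \<omega>) n \<omega>) \<le> ennreal (\<epsilon> * real n)"
  proof (intro exI allI impI)
    fix l n assume l: "l \<ge> L"
    have "second_moment (iid_seq M) (\<lambda>\<omega>. psum (\<lambda>_ \<omega>. X \<omega> - A l \<omega>) n \<omega>) \<le>
      ennreal (4 * C * real n) * second_moment M (\<lambda>\<omega>. X \<omega> - A l \<omega>)"
      using integrable_X integrable_A mean mean_A by (intro type2_mean_zero M C) auto
    also have "\<dots> \<le> ennreal (4 * C * real n) * ennreal \<delta>" by (intro mult_left_mono L l) auto
    also have "\<dots> = ennreal (4 * C * real n * \<delta>)" using C(2) by (intro ennreal_mult'[symmetric]) auto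
    also have "\<dots> \<le> ennreal (\<epsilon> * real n)"
      using mult_right_mono[OF \<delta>(2), of "real n"] by (intro ennreal_leI) (simp add: mult_ac)
    finally show "second_moment (iid_seq M) (\<lambda>\<omega>. psum (\<lambda>_ \<omega>. X \<omega> - A l \<omega>) n \<omega>) \<le> ennreal (\<epsilon> * real n)" .
  qed
qed

text \<open>Otherwise there are consecutive blocks, as many as desired, each with second moment
  above \<epsilon>. They are independent and symmetric, so cotype 2 bounds the sum of their second
  moments by \<open>C\<close> times that of the whole series, which is at most \<open>K\<close> by
  the hypothesis on \<open>X\<close>.\<close>

lemma cotype2_gauss_cauchy:
  assumes C: "\<And>k (x::nat \<Rightarrow> 'b). (\<Sum>i<k. (norm (x i))\<^sup>2) \<le> C * rademacher_moment k x" "C \<ge> 0"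
    and K: "\<And>n. second_moment (iid_seq M) (psum (\<lambda>_. X) n) \<le> ennreal (K * real n)" "K \<ge> 0"
    and \<epsilon>: "\<epsilon> > 0"
  shows "\<exists>L. \<forall>l\<ge>L. second_moment (iid_seq gauss) (G L l) \<le> ennreal \<epsilon>"
proof (rule ccontr)
  let ?d = "\<lambda>l l'. \<integral>\<^sup>+g. ennreal ((norm (G l l' g))\<^sup>2) \<partial>iid_seq gauss"
  assume "\<not> ?thesis"
  then obtain nxt where nx: "\<And>L. nxt L \<ge> L" "\<And>L. ?d L (nxt L) > ennreal \<epsilon>"
    by (metis linorder_not_le)
  define p where "p j = (nxt ^^ j) 0" for j
  have p_Suc: "p (Suc j) = nxt (p j)" and p_0: "p 0 = 0" for j by (simp_all add: p_def)
  have "mono p" by (rule incseq_SucI) (simp add: p_Suc nx)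
  then have mp: "mono (\<lambda>j. 2 ^ p j :: nat)" by (auto simp: mono_def)
  define h where "h j g = (\<Sum>k\<in>{2 ^ p j..<2 ^ p (Suc j)}. g k *\<^sub>R x k)" for j and g :: "nat \<Rightarrow> real"
  have [measurable]: "h j \<in> borel_measurable (iid_seq gauss)" for j unfolding h_def[abs_def] by measurable
  have sym: "symmetric_rv (iid_seq gauss) (h j)" for j
    unfolding h_def[abs_def] by (rule symmetric_rv_gauss_sum)
  have bound: "ennreal \<epsilon> * of_nat J \<le> ennreal (C * K)" for J
  proof -
    have "ennreal \<epsilon> * of_nat J = (\<Sum>j<J. ennreal \<epsilon>)" by (simp add: mult.commute)
    also have "\<dots> \<le> (\<Sum>j<J. \<integral>\<^sup>+g. ennreal ((norm (h j g))\<^sup>2) \<partial>iid_seq gauss)"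
      using nx(2) by (intro sum_mono) (simp add: h_def p_Suc G_def less_imp_le)
    also have "\<dots> \<le> ennreal C * second_moment (iid_seq (iid_seq gauss)) (\<lambda>\<Omega>. 0 + psum h J \<Omega>)"
      using cotype2_symmetric[where h = h and k = J, OF prob_spaces(2) _ sym C] by simp
    also have "second_moment (iid_seq (iid_seq gauss)) (\<lambda>\<Omega>. 0 + psum h J \<Omega>) = ?d 0 (p J)"
      unfolding h_def[abs_def] using nn_integral_gauss_blocks[OF _ mp, of "\<lambda>v. ennreal ((norm v)\<^sup>2)" 0 x J]
      by (simp add: G_def p_0)
    \<comment> \<open>At level 0 the partial sum vanishes, so the remainder is \<open>X\<close>
      itself.\<close>
    also have "\<dots> \<le> ennreal K"
      using K by (intro gauss_second_moment_le) (auto simp: A_0)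
    finally show ?thesis using C(2) K(2) by (simp add: ennreal_mult mult_left_mono)
  qed
  obtain J :: nat where J: "C * K / \<epsilon> < real J" using reals_Archimedean2 by blast
  have "ennreal (\<epsilon> * real J) \<le> ennreal (C * K)"
    using bound[of J] \<epsilon> by (simp add: ennreal_mult ennreal_of_nat_eq_real_of_nat)
  then have "\<epsilon> * real J \<le> C * K" using C(2) K(2) by (simp add: ennreal_le_iff)
  with J \<epsilon> show False by (simp add: field_simps)
qed

text \<open>The Gaussian bound on \<open>A l' - A l\<close> is uniform in l' \<ge> l and yields a
  bound linear in \<open>n\<close>. Then l' may depend on \<open>n\<close>: it is taken so large
  that \<open>X - A l'\<close> is negligible even after the loss of a factor
  \<open>n^2\<close>.\<close>

lemma cotype2_small_remainders:
  assumes C: "\<And>k (x::nat \<Rightarrow> 'b). (\<Sum>i<k. (norm (x i))\<^sup>2) \<le> C * rademacher_moment k x" "C \<ge> 0"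
    and K: "\<And>n. second_moment (iid_seq M) (psum (\<lambda>_. X) n) \<le> ennreal (K * real n)" "K \<ge> 0"
  shows small_remainders
  unfolding small_remainders_def
proof (intro allI impI)
  fix \<epsilon> :: real assume \<epsilon>: "\<epsilon> > 0"
  \<comment> \<open>The blocks beyond \<open>L\<close> have second moments up to 4\<delta>, the
    bound for sums multiplies by \<open>18432 * C\<close>, and splitting a square doubles it; the
    result is at most \<epsilon>/2. The added 1 covers \<open>C = 0\<close>.\<close>
  define \<delta> where "\<delta> = \<epsilon> / (16 * 18432 * C + 1)"
  have \<delta>: "\<delta> > 0" "2 * (18432 * C * (4 * \<delta>)) \<le> \<epsilon> / 2" using \<epsilon> C(2) by (auto simp: \<delta>_def field_simps)
  obtain L where L: "\<And>l. l \<ge> L \<Longrightarrow> second_moment (iid_seq gauss) (G L l) \<le> ennreal \<delta>"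
    using cotype2_gauss_cauchy[OF C K \<delta>(1)] by blast
  have d: "second_moment (iid_seq gauss) (G l l') \<le> ennreal (4 * \<delta>)" if "L \<le> l" "l \<le> l'" for l l'
  proof -
    have le: "(2::nat) ^ L \<le> 2 ^ l" "(2::nat) ^ l \<le> 2 ^ l'" using that by auto
    have "G l l' g = G L l' g - G L l g" for g
      unfolding G_def using sum.atLeastLessThan_concat[OF le, of "\<lambda>k. g k *\<^sub>R x k"] by (simp add: algebra_simps)
    then have "second_moment (iid_seq gauss) (G l l') \<le>
      2 * second_moment (iid_seq gauss) (G L l') + 2 * second_moment (iid_seq gauss) (G L l)"
      by (simp only:) (rule nn_integral_norm_square_diff_le, measurable)
    also have "\<dots> \<le> 2 * ennreal \<delta> + 2 * ennreal \<delta>" using that by (intro add_mono mult_left_mono L) auto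
    also have "\<dots> = ennreal (4 * \<delta>)" using \<delta>(1) by (simp flip: ennreal_numeral ennreal_mult' ennreal_plus)
    finally show ?thesis .
  qed
  show "\<exists>L. \<forall>l\<ge>L. \<forall>n. second_moment (iid_seq M) (\<lambda>\<omega>. psum (\<lambda>_ \<omega>. X \<omega> - A l \<omega>) n \<omega>) \<le> ennreal (\<epsilon> * real n)"
  proof (intro exI allI impI)
    fix l n assume l: "l \<ge> L"
    show "second_moment (iid_seq M) (\<lambda>\<omega>. psum (\<lambda>_ \<omega>. X \<omega> - A l \<omega>) n \<omega>) \<le> ennreal (\<epsilon> * real n)"
    proof (cases "n = 0")
      case True
      then show ?thesis by (simp add: psum_def)
    next
      case False
      define \<gamma> where "\<gamma> = \<epsilon> / (4 * real n)"
      have \<gamma>: "\<gamma> > 0" "2 * ((real n)\<^sup>2 * \<gamma>) = \<epsilon> / 2 * real n" using \<epsilon> False by (auto simp: \<gamma>_def power2_eq_square field_simps)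
      obtain L' where L': "\<And>l. l \<ge> L' \<Longrightarrow> second_moment M (\<lambda>\<omega>. X \<omega> - A l \<omega>) \<le> ennreal \<gamma>"
        using approx[OF \<gamma>(1)] unfolding A_def by blast
      define l' where "l' = max l L'"
      let ?E = "\<lambda>h. \<integral>\<^sup>+\<omega>. ennreal ((norm (psum (\<lambda>_. h) n \<omega>))\<^sup>2) \<partial>iid_seq M"
      have 1: "?E (\<lambda>\<omega>. X \<omega> - A l' \<omega>) \<le> ennreal ((real n)\<^sup>2 * \<gamma>)"
      proof -
        have "?E (\<lambda>\<omega>. X \<omega> - A l' \<omega>) \<le> ennreal ((real n)\<^sup>2) * second_moment M (\<lambda>\<omega>. X \<omega> - A l' \<omega>)"
          by (rule nn_integral_psum_square_le[OF M]) measurable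
        also have "\<dots> \<le> ennreal ((real n)\<^sup>2) * ennreal \<gamma>" by (intro mult_left_mono L') (auto simp: l'_def)
        also have "\<dots> = ennreal ((real n)\<^sup>2 * \<gamma>)" by (intro ennreal_mult'[symmetric]) auto
        finally show ?thesis .
      qed
      have 2: "?E (\<lambda>\<omega>. A l' \<omega> - A l \<omega>) \<le> ennreal (18432 * C * (4 * \<delta>) * real n)"
        using \<delta>(1) l by (intro cotype2_second_moment_bound[OF M prob_spaces(2), where Z = "G l l'"] C d weak_limit_A)
          (auto simp: l'_def)
      have "psum (\<lambda>_ \<omega>. X \<omega> - A l \<omega>) n \<omega> = psum (\<lambda>_ \<omega>. X \<omega> - A l' \<omega>) n \<omega> - (- psum (\<lambda>_ \<omega>. A l' \<omega> - A l \<omega>) n \<omega>)" for \<omega>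
        by (simp add: psum_def flip: sum.distrib)
      then have "?E (\<lambda>\<omega>. X \<omega> - A l \<omega>) \<le> 2 * ?E (\<lambda>\<omega>. X \<omega> - A l' \<omega>) +
          2 * second_moment (iid_seq M) (\<lambda>\<omega>. - psum (\<lambda>_ \<omega>. A l' \<omega> - A l \<omega>) n \<omega>)"
        by (simp only:) (rule nn_integral_norm_square_diff_le, measurable)
      also have "\<dots> \<le> 2 * ennreal ((real n)\<^sup>2 * \<gamma>) + 2 * ennreal (18432 * C * (4 * \<delta>) * real n)"
        using 1 2 by (intro add_mono mult_left_mono) (auto simp del: ennreal_mult)
      also have "\<dots> = ennreal (2 * ((real n)\<^sup>2 * \<gamma>) + 2 * (18432 * C * (4 * \<delta>)) * real n)"
        using \<gamma>(1) \<delta>(1) C(2) by (simp flip: ennreal_numeral ennreal_mult' ennreal_plus add: mult.assoc)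
      also have "\<dots> \<le> ennreal (\<epsilon> * real n)"
        using mult_right_mono[OF \<delta>(2), of "real n"] \<gamma>(2) by (intro ennreal_leI) (simp add: field_simps)
      finally show ?thesis .
    qed
  qed
qed

end

section \<open>The two halves of the theorem\<close>

lemma cotype2E:
  assumes "cotype2 TYPE('b::real_normed_vector)"
  obtains C where "\<And>k (x::nat \<Rightarrow> 'b). (\<Sum>i<k. (norm (x i))\<^sup>2) \<le> C * rademacher_moment k x" "C \<ge> 0"
proof -
  obtain C where C: "\<And>k (x::nat \<Rightarrow> 'b). (\<Sum>i<k. (norm (x i))\<^sup>2) \<le> C * rademacher_moment k x"
    using assms unfolding cotype2_def by blast
  have "C * rademacher_moment k x \<le> max C 0 * rademacher_moment k x" for k and x :: "nat \<Rightarrow> 'b"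
    unfolding rademacher_moment_eq_avg by (intro mult_right_mono rademacher_avg_nonneg) auto
  then show ?thesis using order_trans[OF C] by (intro that[of "max C 0"]) auto
qed

lemma type2E:
  assumes "type2 TYPE('b::real_normed_vector)"
  obtains C where "\<And>k (x::nat \<Rightarrow> 'b). rademacher_moment k x \<le> C * (\<Sum>i<k. (norm (x i))\<^sup>2)" "C \<ge> 0"
proof -
  obtain C where C: "\<And>k (x::nat \<Rightarrow> 'b). rademacher_moment k x \<le> C * (\<Sum>i<k. (norm (x i))\<^sup>2)"
    using assms unfolding type2_def by blast
  have "C * (\<Sum>i<k. (norm (x i))\<^sup>2) \<le> max C 0 * (\<Sum>i<k. (norm (x i))\<^sup>2)" for k and x :: "nat \<Rightarrow> 'b"
    by (intro mult_right_mono sum_nonneg) auto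
  then show ?thesis using order_trans[OF C] by (intro that[of "max C 0"]) auto
qed

text \<open>A single limit law puts little mass far out. Its tail is tested by \<open>f R\<close>, a
  continuous function that vanishes on the ball of radius \<open>R\<close> and equals 1 outside the
  ball of radius \<open>R + 1\<close>; the gap explains \<open>t = real k + 1\<close>.\<close>

lemma CLTSS_imp_stochastically_bounded:
  fixes X :: "'a \<Rightarrow> 'b::{banach,second_countable_topology}"
  assumes M: "prob_space M" and X[measurable]: "X \<in> borel_measurable M" and clt: "CLTSS M X" and \<delta>: "\<delta> > 0"
  obtains t where "t \<ge> 0"
    "\<exists>\<^sub>\<infinity>m. (\<integral>\<^sup>+\<omega>. indicator {v. t * sqrt (real m) < norm v} (psum (\<lambda>_. X) m \<omega>) \<partial>iid_seq M) \<le> ennreal \<delta>"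
proof -
  interpret S: prob_space "iid_seq M" using M by (rule prob_space_iid_seq)
  obtain m \<nu> where m: "strict_mono (m :: nat \<Rightarrow> nat)" "\<And>n. 0 < m n" and \<nu>: "prob_space \<nu>" "sets \<nu> = sets borel"
    and w: "weakly_converges (\<lambda>n. distr (iid_seq M) borel (nsum X (m n))) \<nu>"
    using clt unfolding CLTSS_iff_nsum[OF M X] converges_in_distribution_def by auto
  interpret \<nu>: prob_space \<nu> by fact
  note [measurable_cong] = \<nu>(2)
  define f where "f R v = min 1 (max 0 (norm v - R))" for R :: real and v :: 'b
  have f: "continuous_on UNIV (f R)" "0 \<le> f R v" "f R v \<le> 1" for R v
    by (auto simp: f_def[abs_def] intro!: continuous_intros)
  have [measurable]: "f R \<in> borel_measurable borel" for R by (rule borel_measurable_continuous_onI[OF f(1)])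
  have "(\<lambda>k. \<integral>v. f (real k) v \<partial>\<nu>) \<longlonglongrightarrow> (\<integral>v. 0 \<partial>\<nu>)"
  proof (rule integral_dominated_convergence[where w = "\<lambda>_. 1"])
    show "AE v in \<nu>. (\<lambda>k. f (real k) v) \<longlonglongrightarrow> 0"
    proof (rule AE_I2)
      fix v :: 'b
      obtain k where k: "norm v \<le> real k" using real_arch_simple by blast
      have "\<forall>\<^sub>F k in sequentially. f (real k) v = 0"
        using eventually_ge_at_top[of k] by eventually_elim (use k in \<open>auto simp: f_def\<close>)
      then show "(\<lambda>k. f (real k) v) \<longlonglongrightarrow> 0" by (rule tendsto_eventually)
    qed
  qed (auto simp: f)
  then have "\<forall>\<^sub>F k in sequentially. (\<integral>v. f (real k) v \<partial>\<nu>) < \<delta>"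
    using \<delta> by (intro order_tendstoD) auto
  then obtain k where k: "(\<integral>v. f (real k) v \<partial>\<nu>) < \<delta>" by (auto simp: eventually_sequentially)
  have bf: "bounded (range (f (real k)))"
    by (rule boundedI[of _ 1]) (use f in auto)
  have "(\<lambda>n. \<integral>v. f (real k) v \<partial>distr (iid_seq M) borel (nsum X (m n))) \<longlonglongrightarrow> (\<integral>v. f (real k) v \<partial>\<nu>)"
    using w f(1)[of "real k"] bf unfolding weakly_converges_def by blast
  then have "\<forall>\<^sub>F n in sequentially. (\<integral>v. f (real k) v \<partial>distr (iid_seq M) borel (nsum X (m n))) < \<delta>"
    using k by (rule order_tendstoD)
  then obtain n0 where n0: "\<And>n. n \<ge> n0 \<Longrightarrow> (\<integral>\<omega>. f (real k) (nsum X (m n) \<omega>) \<partial>iid_seq M) < \<delta>"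
    by (auto simp: eventually_sequentially integral_distr)
  define t where "t = real k + 1"
  have le: "(\<integral>\<^sup>+\<omega>. indicator {v. t * sqrt (real (m n)) < norm v} (psum (\<lambda>_. X) (m n) \<omega>) \<partial>iid_seq M) \<le> ennreal \<delta>"
    if n: "n \<ge> n0" for n
  proof -
    have "(\<integral>\<^sup>+\<omega>. indicator {v. t * sqrt (real (m n)) < norm v} (psum (\<lambda>_. X) (m n) \<omega>) \<partial>iid_seq M) \<le>
      (\<integral>\<^sup>+\<omega>. ennreal (f (real k) (nsum X (m n) \<omega>)) \<partial>iid_seq M)"
    proof (rule nn_integral_mono)
      fix \<omega>
      show "indicator {v. t * sqrt (real (m n)) < norm v} (psum (\<lambda>_. X) (m n) \<omega>) \<le> ennreal (f (real k) (nsum X (m n) \<omega>))"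
      proof (cases "t * sqrt (real (m n)) < norm (psum (\<lambda>_. X) (m n) \<omega>)")
        case True
        then have "t < norm (nsum X (m n) \<omega>)" using m(2)[of n] by (simp add: field_simps)
        then have "f (real k) (nsum X (m n) \<omega>) = 1" by (simp add: f_def t_def del: norm_scaleR)
        then show ?thesis by (simp add: indicator_def)
      qed simp
    qed
    also have "\<dots> = ennreal (\<integral>\<omega>. f (real k) (nsum X (m n) \<omega>) \<partial>iid_seq M)"
      using f by (intro nn_integral_eq_integral S.integrable_const_bound[of _ 1]) auto
    also have "\<dots> \<le> ennreal \<delta>" using n0[OF n] by (intro ennreal_leI) auto
    finally show ?thesis .
  qed
  show ?thesis
  proof (rule that[of t])
    show "\<exists>\<^sub>\<infinity>m. (\<integral>\<^sup>+\<omega>. indicator {v. t * sqrt (real m) < norm v} (psum (\<lambda>_. X) m \<omega>) \<partial>iid_seq M) \<le> ennreal \<delta>"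
      unfolding INFM_nat_le
    proof
      fix N
      have "N \<le> m (max N n0)" using seq_suble[OF m(1), of "max N n0"] by simp
      then show "\<exists>j\<ge>N. (\<integral>\<^sup>+\<omega>. indicator {v. t * sqrt (real j) < norm v} (psum (\<lambda>_. X) j \<omega>) \<partial>iid_seq M) \<le> ennreal \<delta>"
        using le[of "max N n0"] by (intro exI[of _ "m (max N n0)"]) auto
    qed
  qed (simp add: t_def)
qed

lemma cotype2_CLTSS_moments:
  fixes X :: "'a \<Rightarrow> 'b::{banach,second_countable_topology}"
  assumes co: "cotype2 TYPE('b)" and M: "prob_space M" and X: "X \<in> borel_measurable M" and clt: "CLTSS M X"
  shows "second_moment M X < \<infinity>" "integrable M X" "(\<integral>x. X x \<partial>M) = 0"
    "\<exists>K\<ge>0. \<forall>n. second_moment (iid_seq M) (psum (\<lambda>_. X) n) \<le> ennreal (K * real n)"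
proof -
  obtain C where C: "\<And>k (x::nat \<Rightarrow> 'b). (\<Sum>i<k. (norm (x i))\<^sup>2) \<le> C * rademacher_moment k x" "C \<ge> 0"
    using cotype2E[OF co] by blast
  obtain t where t: "t \<ge> 0"
    "\<exists>\<^sub>\<infinity>m. (\<integral>\<^sup>+\<omega>. indicator {v. t * sqrt (real m) < norm v} (psum (\<lambda>_. X) m \<omega>) \<partial>iid_seq M) \<le> ennreal (1/576)"
    using CLTSS_imp_stochastically_bounded[OF M X clt, of "1/576"] by auto
  note * = cotype2_stochastically_bounded[OF M X C t]
  show "second_moment M X < \<infinity>" "integrable M X" "(\<integral>x. X x \<partial>M) = 0"
    using * by auto
  show "\<exists>K\<ge>0. \<forall>n. second_moment (iid_seq M) (psum (\<lambda>_. X) n) \<le> ennreal (K * real n)"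
    using *(4) C(2) by (intro exI[of _ "16 * C * t\<^sup>2"]) auto
qed

lemma cotype2_CLTSS_imp_CLT:
  fixes X :: "'a \<Rightarrow> 'b::{banach,second_countable_topology}"
  assumes co: "cotype2 TYPE('b)" and M: "prob_space M" and X: "X \<in> borel_measurable M" and clt: "CLTSS M X"
  shows "CLT M X"
proof -
  note * = cotype2_CLTSS_moments[OF assms]
  obtain C where C: "\<And>k (x::nat \<Rightarrow> 'b). (\<Sum>i<k. (norm (x i))\<^sup>2) \<le> C * rademacher_moment k x" "C \<ge> 0"
    using cotype2E[OF co] by blast
  obtain K where K: "K \<ge> 0" "\<And>n. second_moment (iid_seq M) (psum (\<lambda>_. X) n) \<le> ennreal (K * real n)"
    using *(4) by blast
  obtain e x where "orthonormal_expansion M X e x"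
    using orthonormal_expansion_exists[OF M X *(1,3)] by blast
  then interpret orthonormal_expansion M X e x .
  show ?thesis by (intro small_remainders_imp_CLT cotype2_small_remainders[OF C K(2,1)])
qed

lemma type2_moments_imp_CLT:
  fixes X :: "'a \<Rightarrow> 'b::{banach,second_countable_topology}"
  assumes ty: "type2 TYPE('b)" and M: "prob_space M" and X: "X \<in> borel_measurable M"
    and sq: "second_moment M X < \<infinity>" and mean: "(\<integral>\<omega>. X \<omega> \<partial>M) = 0"
  shows "CLT M X"
proof -
  obtain C where C: "\<And>k (x::nat \<Rightarrow> 'b). rademacher_moment k x \<le> C * (\<Sum>i<k. (norm (x i))\<^sup>2)" "C \<ge> 0"
    using type2E[OF ty] by blast
  obtain e x where "orthonormal_expansion M X e x"
    using orthonormal_expansion_exists[OF M X sq mean] by blast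
  then interpret orthonormal_expansion M X e x .
  show ?thesis by (intro small_remainders_imp_CLT type2_small_remainders[OF C])
qed

section \<open>Comparison of Rademacher and Gaussian averages\<close>

abbreviation sign_pmf :: "real pmf" where "sign_pmf \<equiv> pmf_of_set {-1, 1}"

lemma nn_integral_sign: "(\<integral>\<^sup>+s. F s \<partial>sign_pmf) = (F (-1) + F 1) / 2"
  by (simp add: nn_integral_pmf_of_set)

lemma nn_integral_psum_sign:
  fixes y :: "nat \<Rightarrow> 'b::{real_normed_vector,second_countable_topology}"
  assumes F[measurable]: "F \<in> borel_measurable borel" and F0: "\<And>v. F v \<ge> 0"
  shows "(\<integral>\<^sup>+\<omega>. ennreal (F (s + psum (\<lambda>i \<epsilon>. \<epsilon> *\<^sub>R y i) k \<omega>)) \<partial>iid_seq sign_pmf) = ennreal (rademacher_avg F y k s)"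
proof (induction k arbitrary: y s)
  case 0
  interpret S: prob_space "iid_seq (measure_pmf sign_pmf)"
    by (intro prob_space_iid_seq) (rule measure_pmf.prob_space_axioms)
  show ?case by (simp add: psum_def S.emeasure_space_1)
next
  case (Suc k)
  have nn: "rademacher_avg F y k s \<ge> 0" for y k s by (rule rademacher_avg_nonneg[OF F0])
  have "(\<integral>\<^sup>+\<omega>. ennreal (F (s + psum (\<lambda>i \<epsilon>. \<epsilon> *\<^sub>R y i) (Suc k) \<omega>)) \<partial>iid_seq sign_pmf) =
    (\<integral>\<^sup>+\<epsilon>. ennreal (rademacher_avg F (\<lambda>i. y (Suc i)) k (s + \<epsilon> *\<^sub>R y 0)) \<partial>sign_pmf)"
    by (subst nn_integral_psum_Suc[OF measure_pmf.prob_space_axioms, where F = "\<lambda>v. ennreal (F v)"]) (auto simp: Suc.IH)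
  also have "\<dots> = ennreal (rademacher_avg F y (Suc k) s)"
    unfolding nn_integral_sign rademacher_avg_Suc_first
    by (simp add: nn divide_ennreal[symmetric] ennreal_plus[symmetric] add.commute del: ennreal_plus)
  finally show ?case .
qed

lemma gauss_abs_moment: "integrable gauss (\<lambda>z. \<bar>z\<bar>)" "(\<integral>z. \<bar>z\<bar> \<partial>gauss) = sqrt (2 / pi)"
  using std_normal_distribution_odd_moments_abs[of 0] integrable_gauss_id by auto

text \<open>A standard normal variable is a fair sign times its independent absolute value. Jensen's
  inequality replaces the absolute value by its mean \<open>sqrt (2 / pi)\<close>, whose square is
  the constant.\<close>

lemma rademacher_moment_le_gauss:
  fixes y :: "nat \<Rightarrow> 'b::{banach,second_countable_topology}"
  shows "ennreal (2 / pi * rademacher_moment k y) \<le> second_moment (iid_seq gauss) (\<lambda>g. \<Sum>i<k. g i *\<^sub>R y i)"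
proof -
  interpret g: prob_space gauss by (rule prob_space_gauss)
  define c where "c = sqrt (2 / pi)"
  have c2: "c\<^sup>2 = 2 / pi" by (simp add: c_def)
  have two: "second_moment sign_pmf (\<lambda>\<epsilon>. s + \<epsilon> *\<^sub>R (c *\<^sub>R v)) \<le> second_moment gauss (\<lambda>z. s + z *\<^sub>R v)"
    for s v :: 'b
  proof -
    have 1: "ennreal ((norm (s + c *\<^sub>R u))\<^sup>2) \<le> second_moment gauss (\<lambda>z. s + \<bar>z\<bar> *\<^sub>R u)" for u :: 'b
    proof -
      have "(\<integral>z. (\<bar>z\<bar> - c) *\<^sub>R u \<partial>gauss) = (\<integral>z. \<bar>z\<bar> - c \<partial>gauss) *\<^sub>R u"
        using gauss_abs_moment(1) by (intro integral_scaleR_left) auto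
      also have "(\<integral>z. \<bar>z\<bar> - c \<partial>gauss) = 0"
        using gauss_abs_moment by (simp add: c_def g.prob_space[simplified])
      finally have "ennreal ((norm (s + c *\<^sub>R u))\<^sup>2) \<le> second_moment gauss (\<lambda>z. s + c *\<^sub>R u + (\<bar>z\<bar> - c) *\<^sub>R u)"
        using gauss_abs_moment(1) by (intro norm_square_le_nn_integral prob_space_gauss) auto
      then show ?thesis by (simp add: algebra_simps)
    qed
    have sym: "second_moment gauss (\<lambda>z. s + - (z *\<^sub>R v)) = second_moment gauss (\<lambda>z. s + z *\<^sub>R v)"
      by (rule symmetric_rvD[OF symmetric_rv_gauss, of "\<lambda>w. ennreal ((norm (s + w))\<^sup>2)"]) measurable
    have "ennreal ((norm (s + c *\<^sub>R v))\<^sup>2) + ennreal ((norm (s + c *\<^sub>R (- v)))\<^sup>2) \<le>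
      second_moment gauss (\<lambda>z. s + \<bar>z\<bar> *\<^sub>R v) + second_moment gauss (\<lambda>z. s + \<bar>z\<bar> *\<^sub>R (- v))"
      by (intro add_mono 1)
    also have "\<dots> = (\<integral>\<^sup>+z. ennreal ((norm (s + \<bar>z\<bar> *\<^sub>R v))\<^sup>2) + ennreal ((norm (s + \<bar>z\<bar> *\<^sub>R (- v)))\<^sup>2) \<partial>gauss)"
      by (rule nn_integral_add[symmetric]) auto
    also have "\<dots> = (\<integral>\<^sup>+z. ennreal ((norm (s + z *\<^sub>R v))\<^sup>2) + ennreal ((norm (s + - (z *\<^sub>R v)))\<^sup>2) \<partial>gauss)"
      by (intro nn_integral_cong) (auto simp: abs_if)
    also have "\<dots> = second_moment gauss (\<lambda>z. s + z *\<^sub>R v) + second_moment gauss (\<lambda>z. s + z *\<^sub>R v)"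
      by (subst nn_integral_add) (auto simp: sym[simplified])
    finally have "(ennreal ((norm (s + c *\<^sub>R v))\<^sup>2) + ennreal ((norm (s + c *\<^sub>R (- v)))\<^sup>2)) / 2 \<le>
      (second_moment gauss (\<lambda>z. s + z *\<^sub>R v) + second_moment gauss (\<lambda>z. s + z *\<^sub>R v)) / 2"
      by (rule divide_right_mono_ennreal)
    also have "\<dots> = second_moment gauss (\<lambda>z. s + z *\<^sub>R v)"
      by (rule ennreal_add_self_half)
    finally show ?thesis unfolding nn_integral_sign by (simp add: add.commute)
  qed
  have "ennreal (2 / pi * rademacher_moment k y) = ennreal (rademacher_avg (\<lambda>v. (norm v)\<^sup>2) (\<lambda>i. c *\<^sub>R y i) k 0)"
    using rademacher_avg_scale[of "\<lambda>v. (norm v)\<^sup>2" c y k 0] c2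
      rademacher_avg_cmult[of "2 / pi" "\<lambda>v. (norm v)\<^sup>2" y k 0]
    by (simp add: rademacher_moment_eq_avg power_mult_distrib)
  also have "\<dots> = second_moment (iid_seq sign_pmf) (\<lambda>\<omega>. 0 + psum (\<lambda>i \<epsilon>. \<epsilon> *\<^sub>R (c *\<^sub>R y i)) k \<omega>)"
    by (rule nn_integral_psum_sign[symmetric]) auto
  also have "\<dots> \<le> second_moment (iid_seq gauss) (\<lambda>g. 0 + psum (\<lambda>i z. z *\<^sub>R y i) k g)"
    using two by (intro nn_integral_psum_mono[where F = "\<lambda>v. ennreal ((norm v)\<^sup>2)"] measure_pmf.prob_space_axioms prob_space_gauss) auto
  finally show ?thesis by (simp add: psum_def)
qed

section \<open>A counterexample in spaces that are not of type 2\<close>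

lemma rademacher_moment_scale:
  "rademacher_moment k (\<lambda>i. c *\<^sub>R x i) = c\<^sup>2 * rademacher_moment k x"
  using rademacher_avg_scale[of "\<lambda>v. (norm v)\<^sup>2" c x k 0]
    rademacher_avg_cmult[of "c\<^sup>2" "\<lambda>v. (norm v)\<^sup>2" x k 0]
  by (simp add: rademacher_moment_eq_avg power_mult_distrib)

text \<open>Type 2 fails with constant \<open>8 ^ j\<close>. Both sides are quadratic, so the sum of
  squares can be scaled to \<open>(1/2) ^ j\<close>, and the average then exceeds
  \<open>8 ^ j * (1/2) ^ j = 4 ^ j\<close>.\<close>

lemma not_type2_vectors:
  assumes "\<not> type2 TYPE('b::real_normed_vector)"
  obtains k and y :: "nat \<Rightarrow> 'b::real_normed_vector" where "k > 0" "(\<Sum>i<k. (norm (y i))\<^sup>2) = (1/2) ^ j" "rademacher_moment k y > 4 ^ j"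
proof -
  obtain k and x :: "nat \<Rightarrow> 'b" where kx: "rademacher_moment k x > 8 ^ j * (\<Sum>i<k. (norm (x i))\<^sup>2)"
    using assms unfolding type2_def by (meson not_le)
  define \<sigma> where "\<sigma> = (\<Sum>i<k. (norm (x i))\<^sup>2)"
  have "\<sigma> \<noteq> 0"
  proof
    assume "\<sigma> = 0"
    then have "x i = 0" if "i < k" for i
      using that unfolding \<sigma>_def by (subst (asm) sum_nonneg_eq_0_iff) auto
    then have "rademacher_moment k x = 0" by (simp add: rademacher_moment_def)
    with kx \<open>\<sigma> = 0\<close> show False by (simp add: \<sigma>_def)
  qed
  moreover have "\<sigma> \<ge> 0" unfolding \<sigma>_def by (intro sum_nonneg) auto
  ultimately have \<sigma>: "\<sigma> > 0" by simp
  define c where "c = sqrt ((1/2)^j / \<sigma>)"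
  have c2: "c\<^sup>2 = (1/2)^j / \<sigma>" using \<sigma> by (simp add: c_def)
  show ?thesis
  proof (rule that[of k "\<lambda>i. c *\<^sub>R x i"])
    show "k > 0" using \<sigma> by (cases k) (auto simp: \<sigma>_def)
    show "(\<Sum>i<k. (norm (c *\<^sub>R x i))\<^sup>2) = (1/2)^j"
    proof -
      have "(\<Sum>i<k. (norm (c *\<^sub>R x i))\<^sup>2) = c\<^sup>2 * \<sigma>"
        by (simp add: power_mult_distrib \<sigma>_def sum_distrib_left)
      then show ?thesis using \<sigma> by (simp add: c2)
    qed
    have "4 ^ j = (1/2)^j / \<sigma> * (8 ^ j * \<sigma>)" using \<sigma> by (simp flip: power_mult_distrib)
    also have "\<dots> < (1/2)^j / \<sigma> * rademacher_moment k x"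
      using \<sigma> kx by (intro mult_strict_left_mono) (auto simp: \<sigma>_def)
    finally show "rademacher_moment k (\<lambda>i. c *\<^sub>R x i) > 4 ^ j" by (simp add: rademacher_moment_scale c2)
  qed
qed

text \<open>
  A mixture over \<open>j\<close> of random signs times a uniformly chosen vector of the \<open>j\<close>-th block
  \<open>y j 0, \<dots>, y j (k j - 1)\<close>. The weight \<open>(1/2)\<^sup>j\<^sup>+\<^sup>1\<close> of the \<open>j\<close>-th block and the size \<open>k j\<close> are
  compensated in \<open>value_of\<close>, so that the part of the variable in block \<open>j\<close> has the covariance of
  \<open>\<Sum>i<k j. g i *\<^sub>R y j i\<close> with standard normal \<open>g i\<close>.
\<close>

context
  fixes k :: "nat \<Rightarrow> nat" and y :: "nat \<Rightarrow> nat \<Rightarrow> 'b::{banach,second_countable_topology}"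
  assumes k: "\<And>j. k j > 0"
    and y2: "\<And>j. (\<Sum>i<k j. (norm (y j i))\<^sup>2) = (1/2) ^ j"
begin

definition "block_pmf = geometric_pmf (1/2) \<bind> (\<lambda>j. pmf_of_set {..<k j} \<bind> (\<lambda>i. map_pmf (\<lambda>s. (j, i, s)) sign_pmf))"

definition coef :: "nat \<Rightarrow> real" where "coef j = sqrt (real (k j) * 2 ^ (j + 1))"

definition value_of :: "nat \<times> nat \<times> real \<Rightarrow> 'b" where
  "value_of = (\<lambda>(j, i, s). (s * coef j) *\<^sub>R y j i)"

private lemma coef2: "(coef j)\<^sup>2 = real (k j) * 2 ^ (j + 1)" and coef_pos: "coef j > 0"
  using k[of j] by (auto simp: coef_def)

lemma nn_integral_block:
  "(\<integral>\<^sup>+z. F z \<partial>block_pmf) =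
    (\<integral>\<^sup>+j. (\<Sum>i<k j. (F (j, i, -1) + F (j, i, 1)) / 2) / of_nat (k j) \<partial>geometric_pmf (1/2))"
  using k by (simp add: block_pmf_def nn_integral_bind_pmf nn_integral_map_pmf nn_integral_sign nn_integral_pmf_of_set
      lessThan_empty_iff)

lemma block_pmf_sign_flip: "map_pmf (\<lambda>(j, i, s). (j, i, - s)) block_pmf = block_pmf"
proof -
  have "map_pmf uminus sign_pmf = sign_pmf"
    by (subst map_pmf_of_set_inj) (auto intro: inj_onI simp: insert_commute)
  then have "map_pmf (\<lambda>s. (j, i, - s)) sign_pmf = map_pmf (\<lambda>s. (j, i, s)) sign_pmf" for j i :: nat
    by (metis (no_types, lifting) map_pmf_comp map_pmf_cong)
  then show ?thesis
    by (simp add: block_pmf_def map_bind_pmf map_pmf_comp)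
qed

lemma integral_block_odd:
  fixes F :: "nat \<times> nat \<times> real \<Rightarrow> 'c::{banach,second_countable_topology}"
  assumes "\<And>j i s. F (j, i, - s) = - F (j, i, s)"
  shows "(\<integral>z. F z \<partial>block_pmf) = 0"
proof -
  have "(\<integral>z. F z \<partial>block_pmf) = (\<integral>z. F z \<partial>map_pmf (\<lambda>(j, i, s). (j, i, - s)) block_pmf)"
    by (simp add: block_pmf_sign_flip)
  also have "\<dots> = (\<integral>z. - F z \<partial>block_pmf)"
    by (simp add: assms case_prod_beta')
  finally have "(\<integral>z. F z \<partial>block_pmf) = - (\<integral>z. F z \<partial>block_pmf)" by simp
  then show ?thesis by (simp add: eq_neg_iff_add_eq_0 flip: scaleR_2)
qed

text \<open>Given block \<open>j\<close>, the uniform choice cancels \<open>k j\<close> and the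
  normalization of the block cancels \<open>2 ^ j\<close>, leaving the conditional second moment 2
  for every \<open>j\<close>.\<close>

lemma second_moment_value_of: "second_moment block_pmf value_of \<le> 2"
proof -
  have "(\<Sum>i<k j. (ennreal ((norm (value_of (j, i, -1)))\<^sup>2) + ennreal ((norm (value_of (j, i, 1)))\<^sup>2)) / 2) / of_nat (k j) = 2" for j
  proof -
    have "(ennreal a + ennreal a) / 2 = ennreal a" for a
      by (rule ennreal_add_self_half)
    then have "(\<Sum>i<k j. (ennreal ((norm (value_of (j, i, -1)))\<^sup>2) + ennreal ((norm (value_of (j, i, 1)))\<^sup>2)) / 2) =
      (\<Sum>i<k j. ennreal ((coef j)\<^sup>2 * (norm (y j i))\<^sup>2))"
      by (intro sum.cong) (simp_all add: value_of_def power_mult_distrib)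
    also have "\<dots> = ennreal ((coef j)\<^sup>2 * (1/2)^j)"
      by (subst sum_ennreal) (simp_all add: y2 flip: sum_distrib_left)
    also have "(coef j)\<^sup>2 * (1/2)^j = 2 * real (k j)" by (simp add: coef2 power_divide)
    finally show ?thesis using k[of j]
      by (simp add: ennreal_mult ennreal_of_nat_eq_real_of_nat ennreal_mult_divide_eq)
  qed
  then show ?thesis unfolding nn_integral_block by (simp add: measure_pmf.emeasure_space_1[simplified])
qed

lemma integrable_value_of: "integrable block_pmf value_of"
  by (rule integrable_of_square[OF measure_pmf.prob_space_axioms])
     (use second_moment_value_of in \<open>auto intro: le_less_trans\<close>)

lemma mean_value_of: "(\<integral>z. value_of z \<partial>block_pmf) = 0"
  by (rule integral_block_odd) (simp add: value_of_def)

text \<open>The guard on the second component holds almost surely in block \<open>j\<close>; it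
  makes the expansion into the vectors \<open>y j i\<close> with \<open>i < k j\<close> valid at
  every point.\<close>

definition block_part :: "nat \<Rightarrow> nat \<times> nat \<times> real \<Rightarrow> 'b" where
  "block_part j z = (if fst z = j \<and> fst (snd z) < k j then value_of z else 0)"

text \<open>Given an index in another block, the value is \<open>v\<close> or \<open>- v\<close>
  with equal probability, and the squared norm at the midpoint \<open>s\<close> is at most the mean
  of those at \<open>s - v\<close> and \<open>s + v\<close>. Discarding the other blocks thus lowers
  the second moment.\<close>

lemma block_part_dominated:
  "second_moment block_pmf (\<lambda>z. s + block_part j z) \<le> second_moment block_pmf (\<lambda>z. s + value_of z)"
proof -
  have mid: "(ennreal ((norm s)\<^sup>2) + ennreal ((norm s)\<^sup>2)) / 2 \<le> (ennreal ((norm (s - v))\<^sup>2) + ennreal ((norm (s + v))\<^sup>2)) / 2" for v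
  proof -
    have "2 * norm s = norm ((s - v) + (s + v))" by (simp flip: scaleR_2)
    also have "\<dots> \<le> norm (s - v) + norm (s + v)" by (rule norm_triangle_ineq)
    finally have "(2 * norm s)\<^sup>2 \<le> (norm (s - v) + norm (s + v))\<^sup>2" by (intro power_mono) auto
    also have "\<dots> \<le> 2 * ((norm (s - v))\<^sup>2 + (norm (s + v))\<^sup>2)"
      using zero_le_power2[of "norm (s - v) - norm (s + v)"] by (simp add: power2_eq_square algebra_simps)
    finally have "(norm s)\<^sup>2 + (norm s)\<^sup>2 \<le> (norm (s - v))\<^sup>2 + (norm (s + v))\<^sup>2"
      by (simp add: power_mult_distrib)
    then show ?thesis
      by (intro divide_right_mono_ennreal)
         (simp only: ennreal_plus[OF zero_le_power2 zero_le_power2, symmetric] ennreal_leI)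
  qed
  show ?thesis unfolding nn_integral_block
  proof (rule nn_integral_mono, rule divide_right_mono_ennreal, rule sum_mono)
    fix j' i
    assume i: "i \<in> {..<k j'}"
    show "(ennreal ((norm (s + block_part j (j', i, -1)))\<^sup>2) + ennreal ((norm (s + block_part j (j', i, 1)))\<^sup>2)) / 2 \<le>
      (ennreal ((norm (s + value_of (j', i, -1)))\<^sup>2) + ennreal ((norm (s + value_of (j', i, 1)))\<^sup>2)) / 2"
    proof (cases "j' = j")
      case True
      then show ?thesis using i by (simp add: block_part_def)
    next
      case False
      then show ?thesis using mid[of "coef j' *\<^sub>R y j' i"] by (simp add: block_part_def value_of_def)
    qed
  qed
qed

text \<open>For different \<open>i\<close> the supports are disjoint, and the square of
  \<open>coef j\<close> is the reciprocal of the probability of the support. Thus these are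
  orthonormal coordinates for block \<open>j\<close>.\<close>

definition block_coord :: "nat \<Rightarrow> nat \<Rightarrow> nat \<times> nat \<times> real \<Rightarrow> real" where
  "block_coord j i z = (if fst z = j \<and> fst (snd z) = i then snd (snd z) * coef j else 0)"

lemma block_part_eq: "block_part j z = (\<Sum>i<k j. block_coord j i z *\<^sub>R y j i)"
proof -
  obtain j' i' s where z: "z = (j', i', s)" by (cases z)
  show ?thesis by (auto simp: z block_part_def block_coord_def value_of_def if_distrib[of "\<lambda>a. a *\<^sub>R _"] cong: if_cong)
qed

lemma block_coord_orthonormal:
  assumes i: "i < k j"
  shows "integrable block_pmf (\<lambda>z. block_coord j i z * block_coord j i' z)"
    "(\<integral>z. block_coord j i z * block_coord j i' z \<partial>block_pmf) = (if i = i' then 1 else 0)"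
proof -
  have zero: "block_coord j i z * block_coord j i' z = 0" if "i \<noteq> i'" for z
    using that by (auto simp: block_coord_def)
  have geo: "pmf (geometric_pmf (1/2)) j * 2 ^ (j + 1) = 1"
    by (simp add: pmf_geometric power_divide)
  have inner: "(\<Sum>a<k j'. (ennreal (block_coord j i (j', a, -1) * block_coord j i (j', a, -1)) +
      ennreal (block_coord j i (j', a, 1) * block_coord j i (j', a, 1))) / 2) / of_nat (k j') =
      ennreal (2 ^ (j + 1)) * indicator {j} j'" for j'
  proof (cases "j' = j")
    case True
    have half: "(ennreal a + ennreal a) / 2 = ennreal a" for a
      by (rule ennreal_add_self_half)
    have "(\<Sum>a<k j. (ennreal (block_coord j i (j, a, -1) * block_coord j i (j, a, -1)) +
      ennreal (block_coord j i (j, a, 1) * block_coord j i (j, a, 1))) / 2) = (\<Sum>a<k j. if a = i then ennreal ((coef j)\<^sup>2) else 0)"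
      by (intro sum.cong) (auto simp: block_coord_def half power2_eq_square)
    also have "\<dots> = ennreal (2 ^ (j + 1)) * of_nat (k j)"
      using i by (simp add: coef2 ennreal_mult ennreal_of_nat_eq_real_of_nat mult_ac)
    finally show ?thesis using True k[of j] by (simp add: ennreal_mult_divide_eq)
  qed (simp add: block_coord_def)
  have nn: "(\<integral>\<^sup>+z. ennreal (block_coord j i z * block_coord j i z) \<partial>block_pmf) = 1"
  proof -
    have "(\<integral>\<^sup>+z. ennreal (block_coord j i z * block_coord j i z) \<partial>block_pmf) =
      ennreal (2 ^ (j + 1)) * emeasure (geometric_pmf (1/2)) {j}"
      unfolding nn_integral_block inner by (subst nn_integral_cmult_indicator) auto
    also have "\<dots> = 1" using geo by (simp add: emeasure_pmf_single mult.commute flip: ennreal_mult')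
    finally show ?thesis .
  qed
  have "integrable block_pmf (\<lambda>z. block_coord j i z * block_coord j i z)"
    by (rule integrableI_nonneg) (auto simp: nn)
  then show "integrable block_pmf (\<lambda>z. block_coord j i z * block_coord j i' z)"
    by (cases "i = i'") (simp_all only: zero integrable_zero not_False_eq_True)
  have "(\<integral>z. block_coord j i z * block_coord j i z \<partial>block_pmf) = 1"
    by (subst integral_eq_nn_integral) (auto simp: nn)
  then show "(\<integral>z. block_coord j i z * block_coord j i' z \<partial>block_pmf) = (if i = i' then 1 else 0)"
    by (cases "i = i'") (simp_all only: zero if_True if_False integral_zero simp_thms)
qed

lemma block_coord_integrable: "integrable block_pmf (block_coord j i)"
  and block_coord_mean: "(\<integral>z. block_coord j i z \<partial>block_pmf) = 0"
proof -
  have s: "s \<in> {-1, 1}" if "(j', i', s) \<in> set_pmf block_pmf" for j' i' s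
    using that by (auto simp: block_pmf_def)
  show "integrable block_pmf (block_coord j i)"
    by (rule measure_pmf.integrable_const_bound[of _ "coef j"])
       (use s coef_pos[of j] in \<open>fastforce simp: AE_measure_pmf_iff block_coord_def abs_mult\<close>)+
  show "(\<integral>z. block_coord j i z \<partial>block_pmf) = 0"
    by (rule integral_block_odd) (simp add: block_coord_def)
qed

text \<open>A limit along a subsequence bounds the sums of the full variable by
  \<open>K * n\<close>, and dropping the other blocks keeps this bound. The multivariate theorem for
  block \<open>j\<close> alone carries it to the Gaussian sum, with \<open>K\<close> independent of
  \<open>j\<close>.\<close>

lemma rademacher_moment_le_of_CLTSS:
  assumes co: "cotype2 TYPE('b)" and clt: "CLTSS block_pmf value_of"
  obtains K where "\<And>j. 2 / pi * rademacher_moment (k j) (y j) \<le> K"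
proof -
  have M: "prob_space (measure_pmf block_pmf)" by (rule measure_pmf.prob_space_axioms)
  obtain K where K: "K \<ge> 0" "\<And>n. second_moment (iid_seq block_pmf) (psum (\<lambda>_. value_of) n) \<le> ennreal (K * real n)"
    using cotype2_CLTSS_moments(4)[OF co M _ clt] by auto
  have "2 / pi * rademacher_moment (k j) (y j) \<le> K" for j
  proof -
    have "ennreal (2 / pi * rademacher_moment (k j) (y j)) \<le> second_moment (iid_seq gauss) (\<lambda>g. \<Sum>i<k j. g i *\<^sub>R y j i)"
      by (rule rademacher_moment_le_gauss)
    also have "\<dots> \<le> ennreal K"
    proof (rule second_moment_weak_limit[OF M prob_space_iid_seq[OF prob_space_gauss], where h = "block_part j"])
      fix f :: "'b \<Rightarrow> real" assume f: "continuous_on UNIV f" "\<And>v. \<bar>f v\<bar> \<le> 1"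
      show "(\<lambda>n. \<integral>\<omega>. f (nsum (block_part j) n \<omega>) \<partial>iid_seq block_pmf) \<longlonglongrightarrow>
        (\<integral>g. f (\<Sum>i<k j. g i *\<^sub>R y j i) \<partial>iid_seq gauss)"
        unfolding block_part_eq[abs_def]
        using block_coord_orthonormal by (intro multivariate_clt M f block_coord_mean block_coord_integrable) auto
    next
      fix n
      have "second_moment (iid_seq block_pmf) (\<lambda>\<omega>. 0 + psum (\<lambda>_. block_part j) n \<omega>) \<le>
        second_moment (iid_seq block_pmf) (\<lambda>\<omega>. 0 + psum (\<lambda>_. value_of) n \<omega>)"
        using block_part_dominated
        by (intro nn_integral_psum_mono[where F = "\<lambda>v. ennreal ((norm v)\<^sup>2)"] M) auto
      with K(2)[of n] show "second_moment (iid_seq block_pmf) (psum (\<lambda>_. block_part j) n) \<le> ennreal (K * real n)"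
        by simp
    qed (use K(1) in auto)
    finally show ?thesis using K(1) by (simp add: ennreal_le_iff)
  qed
  then show ?thesis by (rule that)
qed

end

text \<open>The condition depends only on the law, so the mixture is replaced by its law on the
  Banach space with the identity as random variable. Discreteness makes every set measurable, hence
  the probability space complete.\<close>

lemma not_type2_counterexample:
  assumes co: "cotype2 TYPE('b::{banach,second_countable_topology})" and ty: "\<not> type2 TYPE('b)"
  shows "\<exists>(M::'b measure) (X::'b \<Rightarrow> 'b). prob_space M \<and> complete_measure M \<and> X \<in> borel_measurable M \<and>
     (integrable M X \<and> (\<integral>\<omega>. X \<omega> \<partial>M) = 0) \<and> integrable M (\<lambda>\<omega>. (norm (X \<omega>))\<^sup>2) \<and> \<not> CLTSS M X \<and> \<not> CLT M X"
proof -
  have "\<exists>k (y::nat \<Rightarrow> 'b). k > 0 \<and> (\<Sum>i<k. (norm (y i))\<^sup>2) = (1/2) ^ j \<and> rademacher_moment k y > 4 ^ j" for j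
    by (rule not_type2_vectors[OF ty, of j]) blast
  then obtain k and y :: "nat \<Rightarrow> nat \<Rightarrow> 'b" where k: "\<And>j. k j > 0"
    and y: "\<And>j. (\<Sum>i<k j. (norm (y j i))\<^sup>2) = (1/2) ^ j" and big: "\<And>j. rademacher_moment (k j) (y j) > 4 ^ j"
    by metis
  define q where "q = block_pmf k"
  define v where "v = value_of k y"
  define M where "M = measure_pmf (map_pmf v q)"
  have notq: "\<not> CLTSS q v"
  proof
    assume "CLTSS q v"
    then obtain K where K: "\<And>j. 2 / pi * rademacher_moment (k j) (y j) \<le> K"
      using rademacher_moment_le_of_CLTSS[OF k y co] unfolding q_def v_def by blast
    obtain j where j: "K * pi / 2 < 4 ^ j" using real_arch_pow[of "4::real" "K * pi / 2"] by auto
    have "rademacher_moment (k j) (y j) \<le> K * pi / 2" using K[of j] by (simp add: field_simps)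
    with j big[of j] show False by linarith
  qed
  have "distr M borel (\<lambda>x. x) = distr q borel v"
    unfolding M_def map_pmf_rep_eq by (subst distr_distr) (auto simp: comp_def)
  then have "CLTSS M (\<lambda>x. x) \<longleftrightarrow> CLTSS q v" unfolding CLTSS_def iid_space_def by simp
  with notq have notM: "\<not> CLTSS M (\<lambda>x. x)" by simp
  have i2: "integrable q (\<lambda>z. (norm (v z))\<^sup>2)"
    using second_moment_value_of[OF k y] unfolding q_def v_def
    by (intro integrableI_nonneg) (auto intro: le_less_trans)
  show ?thesis
  proof (intro exI[of _ M] exI[of _ "\<lambda>x. x"] conjI)
    show "prob_space M" unfolding M_def by (rule measure_pmf.prob_space_axioms)
    show "complete_measure M" by standard (simp add: M_def)
    show "integrable M (\<lambda>x. x)" using integrable_value_of[OF k y] by (simp add: M_def q_def v_def)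
    show "(\<integral>x. x \<partial>M) = 0" using mean_value_of[OF k y] by (simp add: M_def q_def v_def)
    show "integrable M (\<lambda>x. (norm x)\<^sup>2)" using i2 by (simp add: M_def)
    show "\<not> CLTSS M (\<lambda>x. x)" "\<not> CLT M (\<lambda>x. x)" using notM CLT_imp_CLTSS by blast+
  qed (simp add: M_def)
qed

theorem theorem1:
  shows
    "(cotype2 TYPE('b::{banach,second_countable_topology}) \<and> type2 TYPE('b) \<longrightarrow>
        (\<forall>(M::'a measure) (X::'a \<Rightarrow> 'b). prob_space M \<longrightarrow> X \<in> borel_measurable M \<longrightarrow>
           (CLT M X \<longleftrightarrow> CLTSS M X) \<and>
           (CLTSS M X \<longleftrightarrow>
              (integrable M X \<and> (\<integral>\<omega>. X \<omega> \<partial>M) = 0) \<and> integrable M (\<lambda>\<omega>. (norm (X \<omega>))\<^sup>2))))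
     \<and>
     (cotype2 TYPE('b) \<and> \<not> type2 TYPE('b) \<longrightarrow>
        (\<forall>(M::'a measure) (X::'a \<Rightarrow> 'b). prob_space M \<longrightarrow> X \<in> borel_measurable M \<longrightarrow>
           (CLT M X \<longleftrightarrow> CLTSS M X) \<and>
           (CLTSS M X \<longrightarrow>
              (integrable M X \<and> (\<integral>\<omega>. X \<omega> \<partial>M) = 0) \<and> integrable M (\<lambda>\<omega>. (norm (X \<omega>))\<^sup>2)))
        \<and>
        (\<exists>(M::'b measure) (X::'b \<Rightarrow> 'b). prob_space M \<and> complete_measure M \<and>
           X \<in> borel_measurable M \<and>
           (integrable M X \<and> (\<integral>\<omega>. X \<omega> \<partial>M) = 0) \<and> integrable M (\<lambda>\<omega>. (norm (X \<omega>))\<^sup>2) \<and>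
           \<not> CLTSS M X \<and> \<not> CLT M X))"
proof -
  have clt: "CLT M X \<longleftrightarrow> CLTSS M X"
    if "cotype2 TYPE('b)" "prob_space M" "X \<in> borel_measurable M" for M :: "'a measure" and X :: "'a \<Rightarrow> 'b"
    using CLT_imp_CLTSS cotype2_CLTSS_imp_CLT[OF that] by blast
  have moments: "(integrable M X \<and> (\<integral>\<omega>. X \<omega> \<partial>M) = 0) \<and> integrable M (\<lambda>\<omega>. (norm (X \<omega>))\<^sup>2)"
    if "cotype2 TYPE('b)" "prob_space M" "X \<in> borel_measurable M" "CLTSS M X" for M :: "'a measure" and X :: "'a \<Rightarrow> 'b"
    using cotype2_CLTSS_moments[OF that] that(3) by (auto intro!: integrableI_nonneg)
  have conv: "CLTSS M X"
    if "type2 TYPE('b)" "prob_space M" and X[measurable]: "X \<in> borel_measurable M" and mean: "(\<integral>\<omega>. X \<omega> \<partial>M) = 0"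
      and sq: "integrable M (\<lambda>\<omega>. (norm (X \<omega>))\<^sup>2)" for M :: "'a measure" and X :: "'a \<Rightarrow> 'b"
  proof -
    have "(\<integral>\<^sup>+\<omega>. ennreal ((norm (X \<omega>))\<^sup>2) \<partial>M) < \<infinity>"
      by (subst nn_integral_eq_integral[OF sq]) auto
    then show ?thesis by (intro CLT_imp_CLTSS type2_moments_imp_CLT that)
  qed
  show ?thesis
    using clt moments conv not_type2_counterexample[where 'b = 'b] by (intro conjI impI allI) blast+
qed

end
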